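(* Let $(S,N,Z)$ be a structured semigroup such that $Z$ is symmetric. Then the directed coset bundle representation $\widetilde{\mathcal{D}}:a\mapsto\widetilde{a}_\mathcal{D}$, where $\widetilde{a}_\mathcal{D}$ is the slice-section of $\rho_\mathcal{D}:\widetilde{\mathcal{D}}(S)\to\mathcal{D}(S)$ with domain $\mathcal{D}_a=\{D\in\mathcal{D}(S):a\in D\}$ and $\widetilde{a}_\mathcal{D}(D)=[a,D]$, is a Zakrzewski-universal bundle representation of $(S,N,Z)$.
   Context: STRUCTURED SEMIGROUPS. A structured semigroup $(S,N,Z)$ consists of a semigroup $S$, a subsemigroup $N$ of $S$ and a subsemigroup $Z$ of $S$ with $Z\subseteq\mathsf{Z}(N)=\{z\in N:\forall n\in N\ (nz=zn)\}$, such that: (i) for all $a,b\in S$, $ab,ba\in Z$ implies $aZb\cup bZa\subseteq Z$; (ii) for all $a,b\in S$ and $n\in N$, if $abn=n=nab$ and $ab,ba\in Z$ then $bna\in N$. $Z$ is symmetric if for all $a,b\in S$, $ab\in Z$ implies $baba\in Z$. For $a,s,b\in S$: $a<_sb$ means $asb=a=bsa$, $as,sa\in N$ and $bs,sb\in Z$; $a<b$ means $a<_sb$ for some $s\in S$. For $A,B\subseteq S$: $AB=\{ab:a\in A,b\in B\}$, $A^<=\{b\in S:\exists a\in A\ (a<b)\}$ and $A^*=\{s\in S:\exists a\in A\,\exists b\in S\ (a<_sb)\}$. An atlas is an $A\subseteq S$ with $AA^*A\subseteq A\subseteq A^<$; a coset is a $C\subseteq S$ with $CC^*C\subseteq C=C^<$.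 For an atlas $A$, put $\mathsf{s}(A)=(A^*A)^<$, $\mathsf{r}(A)=(AA^* )^<$. $\mathcal{C}(S)$ is the set of non-empty cosets, an étale groupoid with inverse $C\mapsto C^*$, product $B\cdot C=(BC)^<$ defined when $\mathsf{s}(B)=\mathsf{r}(C)$, and the topology with subbasis $\mathcal{C}_a=\{C\in\mathcal{C}(S):a\in C\}$, $a\in S$. $D\subseteq S$ is directed if for all $a,b\in D$ there is $d\in D$ with $d<a$ and $d<b$. $\mathcal{D}(S)=\{D\in\mathcal{C}(S):D\text{ is directed}\}$, an étale subgroupoid of $\mathcal{C}(S)$ with the subspace topology. DIRECTED COSET BUNDLE. For an atlas $A$, $\sim_A$ is the equivalence relation on $A^<$ given by $a\sim_Ab\Leftrightarrow\exists s,t\in A^*\ (sat=sbt)$. For $a\in A^<$, $[a,A]=(a^{\sim_A},A^<)$, where $a^{\sim_A}$ is the $\sim_A$-class of $a$. $\widetilde{\mathcal{C}}(S)=\{[c,C]:c\in C\in\mathcal{C}(S)\}$ is a groupoid under $[a,A][b,B]=[ab,AB]$ when $\mathsf{s}(A)=\mathsf{r}(B)$, $\rho_\mathcal{C}([a,A])=A^<$, and the topology on $\widetilde{\mathcal{C}}(S)$ is generated by the sets $\{[s,C]:s\in C\in\mathcal{C}(S)\}$ and $\rho_\mathcal{C}^{-1}[\mathcal{C}_s]$, $s\in S$. $\widetilde{\mathcal{D}}(S)=\rho_\mathcal{C}^{-1}[\mathcal{D}(S)]$ with the subspace topology, and $\rho_\mathcal{D}:\widetilde{\mathcal{D}}(S)\to\mathcal{D}(S)$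 is the restriction of $\rho_\mathcal{C}$, a groupoid bundle. GROUPOID BUNDLES. For a groupoid $G$, $G^0$ is its set of units, $\mathsf{s}(g)=g^{-1}g$, $\mathsf{r}(g)=gg^{-1}$, $gh$ is defined iff $\mathsf{s}(g)=\mathsf{r}(h)$. A slice is a subset on which $\mathsf{s}$ and $\mathsf{r}$ are injective. A topological groupoid (continuous inverse and product) is étale if $\mathsf{s}$ maps open subsets of $G$ to open subsets of $G$; no Hausdorff assumptions. $\mathcal{O}(X)$ denotes the open subsets of $X$; $\mathcal{B}(G)$ is the semigroup of open slices of $G$ under pointwise products. A groupoid bundle is a map $\pi:F\to G$ with $F$ a topological groupoid, $G$ an étale groupoid and $\pi$ an open continuous functor injective on units. A slice-section of $\pi$ is a continuous map $a$ into $F$ whose domain is an open slice of $G$ with $\pi(a(g))=g$ for $g\in\mathrm{dom}(a)$. $\mathcal{S}(\pi)$ is the semigroup of slice-sections under $ab(gh)=a(g)b(h)$ ($g\in\mathrm{dom}(a)$, $h\in\mathrm{dom}(b)$, $gh$ defined). MORPHISMS. A relation $\phi\subseteq G\times H$ is viewed as going from $H$ to $G$; $\phi^{-1}[G']=\{h:\exists g\in G'\,(g\mathrel\phi h)\}$. It is functorial if $g\mathrel\phi h$ implies $g^{-1}\mathrel\phi h^{-1}$, and $g\mathrel\phi h$, $g'\mathrel\phi h'$, $\mathsf{s}(h)=\mathsf{r}(h')$ imply $\mathsf{s}(g)=\mathsf{r}(g')$ and $gg'\mathrel\phi hh'$. A functorial $\phi$ is star-bijective if whenever $\mathsf{r}(g)\mathrel\phi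 h\in H^0$ there is precisely one $i\in H$ with $\mathsf{r}(i)=h$ and $g\mathrel\phi i$. A Zakrzewski morphism between étale groupoids is a star-bijective functorial $\phi\subseteq G\times H$ with $\phi^{-1}[O]$ open for all open $O\subseteq G$. For a groupoid bundle $\pi:F\to G$ and a Zakrzewski morphism $\phi\subseteq G\times G'$, $\phi^\pi F=\{(f,g')\in F\times G':\pi(f)\mathrel\phi g'\}$ is a topological groupoid (subspace topology) under $(f,g')(e,h')=(fe,g'h')$ when $g'h'$ is defined. A Zakrzewski-Pierce morphism from $\pi:F\to G$ to $\pi':F'\to G'$ is a pair $(\phi,\tau)$ with $\phi\subseteq G\times G'$ a Zakrzewski morphism and $\tau:\phi^\pi F\to F'$ a continuous functor with $\pi'(\tau(f,g'))=g'$ for all $(f,g')\in\phi^\pi F$. Each such pair yields a semigroup homomorphism $\tfrac{\tau}{\phi}:\mathcal{S}(\pi)\to\mathcal{S}(\pi')$ with $\mathrm{dom}(\tfrac{\tau}{\phi}(a))=\phi^{-1}[\mathrm{dom}(a)]$ and $\tfrac{\tau}{\phi}(a)(g')=\tau(a(g),g')$, where $g$ is the unique element of $\mathrm{dom}(a)$ with $g\mathrel\phi g'$. REPRESENTATIONS. An étale representation of $(S,N,Z)$ on an étale groupoid $G$ is a semigroup homomorphism $\theta:S\to\mathcal{B}(G)$ with $\bigcup_{a\in S}\theta(a)=G$, $\theta[N]\subseteq\mathcal{O}(G^0)$ and such that $g\in\theta(a)$ implies $g\in\theta(b)$ for some $b<a$. A bundle representation of $(S,N,Z)$ on a groupoid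 bundle $\pi:F\to G$ is a semigroup homomorphism $\theta:S\to\mathcal{S}(\pi)$ such that $a\mapsto\mathrm{dom}(\theta(a))$ is an étale representation on $G$. A bundle representation $\mu:S\to\mathcal{S}(\pi)$ is Zakrzewski-universal if for every bundle representation $\theta:S\to\mathcal{S}(\pi')$ (on any groupoid bundle $\pi'$) there is a unique Zakrzewski-Pierce morphism $(\phi,\tau)$ from $\pi$ to $\pi'$ with $\theta=\tfrac{\tau}{\phi}\circ\mu$. *)

theory Defs
  imports "HOL-Analysis.Analysis" "HOL-Library.Set_Algebras"
begin

section \<open>Structured semigroups\<close>

text \<open>
  The semigroup \<open>S\<close> is the type \<open>'a\<close>. Products of subsets are those of
  \<open>Set_Algebras\<close>, so \<open>A * B = {a * b | a \<in> A, b \<in> B}\<close>. The subsemigroups \<open>N\<close> and \<open>Z\<close>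
  are allowed to be empty.
\<close>

definition structured_semigroup :: "'a::semigroup_mult set \<Rightarrow> 'a set \<Rightarrow> bool" where
  "structured_semigroup N Z \<longleftrightarrow>
     (\<forall>m\<in>N. \<forall>n\<in>N. m * n \<in> N) \<and>
     (\<forall>y\<in>Z. \<forall>z\<in>Z. y * z \<in> Z) \<and>
     Z \<subseteq> {z \<in> N. \<forall>n\<in>N. n * z = z * n} \<and>
     (\<forall>a b. a * b \<in> Z \<and> b * a \<in> Z \<longrightarrow> {a} * Z * {b} \<union> {b} * Z * {a} \<subseteq> Z) \<and>
     (\<forall>a b. \<forall>n\<in>N. a * b * n = n \<and> n = n * a * b \<and> a * b \<in> Z \<and> b * a \<in> Z
        \<longrightarrow> b * n * a \<in> N)"

definition symmetric_subsemigroup :: "'a::semigroup_mult set \<Rightarrow> bool" where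
  "symmetric_subsemigroup Z \<longleftrightarrow> (\<forall>a b. a * b \<in> Z \<longrightarrow> b * a * b * a \<in> Z)"

text \<open>\<open>below_via N Z a s b\<close> is \<open>a <\<^sub>s b\<close> and \<open>below N Z a b\<close> is \<open>a < b\<close>.\<close>

definition below_via :: "'a::semigroup_mult set \<Rightarrow> 'a set \<Rightarrow> 'a \<Rightarrow> 'a \<Rightarrow> 'a \<Rightarrow> bool" where
  "below_via N Z a s b \<longleftrightarrow>
     a * s * b = a \<and> a = b * s * a \<and>
     a * s \<in> N \<and> s * a \<in> N \<and> b * s \<in> Z \<and> s * b \<in> Z"

definition below :: "'a::semigroup_mult set \<Rightarrow> 'a set \<Rightarrow> 'a \<Rightarrow> 'a \<Rightarrow> bool" where
  "below N Z a b \<longleftrightarrow> (\<exists>s. below_via N Z a s b)"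

definition up :: "'a::semigroup_mult set \<Rightarrow> 'a set \<Rightarrow> 'a set \<Rightarrow> 'a set" where
  "up N Z A = {b. \<exists>a\<in>A. below N Z a b}"

definition star :: "'a::semigroup_mult set \<Rightarrow> 'a set \<Rightarrow> 'a set \<Rightarrow> 'a set" where
  "star N Z A = {s. \<exists>a\<in>A. \<exists>b. below_via N Z a s b}"

definition coset :: "'a::semigroup_mult set \<Rightarrow> 'a set \<Rightarrow> 'a set \<Rightarrow> bool" where
  "coset N Z C \<longleftrightarrow> C * star N Z C * C \<subseteq> C \<and> C = up N Z C"

definition source :: "'a::semigroup_mult set \<Rightarrow> 'a set \<Rightarrow> 'a set \<Rightarrow> 'a set" where
  "source N Z A = up N Z (star N Z A * A)"

definition range_coset :: "'a::semigroup_mult set \<Rightarrow> 'a set \<Rightarrow> 'a set \<Rightarrow> 'a set" where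
  "range_coset N Z A = up N Z (A * star N Z A)"

definition directed :: "'a::semigroup_mult set \<Rightarrow> 'a set \<Rightarrow> 'a set \<Rightarrow> bool" where
  "directed N Z D \<longleftrightarrow> (\<forall>a\<in>D. \<forall>b\<in>D. \<exists>d\<in>D. below N Z d a \<and> below N Z d b)"


section \<open>Topological and etale groupoids\<close>

text \<open>
  The underlying set of a groupoid is the \<open>topspace\<close> of its topology. The product is a total
  function of which only the values at pairs related by \<open>gcomp\<close> (``\<open>g h\<close> is defined'') matter.
\<close>

record 'g top_groupoid =
  gtop  :: "'g topology"
  gcomp :: "'g \<Rightarrow> 'g \<Rightarrow> bool"
  gmult :: "'g \<Rightarrow> 'g \<Rightarrow> 'g"
  ginv  :: "'g \<Rightarrow> 'g"

definition gset :: "'g top_groupoid \<Rightarrow> 'g set" where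
  "gset G = topspace (gtop G)"

definition gsrc :: "'g top_groupoid \<Rightarrow> 'g \<Rightarrow> 'g" where
  "gsrc G g = gmult G (ginv G g) g"

definition grng :: "'g top_groupoid \<Rightarrow> 'g \<Rightarrow> 'g" where
  "grng G g = gmult G g (ginv G g)"

definition gunits :: "'g top_groupoid \<Rightarrow> 'g set" where
  "gunits G = gsrc G ` gset G"

text \<open>
  Hahn's axioms for a groupoid. That \<open>g h\<close> is defined exactly when \<open>s(g) = r(h)\<close> is a consequence,
  see \<open>gcomp_iff\<close> below.
\<close>

definition groupoid :: "'g top_groupoid \<Rightarrow> bool" where
  "groupoid G \<longleftrightarrow>
     (\<forall>g h. gcomp G g h \<longrightarrow> g \<in> gset G \<and> h \<in> gset G \<and> gmult G g h \<in> gset G) \<and>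
     (\<forall>g\<in>gset G. ginv G g \<in> gset G \<and> ginv G (ginv G g) = g \<and> gcomp G g (ginv G g)) \<and>
     (\<forall>g h k. gcomp G g h \<and> gcomp G h k \<longrightarrow>
        gcomp G (gmult G g h) k \<and> gcomp G g (gmult G h k) \<and>
        gmult G (gmult G g h) k = gmult G g (gmult G h k)) \<and>
     (\<forall>g h. gcomp G g h \<longrightarrow>
        gmult G (ginv G g) (gmult G g h) = h \<and> gmult G (gmult G g h) (ginv G h) = g)"

lemma gcomp_iff:
  assumes "groupoid G" "g \<in> gset G" "h \<in> gset G"
  shows "gcomp G g h \<longleftrightarrow> gsrc G g = grng G h"
proof -
  have inv: "\<And>x. x \<in> gset G \<Longrightarrow> ginv G x \<in> gset G \<and> ginv G (ginv G x) = x \<and> gcomp G x (ginv G x)"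
    and ass: "\<And>x y z. gcomp G x y \<Longrightarrow> gcomp G y z \<Longrightarrow>
        gcomp G (gmult G x y) z \<and> gcomp G x (gmult G y z) \<and>
        gmult G (gmult G x y) z = gmult G x (gmult G y z)"
    and canc: "\<And>x y. gcomp G x y \<Longrightarrow>
        gmult G (ginv G x) (gmult G x y) = y \<and> gmult G (gmult G x y) (ginv G y) = x"
    using assms(1) unfolding groupoid_def by blast+
  have inv': "gcomp G (ginv G x) x" if "x \<in> gset G" for x
    using inv that by metis
  show ?thesis
  proof
    assume c: "gcomp G g h"
    have 1: "gcomp G (gsrc G g) h" "gmult G (gsrc G g) h = h"
      using ass[OF inv'[OF assms(2)] c] canc[OF c] by (auto simp: gsrc_def)
    show "gsrc G g = grng G h"
      using canc[OF 1(1)] 1(2) by (simp add: grng_def)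
  next
    assume e: "gsrc G g = grng G h"
    have 1: "gcomp G g (gsrc G g)"
      using ass inv inv' assms(2) by (simp add: gsrc_def)
    have 2: "gcomp G (gsrc G g) h"
      using ass inv inv' assms(3) by (simp add: e grng_def)
    have 3: "gmult G (gsrc G g) h = h"
      using canc[of h "ginv G h"] inv[OF assms(3)] by (simp add: e grng_def)
    show "gcomp G g h"
      using ass[OF 1 2] 3 by simp
  qed
qed

definition topological_groupoid :: "'g top_groupoid \<Rightarrow> bool" where
  "topological_groupoid G \<longleftrightarrow> groupoid G \<and>
     continuous_map (gtop G) (gtop G) (ginv G) \<and>
     continuous_map (subtopology (prod_topology (gtop G) (gtop G)) {(g, h). gcomp G g h})
       (gtop G) (\<lambda>(g, h). gmult G g h)"

definition etale_groupoid :: "'g top_groupoid \<Rightarrow> bool" where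
  "etale_groupoid G \<longleftrightarrow> topological_groupoid G \<and> open_map (gtop G) (gtop G) (gsrc G)"

definition open_slices :: "'g top_groupoid \<Rightarrow> 'g set set" where
  "open_slices G = {B. openin (gtop G) B \<and> inj_on (gsrc G) B \<and> inj_on (grng G) B}"

definition slice_mult :: "'g top_groupoid \<Rightarrow> 'g set \<Rightarrow> 'g set \<Rightarrow> 'g set" where
  "slice_mult G A B = {gmult G g h | g h. g \<in> A \<and> h \<in> B \<and> gcomp G g h}"

definition restrict_groupoid :: "'g top_groupoid \<Rightarrow> 'g set \<Rightarrow> 'g top_groupoid" where
  "restrict_groupoid G X =
     \<lparr>gtop = subtopology (gtop G) X,
      gcomp = (\<lambda>g h. g \<in> X \<and> h \<in> X \<and> gcomp G g h),
      gmult = gmult G, ginv = ginv G\<rparr>"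


section \<open>Groupoid bundles and slice-sections\<close>

definition groupoid_functor ::
    "'f top_groupoid \<Rightarrow> 'g top_groupoid \<Rightarrow> ('f \<Rightarrow> 'g) \<Rightarrow> bool" where
  "groupoid_functor F G \<pi> \<longleftrightarrow>
     (\<forall>f\<in>gset F. \<pi> f \<in> gset G) \<and>
     (\<forall>e f. gcomp F e f \<longrightarrow>
        gcomp G (\<pi> e) (\<pi> f) \<and> \<pi> (gmult F e f) = gmult G (\<pi> e) (\<pi> f))"

definition groupoid_bundle ::
    "'f top_groupoid \<Rightarrow> 'g top_groupoid \<Rightarrow> ('f \<Rightarrow> 'g) \<Rightarrow> bool" where
  "groupoid_bundle F G \<pi> \<longleftrightarrow>
     topological_groupoid F \<and> etale_groupoid G \<and>
     open_map (gtop F) (gtop G) \<pi> \<and> continuous_map (gtop F) (gtop G) \<pi> \<and>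
     groupoid_functor F G \<pi> \<and> inj_on \<pi> (gunits F)"

text \<open>Slice-sections are partial functions; \<open>dom\<close> is their domain.\<close>

definition slice_sections ::
    "'f top_groupoid \<Rightarrow> 'g top_groupoid \<Rightarrow> ('f \<Rightarrow> 'g) \<Rightarrow> ('g \<rightharpoonup> 'f) set" where
  "slice_sections F G \<pi> =
     {a. dom a \<in> open_slices G \<and>
         continuous_map (subtopology (gtop G) (dom a)) (gtop F) (\<lambda>g. the (a g)) \<and>
         (\<forall>g\<in>dom a. \<pi> (the (a g)) = g)}"

text \<open>
  As the domains are slices, the factors \<open>g\<close> and \<open>h\<close> of an element of the product of the
  domains are unique, which is why \<open>THE\<close> is meaningful here.
\<close>

definition section_mult ::
    "'f top_groupoid \<Rightarrow> 'g top_groupoid \<Rightarrow> ('g \<rightharpoonup> 'f) \<Rightarrow> ('g \<rightharpoonup> 'f) \<Rightarrow> ('g \<rightharpoonup> 'f)" where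
  "section_mult F G a b =
     (\<lambda>k. if k \<in> slice_mult G (dom a) (dom b)
          then Some (THE f. \<exists>g\<in>dom a. \<exists>h\<in>dom b. gcomp G g h \<and> k = gmult G g h \<and>
                 f = gmult F (the (a g)) (the (b h)))
          else None)"


section \<open>Morphisms\<close>

text \<open>
  A relation \<open>\<phi> \<subseteq> G \<times> H\<close> goes from \<open>H\<close> to \<open>G\<close>, so the preimage \<open>\<phi>\<^sup>-\<^sup>1[U]\<close> of \<open>U \<subseteq> G\<close> is
  the library's relational image \<open>\<phi> `` U\<close>.
\<close>

definition functorial_relation ::
    "'g top_groupoid \<Rightarrow> 'h top_groupoid \<Rightarrow> ('g \<times> 'h) set \<Rightarrow> bool" where
  "functorial_relation G H \<phi> \<longleftrightarrow>
     \<phi> \<subseteq> gset G \<times> gset H \<and>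
     (\<forall>(g, h)\<in>\<phi>. (ginv G g, ginv H h) \<in> \<phi>) \<and>
     (\<forall>(g, h)\<in>\<phi>. \<forall>(g', h')\<in>\<phi>. gsrc H h = grng H h' \<longrightarrow>
        gsrc G g = grng G g' \<and> (gmult G g g', gmult H h h') \<in> \<phi>)"

definition star_bijective ::
    "'g top_groupoid \<Rightarrow> 'h top_groupoid \<Rightarrow> ('g \<times> 'h) set \<Rightarrow> bool" where
  "star_bijective G H \<phi> \<longleftrightarrow>
     (\<forall>g\<in>gset G. \<forall>h\<in>gunits H. (grng G g, h) \<in> \<phi> \<longrightarrow>
        (\<exists>!i. i \<in> gset H \<and> grng H i = h \<and> (g, i) \<in> \<phi>))"

definition zakrzewski_morphism ::
    "'g top_groupoid \<Rightarrow> 'h top_groupoid \<Rightarrow> ('g \<times> 'h) set \<Rightarrow> bool" where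
  "zakrzewski_morphism G H \<phi> \<longleftrightarrow>
     etale_groupoid G \<and> etale_groupoid H \<and>
     functorial_relation G H \<phi> \<and> star_bijective G H \<phi> \<and>
     (\<forall>U. openin (gtop G) U \<longrightarrow> openin (gtop H) (\<phi> `` U))"

definition pullback_groupoid ::
    "'f top_groupoid \<Rightarrow> ('f \<Rightarrow> 'g) \<Rightarrow> ('g \<times> 'h) set \<Rightarrow> 'h top_groupoid \<Rightarrow> ('f \<times> 'h) top_groupoid" where
  "pullback_groupoid F \<pi> \<phi> H =
     (let P = {(f, h). f \<in> gset F \<and> h \<in> gset H \<and> (\<pi> f, h) \<in> \<phi>} in
      \<lparr>gtop = subtopology (prod_topology (gtop F) (gtop H)) P,
       gcomp = (\<lambda>p q. p \<in> P \<and> q \<in> P \<and> gcomp H (snd p) (snd q)),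
       gmult = (\<lambda>p q. (gmult F (fst p) (fst q), gmult H (snd p) (snd q))),
       ginv = (\<lambda>p. (ginv F (fst p), ginv H (snd p)))\<rparr>)"

text \<open>
  The map \<open>\<tau>\<close> is required to be \<open>extensional\<close> so that distinct HOL functions represent
  distinct maps on \<open>\<phi>\<^sup>\<pi>F\<close>; otherwise uniqueness of \<open>(\<phi>, \<tau>)\<close> would fail for trivial reasons.
\<close>

definition zakrzewski_pierce_morphism ::
    "'f top_groupoid \<Rightarrow> 'g top_groupoid \<Rightarrow> ('f \<Rightarrow> 'g) \<Rightarrow>
     'e top_groupoid \<Rightarrow> 'h top_groupoid \<Rightarrow> ('e \<Rightarrow> 'h) \<Rightarrow>
     ('g \<times> 'h) set \<times> ('f \<times> 'h \<Rightarrow> 'e) \<Rightarrow> bool" where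
  "zakrzewski_pierce_morphism F G \<pi> F' G' \<pi>' = (\<lambda>(\<phi>, \<tau>).
     zakrzewski_morphism G G' \<phi> \<and>
     (let P = pullback_groupoid F \<pi> \<phi> G' in
        \<tau> \<in> extensional (gset P) \<and>
        continuous_map (gtop P) (gtop F') \<tau> \<and> groupoid_functor P F' \<tau> \<and>
        (\<forall>(f, g')\<in>gset P. \<pi>' (\<tau> (f, g')) = g')))"

text \<open>The map \<open>\<tau>/\<phi>\<close> from slice-sections of \<open>\<pi>\<close> to slice-sections of \<open>\<pi>'\<close>.\<close>

definition induced_hom ::
    "('g \<times> 'h) set \<times> ('f \<times> 'h \<Rightarrow> 'e) \<Rightarrow> ('g \<rightharpoonup> 'f) \<Rightarrow> ('h \<rightharpoonup> 'e)" where
  "induced_hom = (\<lambda>(\<phi>, \<tau>) a g'.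
     if g' \<in> \<phi> `` dom a
     then Some (\<tau> (the (a (THE g. g \<in> dom a \<and> (g, g') \<in> \<phi>)), g'))
     else None)"


section \<open>Representations\<close>

definition etale_representation ::
    "'a::semigroup_mult set \<Rightarrow> 'a set \<Rightarrow> 'g top_groupoid \<Rightarrow> ('a \<Rightarrow> 'g set) \<Rightarrow> bool" where
  "etale_representation N Z G \<theta> \<longleftrightarrow>
     etale_groupoid G \<and>
     (\<forall>a. \<theta> a \<in> open_slices G) \<and>
     (\<forall>a b. \<theta> (a * b) = slice_mult G (\<theta> a) (\<theta> b)) \<and>
     (\<Union>a. \<theta> a) = gset G \<and>
     (\<forall>n\<in>N. openin (subtopology (gtop G) (gunits G)) (\<theta> n)) \<and>
     (\<forall>a. \<forall>g\<in>\<theta> a. \<exists>b. below N Z b a \<and> g \<in> \<theta> b)"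

definition bundle_representation ::
    "'a::semigroup_mult set \<Rightarrow> 'a set \<Rightarrow> 'f top_groupoid \<Rightarrow> 'g top_groupoid \<Rightarrow> ('f \<Rightarrow> 'g) \<Rightarrow>
     ('a \<Rightarrow> 'g \<rightharpoonup> 'f) \<Rightarrow> bool" where
  "bundle_representation N Z F G \<pi> \<theta> \<longleftrightarrow>
     groupoid_bundle F G \<pi> \<and>
     (\<forall>a. \<theta> a \<in> slice_sections F G \<pi>) \<and>
     (\<forall>a b. \<theta> (a * b) = section_mult F G (\<theta> a) (\<theta> b)) \<and>
     etale_representation N Z G (\<lambda>a. dom (\<theta> a))"

text \<open>
  HOL cannot quantify over types inside a formula, so the types carrying the competing bundles
  \<open>\<pi>' : F' \<rightarrow> G'\<close> are parameters. A theorem leaving them as type variables covers all bundles.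
\<close>

definition zakrzewski_universal ::
    "'e itself \<Rightarrow> 'h itself \<Rightarrow> 'a::semigroup_mult set \<Rightarrow> 'a set \<Rightarrow>
     'f top_groupoid \<Rightarrow> 'g top_groupoid \<Rightarrow> ('f \<Rightarrow> 'g) \<Rightarrow> ('a \<Rightarrow> 'g \<rightharpoonup> 'f) \<Rightarrow> bool" where
  "zakrzewski_universal TYPE('e) TYPE('h) N Z F G \<pi> \<mu> \<longleftrightarrow>
     bundle_representation N Z F G \<pi> \<mu> \<and>
     (\<forall>(F' :: 'e top_groupoid) (G' :: 'h top_groupoid) \<pi>' \<theta>.
        bundle_representation N Z F' G' \<pi>' \<theta> \<longrightarrow>
        (\<exists>!m. zakrzewski_pierce_morphism F G \<pi> F' G' \<pi>' m \<and> \<theta> = induced_hom m \<circ> \<mu>))"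


section \<open>The directed coset bundle\<close>

definition cosets :: "'a::semigroup_mult set \<Rightarrow> 'a set \<Rightarrow> 'a set set" where
  "cosets N Z = {C. coset N Z C \<and> C \<noteq> {}}"

definition directed_cosets :: "'a::semigroup_mult set \<Rightarrow> 'a set \<Rightarrow> 'a set set" where
  "directed_cosets N Z = {D \<in> cosets N Z. directed N Z D}"

text \<open>Every element of \<open>cosets N Z\<close> is non-empty, so it belongs to a subbasic set.\<close>

definition coset_groupoid :: "'a::semigroup_mult set \<Rightarrow> 'a set \<Rightarrow> 'a set top_groupoid" where
  "coset_groupoid N Z =
     \<lparr>gtop = topology_generated_by {{C \<in> cosets N Z. a \<in> C} | a. True},
      gcomp = (\<lambda>B C. B \<in> cosets N Z \<and> C \<in> cosets N Z \<and> source N Z B = range_coset N Z C),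
      gmult = (\<lambda>B C. up N Z (B * C)),
      ginv = star N Z\<rparr>"

definition directed_coset_groupoid :: "'a::semigroup_mult set \<Rightarrow> 'a set \<Rightarrow> 'a set top_groupoid" where
  "directed_coset_groupoid N Z = restrict_groupoid (coset_groupoid N Z) (directed_cosets N Z)"

definition atlas_equiv :: "'a::semigroup_mult set \<Rightarrow> 'a set \<Rightarrow> 'a set \<Rightarrow> 'a \<Rightarrow> 'a \<Rightarrow> bool" where
  "atlas_equiv N Z A a b \<longleftrightarrow> (\<exists>s\<in>star N Z A. \<exists>t\<in>star N Z A. s * a * t = s * b * t)"

text \<open>\<open>atlas_class N Z a A\<close> is \<open>[a, A]\<close>, for \<open>a \<in> up N Z A\<close>.\<close>

definition atlas_class :: "'a::semigroup_mult set \<Rightarrow> 'a set \<Rightarrow> 'a \<Rightarrow> 'a set \<Rightarrow> 'a set \<times> 'a set" where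
  "atlas_class N Z a A = ({b \<in> up N Z A. atlas_equiv N Z A a b}, up N Z A)"

definition coset_bundle_set :: "'a::semigroup_mult set \<Rightarrow> 'a set \<Rightarrow> ('a set \<times> 'a set) set" where
  "coset_bundle_set N Z = {atlas_class N Z c C | c C. c \<in> C \<and> C \<in> cosets N Z}"

definition coset_proj :: "'a set \<times> 'a set \<Rightarrow> 'a set" where
  "coset_proj = snd"

text \<open>
  The product is \<open>[b, B] [c, C] = [b c, B C]\<close>. The inverse is \<open>[c, C]\<^sup>-\<^sup>1 = [s, C\<^sup>*]\<close> for any
  \<open>a \<in> C\<close> and \<open>s\<close> with \<open>a <\<^sub>s c\<close>; being determined by the product, it is the only map
  satisfying the groupoid axioms.
\<close>

definition coset_bundle :: "'a::semigroup_mult set \<Rightarrow> 'a set \<Rightarrow> ('a set \<times> 'a set) top_groupoid" where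
  "coset_bundle N Z =
     \<lparr>gtop = topology_generated_by
        ({{atlas_class N Z s C | C. s \<in> C \<and> C \<in> cosets N Z} | s. True} \<union>
         {{p \<in> coset_bundle_set N Z. coset_proj p \<in> cosets N Z \<and> s \<in> coset_proj p} | s. True}),
      gcomp = (\<lambda>p q. p \<in> coset_bundle_set N Z \<and> q \<in> coset_bundle_set N Z \<and>
        source N Z (coset_proj p) = range_coset N Z (coset_proj q)),
      gmult = (\<lambda>p q. THE x. \<exists>b B c C. b \<in> B \<and> B \<in> cosets N Z \<and> c \<in> C \<and> C \<in> cosets N Z \<and>
        p = atlas_class N Z b B \<and> q = atlas_class N Z c C \<and> x = atlas_class N Z (b * c) (B * C)),
      ginv = (\<lambda>p. THE x. \<exists>c C a s. c \<in> C \<and> C \<in> cosets N Z \<and> a \<in> C \<and> below_via N Z a s c \<and>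
        p = atlas_class N Z c C \<and> x = atlas_class N Z s (star N Z C))\<rparr>"

definition directed_coset_bundle ::
    "'a::semigroup_mult set \<Rightarrow> 'a set \<Rightarrow> ('a set \<times> 'a set) top_groupoid" where
  "directed_coset_bundle N Z =
     restrict_groupoid (coset_bundle N Z)
       {p \<in> coset_bundle_set N Z. coset_proj p \<in> directed_cosets N Z}"

definition directed_coset_rep ::
    "'a::semigroup_mult set \<Rightarrow> 'a set \<Rightarrow> 'a \<Rightarrow> ('a set \<rightharpoonup> 'a set \<times> 'a set)" where
  "directed_coset_rep N Z a =
     (\<lambda>D. if D \<in> directed_cosets N Z \<and> a \<in> D then Some (atlas_class N Z a D) else None)"

end

theory Submission
  imports Defs
begin

text \<open>
  Elements of the semigroup are best pictured as partial sections over some groupoid, with \<open>N\<close>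
  consisting of sections over units and \<open>Z\<close> of central ones. That \<open>a\<close> is below \<open>b\<close> via \<open>s\<close> says
  that wherever \<open>a\<close> lives, \<open>s\<close> inverts \<open>b\<close> up to central elements. A directed coset \<open>D\<close> is an
  abstract point, given by all sections defined there, and \<open>[a, D]\<close> is the value of \<open>a\<close> at it.

  \<^emph>\<open>The directed coset bundle is a representation.\<close> Up-closure is compatible with products of sets
  in which every element dominates another one (\<open>up_mult\<close>), so identities between products of
  cosets may be checked on generators, where they reduce to \<open>(C C\<^sup>* C)\<^sup>< = C\<close>
  (\<open>coset_triple\<close>) and to the equality of source and range. What this does not give are enough
  cosets, both for the source map to be open and for every directed coset containing \<open>a b\<close> to be a
  product of one containing \<open>a\<close> and one containing \<open>b\<close>. Such cosets are obtained by moving a unit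
  coset along an element that is invertible over it (\<open>translate_unit\<close>). For the product, the
  witness over \<open>a b\<close> provides only one-sided inverses of \<open>a\<close> and \<open>b\<close>; symmetry of \<open>Z\<close> turns them
  into two-sided ones (\<open>split_dcoset\<close>). In the fibres, the relation defining the classes \<open>[a, D]\<close>
  can be expressed with central multipliers (\<open>equivI\<close>, \<open>equivE\<close>), which can be moved past other
  factors by conjugation; hence it is compatible with products.

  \<^emph>\<open>Universality.\<close> Let \<open>\<theta>\<close> be a bundle representation on \<open>\<pi>' : F' \<rightarrow> G'\<close>. A point \<open>h\<close> of \<open>G'\<close>
  yields the set of all \<open>a\<close> such that \<open>\<theta> a\<close> is defined at \<open>h\<close>. This is a coset, which may fail to be
  directed, but it is partitioned into directed cosets: the one containing \<open>a\<close> consists of the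
  elements that have with \<open>a\<close> a common lower bound defined at \<open>h\<close> (\<open>germ_dcoset\<close>, \<open>germ_eq\<close>). That there
  can be several parts is the reason why morphisms are relations. The relation \<open>\<phi>\<close>
  between the parts and \<open>h\<close> is a Zakrzewski morphism (\<open>zakrzewski_phi\<close>), and \<open>\<tau>\<close> sends
  \<open>([a, D], h)\<close> to \<open>\<theta> a h\<close>; this depends only on the class because an equation \<open>s a t = s b t\<close> can be
  cancelled in the groupoid \<open>F'\<close> (\<open>sec_equiv\<close>). Conversely, let \<open>(\<psi>, \<sigma>)\<close> induce \<open>\<theta>\<close>. Comparing
  domains, the cosets related to \<open>h\<close> by \<open>\<psi>\<close> cover the coset of \<open>h\<close>, and functoriality allows just
  one of them through each element. So they must be the parts above, and \<open>\<sigma>\<close> is then determined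
  by the values of \<open>\<theta>\<close> (\<open>unique\<close>).
\<close>

section \<open>The calculus of domination\<close>

locale structured =
  fixes N Z :: "'a::semigroup_mult set"
  assumes structured: "structured_semigroup N Z"
begin

abbreviation via ("_ \<lhd>\<^bsub>_\<^esub> _" [51, 0, 51] 50) where
  "a \<lhd>\<^bsub>s\<^esub> b \<equiv> below_via N Z a s b"

abbreviation dominated (infix "\<lhd>" 50) where
  "a \<lhd> b \<equiv> below N Z a b"

abbreviation upset ("_\<up>" [1000] 1000) where
  "A\<up> \<equiv> up N Z A"

abbreviation starset ("_\<star>" [1000] 1000) where
  "A\<star> \<equiv> star N Z A"

lemma N_mult: "m \<in> N \<Longrightarrow> n \<in> N \<Longrightarrow> m * n \<in> N"
  and Z_mult: "y \<in> Z \<Longrightarrow> z \<in> Z \<Longrightarrow> y * z \<in> Z"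
  and Z_N: "z \<in> Z \<Longrightarrow> z \<in> N"
  and Z_central: "z \<in> Z \<Longrightarrow> n \<in> N \<Longrightarrow> n * z = z * n"
proof -
  have "\<forall>m\<in>N. \<forall>n\<in>N. m * n \<in> N" "\<forall>y\<in>Z. \<forall>z\<in>Z. y * z \<in> Z" "Z \<subseteq> {z \<in> N. \<forall>n\<in>N. n * z = z * n}"
    using structured by (simp_all add: structured_semigroup_def)
  then show "m \<in> N \<Longrightarrow> n \<in> N \<Longrightarrow> m * n \<in> N" "y \<in> Z \<Longrightarrow> z \<in> Z \<Longrightarrow> y * z \<in> Z" "z \<in> Z \<Longrightarrow> z \<in> N"
    "z \<in> Z \<Longrightarrow> n \<in> N \<Longrightarrow> n * z = z * n"
    by auto
qed

lemma N_mult_assoc: "x * y \<in> N \<Longrightarrow> n \<in> N \<Longrightarrow> x * (y * n) \<in> N"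
  using N_mult[of "x * y" n] by (simp add: mult.assoc)

lemma Z_conj: "a * b \<in> Z \<Longrightarrow> b * a \<in> Z \<Longrightarrow> z \<in> Z \<Longrightarrow> a * z * b \<in> Z"
proof -
  assume *: "a * b \<in> Z" "b * a \<in> Z" "z \<in> Z"
  have "\<forall>a b. a * b \<in> Z \<and> b * a \<in> Z \<longrightarrow> {a} * Z * {b} \<union> {b} * Z * {a} \<subseteq> Z"
    using structured by (simp add: structured_semigroup_def)
  then have "{a} * Z * {b} \<subseteq> Z"
    using * by simp
  then show ?thesis
    using * by (meson set_times_intro singletonI subsetD)
qed

lemma N_conj:
  assumes "a * b \<in> Z" "b * a \<in> Z" "n \<in> N" "a * b * n = n"
  shows "b * n * a \<in> N"
proof -
  have "n * a * b = n"
    using Z_central[OF assms(1,3)] assms(4) by (simp add: mult.assoc)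
  moreover have "\<forall>a b. \<forall>n\<in>N. a * b * n = n \<and> n = n * a * b \<and> a * b \<in> Z \<and> b * a \<in> Z
      \<longrightarrow> b * n * a \<in> N"
    using structured by (simp add: structured_semigroup_def)
  ultimately show ?thesis
    using assms by simp
qed

lemma viaI:
  "a * s * b = a \<Longrightarrow> b * s * a = a \<Longrightarrow> a * s \<in> N \<Longrightarrow> s * a \<in> N \<Longrightarrow> b * s \<in> Z \<Longrightarrow> s * b \<in> Z
    \<Longrightarrow> a \<lhd>\<^bsub>s\<^esub> b"
  by (simp add: below_via_def)

lemma viaD:
  assumes "a \<lhd>\<^bsub>s\<^esub> b"
  shows "a * s * b = a" "b * s * a = a" "a * s \<in> N" "s * a \<in> N" "b * s \<in> Z" "s * b \<in> Z"
  using assms by (auto simp: below_via_def)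

lemma via_rewrite:
  assumes "a \<lhd>\<^bsub>s\<^esub> b"
  shows "a * (s * b) = a" "b * (s * a) = a" "a * (s * (b * x)) = a * x" "b * (s * (a * x)) = a * x"
  using viaD(1,2)[OF assms] by (metis mult.assoc)+

lemma belowI: "a \<lhd>\<^bsub>s\<^esub> b \<Longrightarrow> a \<lhd> b"
  by (auto simp: below_def)

lemma belowE: assumes "a \<lhd> b" obtains s where "a \<lhd>\<^bsub>s\<^esub> b"
  using assms by (auto simp: below_def)

text \<open>
  What inverts \<open>c\<close> wherever \<open>b\<close> lives also does so on the smaller support of \<open>a\<close>.
\<close>

lemma via_trans:
  assumes "a \<lhd>\<^bsub>s\<^esub> b" "b \<lhd>\<^bsub>t\<^esub> c"
  shows "a \<lhd>\<^bsub>t\<^esub> c"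
proof (rule viaI)
  note a = via_rewrite[OF assms(1)] viaD[OF assms(1)] via_rewrite[OF assms(2)] viaD[OF assms(2)]
  have "a * t * c = a * (s * (b * (t * c)))"
    using a(3) by (simp add: mult.assoc)
  also have "\<dots> = a"
    using a by simp
  finally show "a * t * c = a" .
  have "c * t * a = c * (t * (b * (s * a)))"
    using a(2) by (simp add: mult.assoc)
  also have "\<dots> = b * (s * a)"
    by (rule a(14))
  finally show "c * t * a = a"
    using a(2) by simp
  have "a * t = a * s * (b * t)" "t * a = t * b * (s * a)"
    using a(2,3) by (simp_all add: mult.assoc)
  moreover have "a * s * (b * t) \<in> N" "t * b * (s * a) \<in> N"
    using a N_mult by simp_all
  ultimately show "a * t \<in> N" "t * a \<in> N"
    by simp_all
qed (use viaD assms in blast)+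

lemma below_trans: "a \<lhd> b \<Longrightarrow> b \<lhd> c \<Longrightarrow> a \<lhd> c"
  by (meson belowE belowI via_trans)

lemma below_via_trans: "a \<lhd> b \<Longrightarrow> b \<lhd>\<^bsub>t\<^esub> c \<Longrightarrow> a \<lhd>\<^bsub>t\<^esub> c"
  by (meson belowE via_trans)

text \<open>
  The inner factor \<open>c * t\<close> lies in \<open>N\<close> and so commutes with the central \<open>s * b\<close>. That
  \<open>a * (c * t) * s\<close> lies in \<open>N\<close> again is the second axiom, as \<open>s\<close> inverts \<open>b\<close> over \<open>a\<close>.
\<close>

lemma via_mult:
  assumes "a \<lhd>\<^bsub>s\<^esub> b" "c \<lhd>\<^bsub>t\<^esub> d"
  shows "a * c \<lhd>\<^bsub>t * s\<^esub> b * d"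
proof (rule viaI)
  note a = via_rewrite[OF assms(1)] viaD[OF assms(1)]
    and c = via_rewrite[OF assms(2)] viaD[OF assms(2)]
  have "a * c * (t * s) * (b * d) = a * ((c * t) * (s * b)) * d"
    by (simp add: mult.assoc)
  also have "\<dots> = a * ((s * b) * (c * t)) * d"
    using Z_central[of "s * b" "c * t"] a c by simp
  finally show "a * c * (t * s) * (b * d) = a * c"
    using a c by (simp add: mult.assoc)
  have "b * d * (t * s) * (a * c) = b * ((d * t) * (s * a)) * c"
    by (simp add: mult.assoc)
  also have "\<dots> = b * ((s * a) * (d * t)) * c"
    using Z_central[of "d * t" "s * a"] a c by simp
  finally show "b * d * (t * s) * (a * c) = a * c"
    using a c by (simp add: mult.assoc)
  have "b * ((s * a) * (c * t)) * s \<in> N"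
    by (rule N_conj) (use a c N_mult N_mult_assoc in \<open>simp_all add: mult.assoc\<close>)
  then show "a * c * (t * s) \<in> N"
    using a by (simp add: mult.assoc)
  have "t * ((s * a) * (c * t)) * d \<in> N"
  proof (rule N_conj)
    show "d * t * (s * a * (c * t)) = s * a * (c * t)"
      using Z_central[of "d * t" "s * a"] a c by (metis mult.assoc)
  qed (use a c N_mult N_mult_assoc in simp_all)
  then show "t * s * (a * c) \<in> N"
    using c by (simp add: mult.assoc)
  show "b * d * (t * s) \<in> Z"
    using Z_conj[of b s "d * t"] a c by (simp add: mult.assoc)
  show "t * s * (b * d) \<in> Z"
    using Z_conj[of t d "s * b"] a c by (simp add: mult.assoc)
qed

lemma below_mult: "a \<lhd> b \<Longrightarrow> c \<lhd> d \<Longrightarrow> a * c \<lhd> b * d"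
  by (meson belowE belowI via_mult)

text \<open>
  A factor from \<open>N\<close> lives over units, so it changes the value of \<open>a\<close> but not where it is
  defined, except for making it smaller. Conjugating it by \<open>b\<close> and \<open>s\<close> stays within \<open>N\<close>.
\<close>

lemma via_N_right:
  assumes "a \<lhd>\<^bsub>s\<^esub> b" "n \<in> N"
  shows "a * n \<lhd>\<^bsub>s\<^esub> b"
proof (rule viaI)
  note a = via_rewrite[OF assms(1)] viaD[OF assms(1)]
  show "a * n * s * b = a * n"
    using Z_central[of "s * b" n] a assms(2) by (metis mult.assoc)
  show "b * s * (a * n) = a * n"
    using a by (simp add: mult.assoc)
  have "b * ((s * a) * n) * s \<in> N"
    by (rule N_conj) (use a assms N_mult N_mult_assoc in \<open>simp_all add: mult.assoc\<close>)
  then show "a * n * s \<in> N"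
    using a by (simp add: mult.assoc)
  show "s * (a * n) \<in> N"
    using N_mult[of "s * a" n] a assms(2) by (simp add: mult.assoc)
qed (use viaD assms in blast)+

lemma via_N_left:
  assumes "a \<lhd>\<^bsub>s\<^esub> b" "n \<in> N"
  shows "n * a \<lhd>\<^bsub>s\<^esub> b"
proof (rule viaI)
  note a = via_rewrite[OF assms(1)] viaD[OF assms(1)]
  show "n * a * s * b = n * a"
    using a by (simp add: mult.assoc)
  show "b * s * (n * a) = n * a"
    using Z_central[of "b * s" n] a assms(2) by (metis mult.assoc)
  have "s * (n * (a * s)) * b \<in> N"
  proof (rule N_conj)
    show "b * s * (n * (a * s)) = n * (a * s)"
      using Z_central[of "b * s" n] a assms(2) by (metis mult.assoc)
  qed (use a assms N_mult N_mult_assoc in simp_all)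
  then show "s * (n * a) \<in> N"
    using a by (simp add: mult.assoc)
  show "n * a * s \<in> N"
    using N_mult[of n "a * s"] a assms(2) by (simp add: mult.assoc)
qed (use viaD assms in blast)+

lemma below_N: "a \<lhd> b \<Longrightarrow> n \<in> N \<Longrightarrow> a * n \<lhd> b" "a \<lhd> b \<Longrightarrow> n \<in> N \<Longrightarrow> n * a \<lhd> b"
  by (meson belowE belowI via_N_right via_N_left)+

text \<open>
  This provides a smaller element for the witness itself, with the roles of \<open>b\<close> and \<open>s\<close>
  exchanged, and \<open>via_sandwich\<close> below shows that the smaller element is again a witness. Together
  they let the inverse \<open>A\<star>\<close> of a set inherit its properties.
\<close>

lemma via_switch:
  assumes "a \<lhd>\<^bsub>s\<^esub> b"
  shows "s * a * s \<lhd>\<^bsub>b\<^esub> s"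
  by (rule viaI) (use via_rewrite[OF assms] viaD[OF assms] in \<open>simp_all add: mult.assoc\<close>)

lemma via_sandwich:
  assumes "a' \<lhd>\<^bsub>t\<^esub> a" "a \<lhd>\<^bsub>s\<^esub> b"
  shows "a' \<lhd>\<^bsub>s * a * s\<^esub> b * t * b"
proof (rule viaI)
  have a': "a' \<lhd>\<^bsub>s\<^esub> b"
    by (rule via_trans[OF assms])
  note a = via_rewrite[OF assms(1)] viaD[OF assms(1)] via_rewrite[OF assms(2)] viaD[OF assms(2)]
     via_rewrite[OF a'] viaD[OF a']
  have 1: "a' * s * (a * t) = a * t * (a' * s)" "t * a * (s * a') = s * a' * (t * a)"
    by (rule Z_central; use a in simp) (rule Z_central[symmetric]; use a in simp)
  have "a' * (s * a * s) * (b * t * b) = (a' * s * (a * t)) * b"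
    using a by (simp add: mult.assoc)
  also have "\<dots> = a'"
    unfolding 1 using a by (simp add: mult.assoc)
  finally show "a' * (s * a * s) * (b * t * b) = a'" .
  have "b * t * b * (s * a * s) * a' = b * (t * a * (s * a'))"
    using a by (simp add: mult.assoc)
  also have "\<dots> = a'"
    unfolding 1 using a by (simp add: mult.assoc)
  finally show "b * t * b * (s * a * s) * a' = a'" .
  show "a' * (s * a * s) \<in> N"
    using N_mult[of "a' * s" "a * s"] a by (simp add: mult.assoc)
  show "s * a * s * a' \<in> N"
    using N_mult[of "s * a" "s * a'"] a by (simp add: mult.assoc)
  show "b * t * b * (s * a * s) \<in> Z"
    using Z_conj[of b s "t * a"] a by (simp add: mult.assoc)
  show "s * a * s * (b * t * b) \<in> Z"
    using Z_conj[of s b "a * t"] a by (simp add: mult.assoc)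
qed

text \<open>
  If \<open>t\<close> dominates a witness \<open>s\<close> for \<open>c\<close>, then \<open>t\<close> need not itself invert \<open>c\<close>. However, \<open>b * s\<close> and
  \<open>c * t\<close> invert each other up to central elements, as their products are \<open>c * s\<close> and
  \<open>b * (s * c) * t\<close>.
\<close>

lemma via_quotient_switch:
  assumes "a \<lhd>\<^bsub>s\<^esub> c" "s \<lhd>\<^bsub>b\<^esub> t"
  shows "a * s \<lhd>\<^bsub>b * s\<^esub> c * t"
proof (rule viaI)
  note a = via_rewrite[OF assms(1)] viaD[OF assms(1)] via_rewrite[OF assms(2)] viaD[OF assms(2)]
  have "a * s * (b * s) * (c * t) = a * ((s * b) * (s * c)) * t"
    by (simp add: mult.assoc)
  also have "\<dots> = a * ((s * c) * (s * b)) * t"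
    using Z_central[of "s * c" "s * b"] a by simp
  finally show "a * s * (b * s) * (c * t) = a * s"
    using a by (simp add: mult.assoc)
  show "c * t * (b * s) * (a * s) = a * s" "c * t * (b * s) \<in> Z"
    using a by (simp_all add: mult.assoc)
  show "a * s * (b * s) \<in> N" "b * s * (a * s) \<in> N"
    using a N_mult by simp_all
  show "b * s * (c * t) \<in> Z"
    using Z_conj[of b t "s * c"] a by (simp add: mult.assoc)
qed

lemma below_in_N:
  assumes "m \<lhd> n" "n \<in> N"
  shows "m \<in> N"
  using assms N_mult viaD(1,3) by (metis belowE)

text \<open>
  Among elements of \<open>N\<close> the roles of \<open>n\<close> and its inverse \<open>s\<close> can be exchanged after cutting down
  with \<open>m\<close>, as \<open>m\<close> commutes with the central \<open>n * s\<close>. This puts \<open>n\<close> into the inverse of any set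
  containing \<open>s * m\<close>.
\<close>

lemma via_N_swap:
  assumes "m \<lhd>\<^bsub>s\<^esub> n" "n \<in> N"
  shows "s * m \<lhd>\<^bsub>n\<^esub> s"
proof (rule viaI)
  note m = via_rewrite[OF assms(1)] viaD[OF assms(1)] below_in_N[OF belowI[OF assms(1)] assms(2)]
  have "s * m * n * s = s * (m * (n * s))"
    by (simp add: mult.assoc)
  also have "\<dots> = s * ((n * s) * m)"
    using Z_central[of "n * s" m] m by simp
  finally show "s * m * n * s = s * m"
    using m by (simp add: mult.assoc)
  show "s * n * (s * m) = s * m" "n * (s * m) \<in> N"
    using m by (simp_all add: mult.assoc)
  show "s * m * n \<in> N"
    using m assms N_mult by simp
qed (use viaD assms in blast)+

text \<open>
  The equation for \<open>n\<close> says that \<open>n\<close> only lives where \<open>t\<close> inverts \<open>b\<close>, so this also holds for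
  \<open>b\<close> cut down with \<open>n\<close>.
\<close>

lemma via_cut_right:
  assumes "b * t \<in> Z" "t * b \<in> Z" "n \<in> N" "t * b * n = n"
  shows "b * n \<lhd>\<^bsub>t\<^esub> b"
proof (rule viaI)
  have "n * (t * b) = n"
    using Z_central[OF assms(2,3)] assms(4) by simp
  then show "b * n * t * b = b * n"
    by (simp add: mult.assoc)
  show "b * t * (b * n) = b * n" "t * (b * n) \<in> N"
    using assms by (simp_all add: mult.assoc)
  show "b * n * t \<in> N"
    by (rule N_conj) (use assms in simp_all)
qed (use assms in simp_all)

lemma via_cut_left:
  assumes "b * t \<in> Z" "t * b \<in> Z" "n \<in> N" "n * (b * t) = n"
  shows "n * b \<lhd>\<^bsub>t\<^esub> b"
proof (rule viaI)
  have n: "b * t * n = n"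
    using Z_central[OF assms(1,3)] assms(4) by simp
  then show "b * t * (n * b) = n * b"
    by (simp add: mult.assoc[symmetric])
  show "n * b * t * b = n * b" "n * b * t \<in> N"
    using assms by (simp_all add: mult.assoc[symmetric])
  have "t * n * b \<in> N"
    by (rule N_conj) (use assms n in simp_all)
  then show "t * (n * b) \<in> N"
    by (simp add: mult.assoc)
qed (use assms in simp_all)

end

section \<open>Cosets\<close>

context structured
begin

text \<open>
  Domination is not reflexive, so \<open>A\<up>\<close> is a closure of \<open>A\<close> only for sets of this kind.
\<close>

definition round :: "'a set \<Rightarrow> bool" where
  "round A \<longleftrightarrow> A \<subseteq> A\<up>"

lemma upI: "a \<in> A \<Longrightarrow> a \<lhd> b \<Longrightarrow> b \<in> A\<up>"
  by (auto simp: up_def)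

lemma upE: assumes "b \<in> A\<up>" obtains a where "a \<in> A" "a \<lhd> b"
  using assms by (auto simp: up_def)

lemma up_multE:
  assumes "x \<in> (A * B)\<up>"
  obtains a b where "a \<in> A" "b \<in> B" "a * b \<lhd> x"
proof -
  obtain y where y: "y \<in> A * B" "y \<lhd> x"
    using assms by (rule upE)
  show thesis
    using y(1) by (rule set_times_elim) (use that y(2) in blast)
qed

lemma roundE: assumes "round A" "b \<in> A" obtains a where "a \<in> A" "a \<lhd> b"
  using assms by (auto simp: round_def up_def)

lemma up_mono: "A \<subseteq> B \<Longrightarrow> A\<up> \<subseteq> B\<up>"
  by (auto simp: up_def)

lemma up_up_subset: "A\<up>\<up> \<subseteq> A\<up>"
  by (auto simp: up_def intro: below_trans)

lemma round_subset_up: "round A \<Longrightarrow> A \<subseteq> A\<up>"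
  by (simp add: round_def)

lemma up_up: "round A \<Longrightarrow> A\<up>\<up> = A\<up>"
  by (simp add: round_def subset_antisym up_mono up_up_subset)

lemma up_mult_subset: "A\<up> * B\<up> \<subseteq> (A * B)\<up>"
  by (auto elim!: set_times_elim upE intro!: upI below_mult set_times_intro)

lemma round_mult: "round A \<Longrightarrow> round B \<Longrightarrow> round (A * B)"
  unfolding round_def by (meson order_trans set_times_mono2 up_mult_subset)

text \<open>
  Thanks to these identities, equations between up-closed products can be verified on generators.
\<close>

lemma up_mult:
  assumes "round A" "round B"
  shows "(A\<up> * B\<up>)\<up> = (A * B)\<up>" "(A\<up> * B)\<up> = (A * B)\<up>" "(A * B\<up>)\<up> = (A * B)\<up>"
proof -
  have "(A\<up> * B\<up>)\<up> \<subseteq> (A * B)\<up>"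
    using up_mono[OF up_mult_subset] up_up_subset by blast
  moreover have "A * B \<subseteq> A\<up> * B" "A * B \<subseteq> A * B\<up>" "A\<up> * B \<subseteq> A\<up> * B\<up>" "A * B\<up> \<subseteq> A\<up> * B\<up>"
    using assms by (simp_all add: round_def set_times_mono2)
  ultimately show "(A\<up> * B\<up>)\<up> = (A * B)\<up>" "(A\<up> * B)\<up> = (A * B)\<up>" "(A * B\<up>)\<up> = (A * B)\<up>"
    by (meson order_trans subset_antisym up_mono)+
qed

lemma starI: "a \<in> A \<Longrightarrow> a \<lhd>\<^bsub>s\<^esub> b \<Longrightarrow> s \<in> A\<star>"
  by (auto simp: star_def)

lemma star_up: "round A \<Longrightarrow> (A\<up>)\<star> = A\<star>"
  unfolding star_def by (blast elim: upE roundE intro: upI below_via_trans dest: round_subset_up)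

lemma cosetD:
  assumes "coset N Z C"
  shows "C * C\<star> * C \<subseteq> C" "C\<up> = C" "round C"
  using assms by (auto simp: coset_def round_def)

lemma coset_mult3: "coset N Z C \<Longrightarrow> a \<in> C \<Longrightarrow> s \<in> C\<star> \<Longrightarrow> b \<in> C \<Longrightarrow> a * s * b \<in> C"
  using cosetD(1) by (meson set_times_intro subsetD)

lemma coset_below: "coset N Z C \<Longrightarrow> a \<in> C \<Longrightarrow> a \<lhd> b \<Longrightarrow> b \<in> C"
  using cosetD(2) upI by blast

lemma coset_belowE:
  assumes "coset N Z C" "c \<in> C"
  obtains a s where "a \<in> C" "a \<lhd>\<^bsub>s\<^esub> c" "s \<in> C\<star>"
  using assms cosetD(3) by (meson belowE roundE starI)

lemma starE:
  assumes "coset N Z C" "s \<in> C\<star>"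
  obtains a c where "a \<in> C" "c \<in> C" "a \<lhd>\<^bsub>s\<^esub> c"
  using assms coset_below belowI unfolding star_def by blast

text \<open>
  This shows at once that \<open>C\<star>\<close> is closed upwards and that its inverse is contained in \<open>C\<close>. By
  \<open>via_quotient_switch\<close>, \<open>s * (b * s)\<close> is a witness for an element of \<open>C C\<^sup>* C\<close> and so belongs to
  \<open>C\<star>\<close>. Hence \<open>c * (s * (b * s)) * a\<close> is in \<open>C\<close>, and this element is \<open>b\<close> cut down by \<open>s * a\<close>.
\<close>

lemma star_via:
  assumes C: "coset N Z C" and s: "s \<in> C\<star>" "s \<lhd>\<^bsub>b\<^esub> t"
  shows "b \<in> C" "t \<in> C\<star>"
proof -
  obtain a c where a: "a \<in> C" "c \<in> C" "a \<lhd>\<^bsub>s\<^esub> c"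
    using starE[OF C s(1)] by blast
  note eq = via_rewrite[OF a(3)] viaD[OF a(3)] via_rewrite[OF s(2)] viaD[OF s(2)]
  have "a * s * a \<lhd>\<^bsub>s * (b * s)\<^esub> c * t * c"
    by (rule via_mult[OF via_quotient_switch[OF a(3) s(2)] a(3)])
  then have "s * (b * s) \<in> C\<star>"
    by (rule starI[OF coset_mult3[OF C a(1) s(1) a(1)]])
  then have "c * (s * (b * s)) * a \<in> C"
    using coset_mult3 C a by simp
  moreover have "c * (s * (b * s)) * a = (c * s) * (b * s) * a"
    by (simp add: mult.assoc)
  moreover have "(c * s) * (b * s) = (b * s) * (c * s)"
    using Z_central[of "c * s" "b * s"] eq by simp
  moreover have "(b * s) * (c * s) * a = b * (s * a)"
    using eq by (simp add: mult.assoc)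
  ultimately have "b * (s * a) \<in> C"
    by simp
  moreover have "b * (s * a) \<lhd>\<^bsub>t\<^esub> b"
    by (rule via_cut_right) (use eq in \<open>simp_all add: mult.assoc\<close>)
  ultimately show "b \<in> C" "t \<in> C\<star>"
    using C by (meson coset_below belowI starI)+
qed

lemma round_star:
  assumes C: "coset N Z C" and s: "s \<in> C\<star>"
  obtains t c where "t \<in> C\<star>" "c \<in> C" "t \<lhd>\<^bsub>c\<^esub> s"
proof -
  obtain a c where a: "a \<in> C" "c \<in> C" "a \<lhd>\<^bsub>s\<^esub> c"
    using starE[OF C s] by blast
  obtain a' t where "a' \<in> C" "a' \<lhd>\<^bsub>t\<^esub> a"
    using coset_belowE[OF C a(1)] by blast
  then have "s * a * s \<in> C\<star>"
    using via_sandwich[OF _ a(3)] starI by blast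
  then show thesis
    using via_switch[OF a(3)] a(2) that by blast
qed

lemma star_star:
  assumes C: "coset N Z C"
  shows "C\<star>\<star> = C"
proof
  show "C\<star>\<star> \<subseteq> C"
    using star_via[OF C] by (auto simp: star_def[of _ _ "C\<star>"])
  show "C \<subseteq> C\<star>\<star>"
  proof
    fix c assume "c \<in> C"
    then obtain a s where a: "a \<in> C" "a \<lhd>\<^bsub>s\<^esub> c"
      using coset_belowE[OF C] by blast
    obtain a' t where "a' \<in> C" "a' \<lhd>\<^bsub>t\<^esub> a"
      using coset_belowE[OF C a(1)] by blast
    then have "s * a * s \<in> C\<star>"
      using via_sandwich[OF _ a(2)] starI by blast
    then show "c \<in> C\<star>\<star>"
      using via_switch[OF a(2)] starI by blast
  qed
qed

lemma coset_star:
  assumes C: "coset N Z C"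
  shows "coset N Z (C\<star>)"
  unfolding coset_def star_star[OF C]
proof
  show "C\<star> * C * C\<star> \<subseteq> C\<star>"
  proof (safe elim!: set_times_elim)
    fix s b t assume *: "s \<in> C\<star>" "b \<in> C" "t \<in> C\<star>"
    obtain a c a' c' where a: "a \<in> C" "a \<lhd>\<^bsub>s\<^esub> c" "a' \<in> C" "a' \<lhd>\<^bsub>t\<^esub> c'"
      using starE[OF C] * by metis
    have "b \<in> C\<star>\<star>"
      using star_star[OF C] * by simp
    then obtain s' t' where s': "s' \<in> C\<star>" "s' \<lhd>\<^bsub>b\<^esub> t'"
      by (auto simp: star_def[of _ _ "C\<star>"])
    have "a' * s' * a \<lhd>\<^bsub>s * (b * t)\<^esub> c' * t' * c"
      by (rule via_mult[OF via_mult[OF a(4) s'(2)] a(2)])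
    then show "s * b * t \<in> C\<star>"
      using starI[OF coset_mult3[OF C a(3) s'(1) a(1)]] by (simp add: mult.assoc)
  qed
  show "C\<star> = C\<star>\<up>"
  proof
    show "C\<star> \<subseteq> C\<star>\<up>"
    proof
      fix s assume "s \<in> C\<star>"
      then obtain t c where "t \<in> C\<star>" "t \<lhd>\<^bsub>c\<^esub> s"
        using round_star[OF C] by blast
      then show "s \<in> C\<star>\<up>"
        using belowI upI by blast
    qed
    show "C\<star>\<up> \<subseteq> C\<star>"
    proof
      fix t assume "t \<in> C\<star>\<up>"
      then obtain s b where "s \<in> C\<star>" "s \<lhd>\<^bsub>b\<^esub> t"
        by (blast elim: upE belowE)
      then show "t \<in> C\<star>"
        using star_via(2)[OF C] by blast
    qed
  qed
qed

lemma star_mult3: "coset N Z C \<Longrightarrow> s \<in> C\<star> \<Longrightarrow> a \<in> C \<Longrightarrow> t \<in> C\<star> \<Longrightarrow> s * a * t \<in> C\<star>"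
  using coset_mult3[OF coset_star] star_star by metis

abbreviation src where "src C \<equiv> source N Z C"
abbreviation rng where "rng C \<equiv> range_coset N Z C"

lemma src_star: "coset N Z C \<Longrightarrow> src (C\<star>) = rng C"
  and rng_star: "coset N Z C \<Longrightarrow> rng (C\<star>) = src C"
  by (simp_all add: source_def range_coset_def star_star)

lemma rounds:
  assumes "coset N Z C"
  shows "round C" "round (C\<star>)" "round (C\<star> * C)" "round (C * C\<star>)"
  using cosetD(3) coset_star assms round_mult by auto

lemma mult_in_src: "coset N Z C \<Longrightarrow> s \<in> C\<star> \<Longrightarrow> a \<in> C \<Longrightarrow> s * a \<in> src C"
  and mult_in_rng: "coset N Z C \<Longrightarrow> s \<in> C\<star> \<Longrightarrow> a \<in> C \<Longrightarrow> a * s \<in> rng C"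
  unfolding source_def range_coset_def using rounds round_subset_up by (blast intro: set_times_intro)+

lemma mult_src:
  assumes C: "coset N Z C" and a: "a \<in> C" "x \<in> src C"
  shows "a * x \<in> C"
proof -
  obtain s c where x: "s \<in> C\<star>" "c \<in> C" "s * c \<lhd> x"
    using a(2) unfolding source_def by (blast elim!: upE set_times_elim)
  obtain a' t where "a' \<in> C" "a' \<lhd>\<^bsub>t\<^esub> a"
    using coset_belowE[OF C a(1)] by blast
  then have "a' * s * c \<in> C" "a' * (s * c) \<lhd> a * x"
    using coset_mult3[OF C] x below_mult belowI by blast+
  then show ?thesis
    using coset_below[OF C] by (simp add: mult.assoc)
qed

lemma rng_mult:
  assumes C: "coset N Z C" and a: "a \<in> C" "x \<in> rng C"
  shows "x * a \<in> C"
proof -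
  obtain s c where x: "s \<in> C\<star>" "c \<in> C" "c * s \<lhd> x"
    using a(2) unfolding range_coset_def by (blast elim!: upE set_times_elim)
  obtain a' t where "a' \<in> C" "a' \<lhd>\<^bsub>t\<^esub> a"
    using coset_belowE[OF C a(1)] by blast
  then have "c * s * a' \<in> C" "c * s * a' \<lhd> x * a"
    using coset_mult3[OF C] x below_mult belowI by blast+
  then show ?thesis
    using coset_below[OF C] by simp
qed

lemma coset_triple:
  assumes C: "coset N Z C"
  shows "(C * C\<star> * C)\<up> = C"
proof
  show "(C * C\<star> * C)\<up> \<subseteq> C"
    using up_mono[OF cosetD(1)[OF C]] cosetD(2)[OF C] by simp
  show "C \<subseteq> (C * C\<star> * C)\<up>"
  proof
    fix c assume c: "c \<in> C"
    then obtain a s where a: "a \<in> C" "a \<lhd>\<^bsub>s\<^esub> c" "s \<in> C\<star>"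
      using coset_belowE[OF C] by blast
    then have "a * s * c \<in> C * C\<star> * C"
      using c by (simp add: set_times_intro)
    then show "c \<in> (C * C\<star> * C)\<up>"
      using a viaD(1)[OF a(2)] belowI upI by metis
  qed
qed

subsection \<open>Products of cosets\<close>

text \<open>
  A witness \<open>u\<close> for \<open>b * c\<close> cannot be split directly into witnesses for \<open>c\<close> and \<open>b\<close>. However,
  multiplying \<open>b * c\<close> on the right by an element of \<open>C\<star>\<close> leads into \<open>B\<close>, so \<open>k * u\<close> is in
  \<open>B\<star>\<close> for suitable \<open>k\<close> in \<open>C\<close>. Likewise, \<open>u * p\<close> is in \<open>C\<star>\<close> for suitable \<open>p\<close> in \<open>B\<close>. These
  are assembled to an element of \<open>C\<^sup>* B\<^sup>*\<close> that differs from \<open>u * (b * c) * u\<close> only by factors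
  from \<open>N\<close> and thus lies below \<open>u\<close>.
\<close>

lemma star_of_mult:
  assumes B: "coset N Z B" and C: "coset N Z C" and BC: "src B = rng C"
  shows "(B * C)\<star> \<subseteq> (C\<star> * B\<star>)\<up>"
proof
  fix u assume "u \<in> (B * C)\<star>"
  then obtain b c d where b: "b \<in> B" "c \<in> C" and u: "b * c \<lhd>\<^bsub>u\<^esub> d"
    by (auto simp: star_def elim!: set_times_elim)
  obtain t where "t \<in> C\<star>"
    using coset_belowE[OF C b(2)] by blast
  then obtain t' k where t': "t' \<in> C\<star>" "k \<in> C" "t' \<lhd>\<^bsub>k\<^esub> t"
    using round_star[OF C] by blast
  obtain q where "q \<in> B\<star>"
    using coset_belowE[OF B b(1)] by blast
  then obtain q' p where q': "q' \<in> B\<star>" "p \<in> B" "q' \<lhd>\<^bsub>p\<^esub> q"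
    using round_star[OF B] by blast
  have "b * (c * t') \<in> B"
    using mult_src[OF B b(1)] mult_in_rng[OF C t'(1) b(2)] BC by simp
  moreover have "b * (c * t') \<lhd>\<^bsub>k * u\<^esub> d * t"
    using via_mult[OF u t'(3)] by (simp add: mult.assoc)
  ultimately have ku: "k * u \<in> B\<star>"
    by (rule starI)
  have "q' * b * c \<in> C"
    using rng_mult[OF C b(2)] mult_in_src[OF B q'(1) b(1)] BC by simp
  moreover have "q' * b * c \<lhd>\<^bsub>u * p\<^esub> q * d"
    using via_mult[OF q'(3) u] by (simp add: mult.assoc)
  ultimately have up: "u * p \<in> C\<star>"
    by (rule starI)
  have "b * (c * (u * p)) \<in> B"
    using mult_src[OF B b(1)] mult_in_rng[OF C up b(2)] BC by simp
  then have "(k * u) * (b * (c * (u * p))) * q' \<in> B\<star>"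
    by (rule star_mult3[OF B ku _ q'(1)])
  then have "t' * ((k * u) * (b * (c * (u * p))) * q') \<in> C\<star> * B\<star>"
    using t'(1) by (simp add: set_times_intro)
  moreover have "(t' * k) * ((u * (b * c) * u) * (p * q')) \<lhd> u"
    using below_N[OF _ viaD(4)[OF q'(3)]] below_N(2)[OF _ viaD(3)[OF t'(3)]] via_switch[OF u] belowI
    by blast
  ultimately show "u \<in> (C\<star> * B\<star>)\<up>"
    by (intro upI) (simp_all add: mult.assoc)
qed

lemma coset_upI:
  assumes X: "round X" "X\<star> \<subseteq> W\<up>" "X * W * X \<subseteq> X\<up>"
  shows "coset N Z (X\<up>)"
proof -
  have "X\<up> * (X\<up>)\<star> * X\<up> \<subseteq> X\<up> * W\<up> * X\<up>"
    using star_up[OF X(1)] X(2) by (simp add: set_times_mono2)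
  also have "\<dots> \<subseteq> (X * W)\<up> * X\<up>"
    by (simp add: set_times_mono2 up_mult_subset)
  also have "\<dots> \<subseteq> (X * W * X)\<up>"
    by (rule up_mult_subset)
  also have "\<dots> \<subseteq> X\<up>"
    using up_mono[OF X(3)] up_up_subset by blast
  finally show ?thesis
    using up_up[OF X(1)] by (simp add: coset_def)
qed

lemma coset_mult:
  assumes B: "coset N Z B" and C: "coset N Z C" and BC: "src B = rng C"
  shows "coset N Z ((B * C)\<up>)"
proof (rule coset_upI)
  show "round (B * C)" "(B * C)\<star> \<subseteq> (C\<star> * B\<star>)\<up>"
    using star_of_mult assms rounds round_mult by simp_all
  show "B * C * (C\<star> * B\<star>) * (B * C) \<subseteq> (B * C)\<up>"
  proof (safe elim!: set_times_elim)
    fix b c t s b' c' assume *: "b \<in> B" "c \<in> C" "t \<in> C\<star>" "s \<in> B\<star>" "b' \<in> B" "c' \<in> C"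
    have "b * (c * t) \<in> B"
      using mult_src[OF B *(1)] mult_in_rng[OF C *(3,2)] BC by simp
    then have "b * (c * t) * s * b' \<in> B"
      using coset_mult3[OF B] * by simp
    then have "b * (c * t) * s * b' * c' \<in> (B * C)\<up>"
      using * round_subset_up[OF round_mult] rounds(1) B C by (meson set_times_intro subsetD)
    then show "b * c * (t * s) * (b' * c') \<in> (B * C)\<up>"
      by (simp add: mult.assoc)
  qed
qed

lemma star_mult:
  assumes B: "coset N Z B" and C: "coset N Z C" and BC: "src B = rng C"
  shows "((B * C)\<up>)\<star> = (C\<star> * B\<star>)\<up>"
proof
  have r: "round (B * C)"
    using rounds(1) round_mult B C by simp
  show "((B * C)\<up>)\<star> \<subseteq> (C\<star> * B\<star>)\<up>"
    using star_of_mult[OF assms] star_up[OF r] by simp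
  have "C\<star> * B\<star> \<subseteq> (B * C)\<star>"
    by (auto elim!: set_times_elim simp: star_def[of _ _ B] star_def[of _ _ C])
       (metis set_times_intro starI via_mult)
  then have "(C\<star> * B\<star>)\<up> \<subseteq> (((B * C)\<up>)\<star>)\<up>"
    using star_up[OF r] by (simp add: up_mono)
  then show "(C\<star> * B\<star>)\<up> \<subseteq> ((B * C)\<up>)\<star>"
    using cosetD(2)[OF coset_star[OF coset_mult[OF assms]]] by simp
qed

text \<open>
  A generating set of the source may be cancelled, by \<open>coset_triple\<close>. All groupoid
  identities for cosets come down to this and to its mirror image.
\<close>

lemma src_cancel:
  assumes C: "coset N Z C" and X: "round X" "src C = X\<up>"
  shows "(C * X)\<up> = C"
proof -
  have "C = (C * (C\<star> * C)\<up>)\<up>"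
    using coset_triple[OF C] up_mult(3)[OF rounds(1,3)[OF C]] by (simp add: mult.assoc)
  also have "\<dots> = (C * X)\<up>"
    using X up_mult(3)[OF rounds(1)[OF C] X(1)] by (simp add: source_def)
  finally show ?thesis ..
qed

lemma rng_cancel:
  assumes C: "coset N Z C" and X: "round X" "rng C = X\<up>"
  shows "(X * C)\<up> = C"
proof -
  have "C = ((C * C\<star>)\<up> * C)\<up>"
    using coset_triple[OF C] up_mult(2)[OF rounds(4,1)[OF C]] by simp
  also have "\<dots> = (X * C)\<up>"
    using X up_mult(2)[OF X(1) rounds(1)[OF C]] by (simp add: range_coset_def)
  finally show ?thesis ..
qed

lemma mult_cancel:
  assumes B: "coset N Z B" and C: "coset N Z C" and BC: "src B = rng C"
  shows "(B\<star> * (B * C)\<up>)\<up> = C" "((B * C)\<up> * C\<star>)\<up> = B"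
    "src ((B * C)\<up>) = src C" "rng ((B * C)\<up>) = rng B"
proof -
  note r = rounds[OF B] rounds[OF C] round_mult
  have 1: "((B\<star> * B) * C)\<up> = C" "(B * (C * C\<star>))\<up> = B"
    using rng_cancel[OF C r(3)] src_cancel[OF B r(8)] BC by (simp_all add: source_def range_coset_def)
  then show "(B\<star> * (B * C)\<up>)\<up> = C" "((B * C)\<up> * C\<star>)\<up> = B"
    using r by (simp_all add: up_mult mult.assoc)
  have 2: "(C\<star> * (B\<star> * B))\<up> = C\<star>" "((C * C\<star>) * B\<star>)\<up> = B\<star>"
    using src_cancel[OF coset_star[OF C] r(3)] rng_cancel[OF coset_star[OF B] r(8)] BC
      src_star[OF C] rng_star[OF B]
    by (simp_all add: source_def range_coset_def)
  have "src ((B * C)\<up>) = ((C\<star> * (B\<star> * B)) * C)\<up>"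
    unfolding source_def[of _ _ "(B * C)\<up>"] star_mult[OF assms]
    using r by (simp add: up_mult mult.assoc)
  also have "\<dots> = ((C\<star> * (B\<star> * B))\<up> * C)\<up>"
    using r by (simp add: up_mult)
  finally show "src ((B * C)\<up>) = src C"
    unfolding 2 source_def[of _ _ C] .
  have "rng ((B * C)\<up>) = (B * ((C * C\<star>) * B\<star>))\<up>"
    unfolding range_coset_def[of _ _ "(B * C)\<up>"] star_mult[OF assms]
    using r by (simp add: up_mult mult.assoc)
  also have "\<dots> = (B * ((C * C\<star>) * B\<star>)\<up>)\<up>"
    using r by (simp add: up_mult)
  finally show "rng ((B * C)\<up>) = rng B"
    unfolding 2 range_coset_def[of _ _ B] .
qed

subsection \<open>Unit cosets\<close>

definition unit_coset :: "'a set \<Rightarrow> bool" where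
  "unit_coset U \<longleftrightarrow> coset N Z U \<and> U\<star> = U \<and> src U = U"

lemma unit_cosetD:
  assumes "unit_coset U"
  shows "coset N Z U" "U\<star> = U" "src U = U" "rng U = U" "x \<in> U \<Longrightarrow> y \<in> U \<Longrightarrow> x * y \<in> U"
    "(U * U)\<up> = U"
  using assms mult_src unfolding unit_coset_def by (auto simp: source_def range_coset_def)

lemma unit_src: "coset N Z C \<Longrightarrow> unit_coset (src C)"
  using coset_mult[OF coset_star, of C C] star_mult[OF coset_star, of C C]
    mult_cancel(3)[OF coset_star, of C C] src_star[of C]
  by (simp add: unit_coset_def star_star source_def)

lemma unit_rng: "coset N Z C \<Longrightarrow> unit_coset (rng C)"
  using unit_src[OF coset_star] by (simp add: src_star)

text \<open>
  A coset is recovered from its source and one of its elements, since for \<open>a\<close> and \<open>c\<close> in \<open>C\<close> the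
  product \<open>a * s * c'\<close> differs from \<open>c'\<close> by the central factor \<open>a * s\<close>. Consequently the cosets
  containing a given element form a slice.
\<close>

lemma src_translate:
  assumes C: "coset N Z C" and a: "a \<in> C" "c \<in> C"
  obtains x where "x \<in> src C" "a * x \<lhd> c"
proof -
  obtain a' s where s: "a' \<lhd>\<^bsub>s\<^esub> a" "s \<in> C\<star>"
    using coset_belowE[OF C a(1)] by blast
  obtain c' t where c: "c' \<in> C" "c' \<lhd>\<^bsub>t\<^esub> c"
    using coset_belowE[OF C a(2)] by blast
  have "a * s * c' \<lhd> c"
    using below_N(2) belowI[OF c(2)] Z_N viaD(5)[OF s(1)] by blast
  then show thesis
    using that[of "s * c'"] mult_in_src[OF C s(2) c(1)] by (simp add: mult.assoc)
qed

lemma rng_translate: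
  assumes C: "coset N Z C" and a: "a \<in> C" "c \<in> C"
  obtains x where "x \<in> rng C" "x * a \<lhd> c"
proof -
  obtain a' s where s: "a' \<lhd>\<^bsub>s\<^esub> a" "s \<in> C\<star>"
    using coset_belowE[OF C a(1)] by blast
  obtain c' t where c: "c' \<in> C" "c' \<lhd>\<^bsub>t\<^esub> c"
    using coset_belowE[OF C a(2)] by blast
  have "c' * (s * a) \<lhd> c"
    using below_N(1) belowI[OF c(2)] Z_N viaD(6)[OF s(1)] by blast
  then show thesis
    using that[of "c' * s"] mult_in_rng[OF C s(2) c(1)] by (simp add: mult.assoc)
qed

lemma coset_eq_src:
  assumes "coset N Z C" "coset N Z D" "a \<in> C" "a \<in> D" "src C = src D"
  shows "C = D"
proof -
  have "C \<subseteq> D" if "coset N Z C" "coset N Z D" "a \<in> C" "a \<in> D" "src C = src D" for C D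
    using that src_translate mult_src coset_below by (metis subsetI)
  then show ?thesis
    using assms by (metis subset_antisym)
qed

lemma coset_eq_rng:
  assumes "coset N Z C" "coset N Z D" "a \<in> C" "a \<in> D" "rng C = rng D"
  shows "C = D"
proof -
  have "C \<subseteq> D" if "coset N Z C" "coset N Z D" "a \<in> C" "a \<in> D" "rng C = rng D" for C D
    using that rng_translate rng_mult coset_below by (metis subsetI)
  then show ?thesis
    using assms by (metis subset_antisym)
qed

text \<open>
  By \<open>via_N_swap\<close> an element of \<open>U\<close> below \<open>n\<close> is a witness for an element of the source of
  \<open>U\<close>, and as a unit coset the source is its own inverse. So \<open>U\<close> meets its source and therefore equals it.
\<close>

lemma unit_if_meets_N:
  assumes U: "coset N Z U" and n: "n \<in> U" "n \<in> N"
  shows "unit_coset U"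
proof -
  let ?V = "src U"
  have V: "unit_coset ?V"
    by (rule unit_src[OF U])
  obtain m s where m: "m \<in> U" "m \<lhd>\<^bsub>s\<^esub> n"
    using coset_belowE[OF U n(1)] by blast
  then obtain l w where l: "l \<in> U" "l \<lhd>\<^bsub>w\<^esub> m" "w \<in> U\<star>"
    using coset_belowE[OF U] by blast
  have "m \<in> N"
    using below_in_N belowI m(2) n(2) by blast
  then have "w * l \<lhd>\<^bsub>m\<^esub> w"
    by (rule via_N_swap[OF l(2)])
  then have "m \<in> ?V"
    using starI[OF mult_in_src[OF U l(3,1)]] unit_cosetD(2)[OF V] by simp
  then have "U = ?V"
    using coset_eq_src[OF U _ m(1)] unit_cosetD(1,3)[OF V] by simp
  then show ?thesis
    using V by simp
qed

text \<open>
  A unit coset can be moved along any element that is invertible over it. This is what produces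
  enough cosets: it makes the source map open, and it splits a coset containing \<open>a * b\<close> into a
  product of cosets containing \<open>a\<close> and \<open>b\<close>.
\<close>

lemma translate_unit:
  assumes U: "unit_coset U" and n: "n \<in> U" "n \<in> N" and b: "b * t \<in> Z" "t * b \<in> Z" "t * b * n = n"
  defines "C \<equiv> ({b} * U)\<up>"
  shows "coset N Z C" "b * n \<in> C" "b \<in> C" "t \<in> C\<star>" "src C = U"
    and "directed N Z U \<Longrightarrow> directed N Z C"
proof -
  let ?X = "{b} * U"
  note U' = unit_cosetD[OF U]
  have ntb: "n * (t * b) = n"
    using Z_central[OF b(2) n(2)] b(3) by simp
  have bn: "b * n \<lhd>\<^bsub>t\<^esub> b"
    by (rule via_cut_right[OF b(1,2) n(2) b(3)])
  have nt: "n * t \<lhd>\<^bsub>b\<^esub> t"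
    by (rule via_cut_left[OF b(2,1) n(2) ntb])
  have move: "b * (n * x) \<in> ?X" "b * (n * x) \<lhd> b * y" if "x \<in> U" "x \<lhd> y" for x y
    using that U'(5)[OF n(1)] below_mult[OF belowI[OF bn] that(2)] by (auto simp: mult.assoc)
  have X: "round ?X"
    unfolding round_def
  proof
    fix y assume "y \<in> ?X"
    then obtain x where x: "y = b * x" "x \<in> U"
      by (auto elim!: set_times_elim)
    then show "y \<in> ?X\<up>"
      using move coset_belowE[OF U'(1) x(2)] by (metis upI belowI)
  qed
  have tb: "t * b \<in> U"
  proof (rule coset_below[OF U'(1) n(1)], rule belowI, rule viaI)
    show "n * (t * b) * (t * b) = n" "t * b * (t * b) * n = n"
      using ntb b(3) by (simp_all add: mult.assoc)
    show "n * (t * b) \<in> N" "t * b * n \<in> N" "t * b * (t * b) \<in> Z"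
      using ntb b n Z_mult by simp_all
  qed (use b Z_mult in simp_all)
  have star: "?X\<star> \<subseteq> (U * {t})\<up>"
  proof
    fix u assume "u \<in> ?X\<star>"
    then obtain x d where x: "x \<in> U" and u: "b * x \<lhd>\<^bsub>u\<^esub> d"
      by (auto simp: star_def elim!: set_times_elim)
    have via: "y' * (n * t) \<lhd>\<^bsub>b * y\<^esub> y'' * t" if "y' \<lhd>\<^bsub>y\<^esub> y''" for y y' y''
      by (rule via_mult[OF that nt])
    \<comment> \<open>\<open>u\<close> behaves like an inverse of \<open>b\<close> over \<open>U\<close>: as \<open>y' * (n * t) * (b * x)\<close> is in \<open>U\<close>, its
      witness is in the inverse of \<open>U\<close>, which is \<open>U\<close>\<close>
    have uby: "u * (b * y) \<in> U" if "y \<in> U" for y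
    proof -
      obtain y' y'' where y: "y' \<in> U" "y' \<lhd>\<^bsub>y\<^esub> y''"
        using \<open>y \<in> U\<close> U'(1,2) starE by metis
      have "y' * (n * t) * (b * x) \<lhd>\<^bsub>u * (b * y)\<^esub> y'' * t * d"
        by (rule via_mult[OF via[OF y(2)] u])
      moreover have "y' * (n * t) * (b * x) = y' * (n * (t * b) * x)"
        by (simp add: mult.assoc)
      ultimately have "y' * (n * x) \<lhd>\<^bsub>u * (b * y)\<^esub> y'' * t * d"
        by (simp add: ntb)
      then show ?thesis
        using starI U'(2,5) n(1) x y(1) by metis
    qed
    obtain y' y'' where y: "y' \<in> U" "y' \<lhd>\<^bsub>n\<^esub> y''"
      using n(1) U'(1,2) starE by metis
    have "u * (b * x) * u * (b * n * (y' * (n * t))) \<lhd> u"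
      by (rule below_N(1)[OF belowI[OF via_switch[OF u]] viaD(4)[OF via[OF y(2)]]])
    moreover have "u * (b * x) * (u * (b * n)) * (y' * n) * t \<in> U * {t}"
      using U'(5)[OF U'(5)[OF uby[OF x] uby[OF n(1)]] U'(5)[OF y(1) n(1)]]
      by (simp add: set_times_intro)
    ultimately show "u \<in> (U * {t})\<up>"
      by (intro upI) (simp_all add: mult.assoc)
  qed
  have "?X * (U * {t}) * ?X \<subseteq> ?X\<up>"
  proof (safe elim!: set_times_elim)
    fix x y z assume "x \<in> U" "y \<in> U" "z \<in> U"
    then have "x * y * (t * b) * z \<in> U"
      using U'(5) tb by blast
    then have "b * (x * y * (t * b) * z) \<in> ?X"
      by blast
    then show "b * x * (y * t) * (b * z) \<in> ?X\<up>"
      using round_subset_up[OF X] by (auto simp: mult.assoc)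
  qed
  then show C: "coset N Z C"
    using coset_upI[OF X star] C_def by simp
  have XC: "b * x \<in> C" if "x \<in> U" for x
    using that round_subset_up[OF X] unfolding C_def by blast
  show "b * n \<in> C"
    by (rule XC[OF n(1)])
  then show "b \<in> C" "t \<in> C\<star>"
    using bn C coset_below starI belowI by blast+
  show "src C = U"
  proof
    have "C\<star> * C \<subseteq> (U * {t})\<up> * ?X\<up>"
      using star star_up[OF X] unfolding C_def by (simp add: set_times_mono2)
    also have "\<dots> \<subseteq> (U * {t} * ?X)\<up>"
      by (rule up_mult_subset)
    also have "\<dots> \<subseteq> U\<up>"
    proof (rule up_mono, safe elim!: set_times_elim)
      fix x y assume "x \<in> U" "y \<in> U"
      then have "x * (t * b) * y \<in> U"
        using U'(5) tb by blast
      then show "x * t * (b * y) \<in> U"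
        by (simp add: mult.assoc)
    qed
    also have "U\<up> = U"
      by (rule cosetD(2)[OF U'(1)])
    finally show "src C \<subseteq> U"
      unfolding source_def using up_mono cosetD(2)[OF U'(1)] by blast
    show "U \<subseteq> src C"
    proof
      fix x assume "x \<in> U"
      then obtain x' where x': "x' \<in> U" "x' \<lhd> x"
        using coset_belowE[OF U'(1)] belowI by metis
      have "t * b * x' \<lhd> x"
        by (rule below_N(2)[OF x'(2) Z_N[OF b(2)]])
      moreover have "t * (b * x') \<in> src C"
        by (rule mult_in_src[OF C \<open>t \<in> C\<star>\<close> XC[OF x'(1)]])
      ultimately show "x \<in> src C"
        using coset_below unit_cosetD(1)[OF unit_src[OF C]] by (metis mult.assoc)
    qed
  qed
  show "directed N Z C" if U: "directed N Z U"
    unfolding directed_def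
  proof safe
    fix p q assume "p \<in> C" "q \<in> C"
    then obtain x y where xy: "x \<in> U" "y \<in> U" "b * x \<lhd> p" "b * y \<lhd> q"
      unfolding C_def by (auto elim!: upE set_times_elim)
    then obtain z where "z \<in> U" "z \<lhd> x" "z \<lhd> y"
      using U unfolding directed_def by blast
    then have "b * (n * z) \<in> C" "b * (n * z) \<lhd> b * x" "b * (n * z) \<lhd> b * y"
      using move XC U'(5) n(1) by blast+
    then show "\<exists>d\<in>C. d \<lhd> p \<and> d \<lhd> q"
      using xy below_trans by blast
  qed
qed

subsection \<open>Directed cosets\<close>

text \<open>
  Witnesses \<open>s\<close> and \<open>t\<close> over a common element \<open>e\<close> have the common lower bound
  \<open>(s * e * s) * e * (t * e * t)\<close>: it can be bracketed as \<open>s * e * s\<close> times an element of \<open>N\<close>,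
  and as an element of \<open>N\<close> times \<open>t * e * t\<close>.
\<close>

lemma directed_star:
  assumes C: "coset N Z C" and d: "directed N Z C"
  shows "directed N Z (C\<star>)"
  unfolding directed_def
proof safe
  fix s t assume *: "s \<in> C\<star>" "t \<in> C\<star>"
  obtain a c a' c' where a: "a \<in> C" "a \<lhd>\<^bsub>s\<^esub> c" "a' \<in> C" "a' \<lhd>\<^bsub>t\<^esub> c'"
    using starE[OF C] * by metis
  then obtain e where e: "e \<in> C" "e \<lhd>\<^bsub>s\<^esub> c" "e \<lhd>\<^bsub>t\<^esub> c'"
    using d below_via_trans unfolding directed_def by metis
  let ?r = "(s * e * s) * e * (t * e * t)"
  have "?r \<in> C\<star>"
    using star_mult3[OF C] * e by blast
  moreover have "(s * e * s) * (e * t * (e * t)) \<lhd> s"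
    by (rule below_N(1)) (use via_switch[OF e(2)] belowI viaD[OF e(3)] N_mult in blast)+
  moreover have "(s * e * (s * e)) * (t * e * t) \<lhd> t"
    by (rule below_N(2)) (use via_switch[OF e(3)] belowI viaD[OF e(2)] N_mult in blast)+
  ultimately show "\<exists>r\<in>C\<star>. r \<lhd> s \<and> r \<lhd> t"
    by (intro bexI[of _ ?r]) (simp_all add: mult.assoc)
qed

lemma directed_mult:
  assumes B: "round B" "directed N Z B" and C: "round C" "directed N Z C"
  shows "directed N Z ((B * C)\<up>)"
  unfolding directed_def
proof safe
  fix p q assume "p \<in> (B * C)\<up>" "q \<in> (B * C)\<up>"
  then obtain b c b' c' where *: "b \<in> B" "c \<in> C" "b * c \<lhd> p" "b' \<in> B" "c' \<in> C" "b' * c' \<lhd> q"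
    by (auto elim!: upE set_times_elim)
  obtain x y where x: "x \<in> B" "x \<lhd> b" "x \<lhd> b'" "y \<in> C" "y \<lhd> c" "y \<lhd> c'"
    using * assms(2,4) unfolding directed_def by metis
  then have "x * y \<in> (B * C)\<up>"
    using round_subset_up[OF round_mult[OF B(1) C(1)]] by blast
  moreover have "x * y \<lhd> p" "x * y \<lhd> q"
    using x * below_mult below_trans by blast+
  ultimately show "\<exists>d\<in>(B * C)\<up>. d \<lhd> p \<and> d \<lhd> q"
    by blast
qed

abbreviation dcosets where "dcosets \<equiv> directed_cosets N Z"

lemma dcosetD:
  assumes "D \<in> dcosets"
  shows "coset N Z D" "D \<noteq> {}" "directed N Z D" "D \<in> cosets N Z"
  using assms by (auto simp: directed_cosets_def cosets_def)

lemma dcosetI: "coset N Z D \<Longrightarrow> a \<in> D \<Longrightarrow> directed N Z D \<Longrightarrow> D \<in> dcosets"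
  by (auto simp: directed_cosets_def cosets_def)

lemma dcoset_lower:
  assumes "D \<in> dcosets" "a \<in> D" "b \<in> D"
  obtains d where "d \<in> D" "d \<lhd> a" "d \<lhd> b"
  using assms dcosetD(3) unfolding directed_def by blast

lemma dcoset_star: "D \<in> dcosets \<Longrightarrow> D\<star> \<in> dcosets"
  using dcosetD coset_star directed_star coset_belowE by (metis dcosetI ex_in_conv)

lemma mult_in_mult:
  assumes "coset N Z B" "coset N Z C" "b \<in> B" "c \<in> C"
  shows "b * c \<in> (B * C)\<up>"
  using assms round_subset_up[OF round_mult] rounds(1) by blast

lemma dcoset_mult:
  assumes "B \<in> dcosets" "C \<in> dcosets" "src B = rng C"
  shows "(B * C)\<up> \<in> dcosets"
  using assms dcosetD[of B] dcosetD[of C] coset_mult directed_mult rounds(1) mult_in_mult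
  by (metis dcosetI ex_in_conv)

lemma dcoset_src: "D \<in> dcosets \<Longrightarrow> src D \<in> dcosets"
  using dcoset_mult[of "D\<star>" D] dcoset_star src_star dcosetD(1) by (simp add: source_def)

text \<open>
  The factor containing \<open>b\<close> is the source of \<open>D\<close> moved along \<open>b\<close>, and the factor containing \<open>a\<close>
  is the quotient of \<open>D\<close> by it. This requires \<open>b\<close> to be invertible over the source of \<open>D\<close>.
\<close>

lemma split_dcoset:
  assumes sym: "symmetric_subsemigroup Z" and D: "D \<in> dcosets" and ab: "a * b \<in> D"
  obtains B C where "B \<in> dcosets" "C \<in> dcosets" "a \<in> B" "b \<in> C" "src B = rng C" "(B * C)\<up> = D"
proof -
  note D' = dcosetD[OF D]
  obtain d s where d: "d \<in> D" "d \<lhd>\<^bsub>s\<^esub> a * b" "s \<in> D\<star>"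
    using coset_belowE[OF D'(1) ab] by blast
  note eq = via_rewrite[OF d(2)] viaD[OF d(2)]
  \<comment> \<open>symmetry of \<open>Z\<close> lets \<open>t\<close> invert \<open>b\<close> on both sides, whereas \<open>s * a\<close> does so only on the left\<close>
  define t where "t = s * a * b * s * a"
  have t: "b * t \<in> Z" "t * b \<in> Z"
  proof -
    have "s * a * b \<in> Z"
      using eq by (simp add: mult.assoc)
    then have "b * (s * a) * b * (s * a) \<in> Z" "(s * a * b) * (s * a * b) \<in> Z"
      using sym Z_mult unfolding symmetric_subsemigroup_def by blast+
    then show "b * t \<in> Z" "t * b \<in> Z"
      by (simp_all add: t_def mult.assoc)
  qed
  have sd: "s * d \<in> src D" "s * d \<in> N" "t * b * (s * d) = s * d"
    using mult_in_src[OF D'(1) d(3,1)] eq by (simp_all add: t_def mult.assoc)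
  define C where "C = ({b} * src D)\<up>"
  note C = translate_unit[OF unit_src[OF D'(1)] sd(1,2) t sd(3), folded C_def]
  have Cd: "C \<in> dcosets"
    using C dcosetD(3)[OF dcoset_src[OF D]] dcosetI by blast
  have DC: "src D = rng (C\<star>)"
    using C rng_star by simp
  define B where "B = (D * C\<star>)\<up>"
  have Bd: "B \<in> dcosets"
    unfolding B_def by (rule dcoset_mult[OF D dcoset_star[OF Cd] DC])
  have BC: "src B = rng C"
    unfolding B_def using mult_cancel(3)[OF D'(1) coset_star[OF C(1)] DC] src_star[OF C(1)] by simp
  have "(B * C)\<up> = D"
    using mult_cancel(2)[OF D'(1) coset_star[OF C(1)] DC] star_star[OF C(1)] unfolding B_def by simp
  moreover have "a \<in> B"
  proof -
    let ?t = "b * s * a * b * s"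
    have "d * s * a \<lhd>\<^bsub>?t\<^esub> a"
    proof (rule via_cut_left)
      have "(a * b * s) * (a * b * s) \<in> Z"
        by (rule Z_mult[OF eq(9,9)])
      then show "a * ?t \<in> Z"
        by (simp add: mult.assoc)
      show "?t * a \<in> Z"
        using t(1) by (simp add: t_def mult.assoc)
      show "d * s \<in> N" "d * s * (a * ?t) = d * s"
        using eq by (simp_all add: mult.assoc)
    qed
    moreover have "d * t = d * s * a"
      using eq by (simp add: t_def mult.assoc)
    moreover have "d * t \<in> B"
      unfolding B_def using mult_in_mult D'(1) coset_star C d by blast
    ultimately show ?thesis
      using coset_below dcosetD(1)[OF Bd] belowI by metis
  qed
  ultimately show thesis
    using that Bd Cd C(3) BC by blast
qed

end

section \<open>The etale groupoid of directed cosets\<close>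

text \<open>
  Both topologies to be considered are given by a subbasis. On directed cosets the subbasic
  sets have the filtering property required here, which makes them a basis. Openness can
  then be tested point by point.
\<close>

lemma openin_restricted_generated:
  assumes basis: "\<And>S x. S \<in> \<S> \<Longrightarrow> x \<in> S \<Longrightarrow> x \<in> X \<Longrightarrow> \<exists>i. P x i \<and> (\<forall>y\<in>X. P y i \<longrightarrow> y \<in> S)"
    and filtered: "\<And>x i j. x \<in> X \<Longrightarrow> P x i \<Longrightarrow> P x j \<Longrightarrow>
        \<exists>k. P x k \<and> (\<forall>y\<in>X. P y k \<longrightarrow> P y i \<and> P y j)"
    and "open": "\<And>i. openin (subtopology (topology_generated_by \<S>) X) {y \<in> X. P y i}"
  shows "openin (subtopology (topology_generated_by \<S>) X) W \<longleftrightarrow>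
    W \<subseteq> X \<and> (\<forall>x\<in>W. \<exists>i. P x i \<and> (\<forall>y\<in>X. P y i \<longrightarrow> y \<in> W))"
proof
  assume "openin (subtopology (topology_generated_by \<S>) X) W"
  then obtain T where T: "generate_topology_on \<S> T" "W = T \<inter> X"
    by (auto simp: openin_subtopology openin_topology_generated_by_iff)
  have "\<forall>x\<in>T \<inter> X. \<exists>i. P x i \<and> (\<forall>y\<in>X. P y i \<longrightarrow> y \<in> T)"
    using T(1)
  proof (induction rule: generate_topology_on.induct)
    case (Int A B)
    show ?case
    proof
      fix x assume x: "x \<in> A \<inter> B \<inter> X"
      then obtain i j where "P x i" "\<forall>y\<in>X. P y i \<longrightarrow> y \<in> A" "P x j" "\<forall>y\<in>X. P y j \<longrightarrow> y \<in> B"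
        using Int.IH by blast
      moreover obtain k where "P x k" "\<forall>y\<in>X. P y k \<longrightarrow> P y i \<and> P y j"
        using filtered calculation x by blast
      ultimately show "\<exists>i. P x i \<and> (\<forall>y\<in>X. P y i \<longrightarrow> y \<in> A \<inter> B)"
        by blast
    qed
  next
    case (UN K)
    show ?case
    proof
      fix x assume "x \<in> \<Union>K \<inter> X"
      then obtain k where "k \<in> K" "x \<in> k \<inter> X"
        by blast
      then show "\<exists>i. P x i \<and> (\<forall>y\<in>X. P y i \<longrightarrow> y \<in> \<Union>K)"
        using UN.IH by (metis UnionI)
    qed
  next
    case (Basis S)
    then show ?case
      using basis by blast
  qed simp
  then show "W \<subseteq> X \<and> (\<forall>x\<in>W. \<exists>i. P x i \<and> (\<forall>y\<in>X. P y i \<longrightarrow> y \<in> W))"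
    using T(2) by auto
next
  assume W: "W \<subseteq> X \<and> (\<forall>x\<in>W. \<exists>i. P x i \<and> (\<forall>y\<in>X. P y i \<longrightarrow> y \<in> W))"
  show "openin (subtopology (topology_generated_by \<S>) X) W"
  proof (subst openin_subopen, rule ballI)
    fix x assume x: "x \<in> W"
    then obtain i where i: "P x i" "\<forall>y\<in>X. P y i \<longrightarrow> y \<in> W"
      using W by blast
    then show "\<exists>T. openin (subtopology (topology_generated_by \<S>) X) T \<and> x \<in> T \<and> T \<subseteq> W"
      using "open"[of i] W x by (intro exI[of _ "{y \<in> X. P y i}"]) blast
  qed
qed

lemma continuous_map_atI:
  assumes "\<And>x. x \<in> topspace X \<Longrightarrow> f x \<in> topspace Y"
    and "\<And>x V. x \<in> topspace X \<Longrightarrow> openin Y V \<Longrightarrow> f x \<in> V \<Longrightarrow>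
      \<exists>U. openin X U \<and> x \<in> U \<and> (\<forall>y\<in>U. f y \<in> V)"
  shows "continuous_map X Y f"
  using assms by (auto simp: continuous_map_eq_topcontinuous_at topcontinuous_at_def)

lemma continuous_map_pairs_atI:
  assumes "C \<subseteq> topspace X \<times> topspace Y"
    and "\<And>x y. (x, y) \<in> C \<Longrightarrow> f (x, y) \<in> topspace T"
    and "\<And>x y V. (x, y) \<in> C \<Longrightarrow> openin T V \<Longrightarrow> f (x, y) \<in> V \<Longrightarrow>
      \<exists>U U'. openin X U \<and> openin Y U' \<and> x \<in> U \<and> y \<in> U' \<and>
        (\<forall>x'\<in>U. \<forall>y'\<in>U'. (x', y') \<in> C \<longrightarrow> f (x', y') \<in> V)"
  shows "continuous_map (subtopology (prod_topology X Y) C) T f"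
proof (rule continuous_map_atI)
  fix p V assume "p \<in> topspace (subtopology (prod_topology X Y) C)" "openin T V" "f p \<in> V"
  then obtain x y U U' where *: "p = (x, y)" "(x, y) \<in> C" "openin X U" "openin Y U'" "x \<in> U" "y \<in> U'"
    "\<forall>x'\<in>U. \<forall>y'\<in>U'. (x', y') \<in> C \<longrightarrow> f (x', y') \<in> V"
    using assms(3) by (metis IntD2 surj_pair topspace_subtopology)
  then have "openin (subtopology (prod_topology X Y) C) (C \<inter> U \<times> U')"
    by (intro openin_subtopology_Int2) (simp add: openin_prod_Times_iff)
  then show "\<exists>W. openin (subtopology (prod_topology X Y) C) W \<and> p \<in> W \<and> (\<forall>q\<in>W. f q \<in> V)"
    using * by blast
qed (use assms in auto)

context structured
begin

abbreviation GD where "GD \<equiv> directed_coset_groupoid N Z"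

lemma topspace_cosets:
  "topspace (topology_generated_by {{C \<in> cosets N Z. a \<in> C} |a. True}) = cosets N Z"
  by (auto simp: cosets_def)

lemma GD_simps:
  "gset GD = dcosets" "topspace (gtop GD) = dcosets"
  "gcomp GD B C \<longleftrightarrow> B \<in> dcosets \<and> C \<in> dcosets \<and> src B = rng C"
  "gmult GD B C = (B * C)\<up>" "ginv GD C = C\<star>"
  "gsrc GD C = src C"
proof -
  show *: "topspace (gtop GD) = dcosets"
    unfolding directed_coset_groupoid_def restrict_groupoid_def coset_groupoid_def
      top_groupoid.simps topspace_subtopology topspace_cosets
    using dcosetD(4) by auto
  then show "gset GD = dcosets"
    by (simp add: gset_def)
qed (auto simp: directed_coset_groupoid_def restrict_groupoid_def coset_groupoid_def dcosetD
    gsrc_def source_def)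

lemma GD_rng: "grng GD C = rng C"
  by (simp add: grng_def GD_simps range_coset_def)

lemma openin_GD:
  "openin (gtop GD) W \<longleftrightarrow>
    W \<subseteq> dcosets \<and> (\<forall>D\<in>W. \<exists>d. d \<in> D \<and> (\<forall>E\<in>dcosets. d \<in> E \<longrightarrow> E \<in> W))"
proof -
  let ?\<S> = "{{C \<in> cosets N Z. a \<in> C} |a. True}"
  have "openin (subtopology (topology_generated_by ?\<S>) dcosets) W \<longleftrightarrow>
    W \<subseteq> dcosets \<and> (\<forall>D\<in>W. \<exists>d. d \<in> D \<and> (\<forall>E\<in>dcosets. d \<in> E \<longrightarrow> E \<in> W))"
  proof (rule openin_restricted_generated[where P = "\<lambda>D d. d \<in> D"])
    show "\<exists>i. i \<in> D \<and> (\<forall>E\<in>dcosets. i \<in> E \<longrightarrow> E \<in> S)" if "S \<in> ?\<S>" "D \<in> S" "D \<in> dcosets" for S D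
      using that dcosetD(4) by auto
    show "\<exists>k. k \<in> D \<and> (\<forall>E\<in>dcosets. k \<in> E \<longrightarrow> i \<in> E \<and> j \<in> E)"
      if "D \<in> dcosets" "i \<in> D" "j \<in> D" for D i j
      using dcoset_lower[OF that] coset_below dcosetD(1) by metis
    show "openin (subtopology (topology_generated_by ?\<S>) dcosets) {E \<in> dcosets. i \<in> E}" for i
    proof -
      have "{E \<in> dcosets. i \<in> E} = dcosets \<inter> {C \<in> cosets N Z. i \<in> C}"
        using dcosetD(4) by auto
      then show ?thesis
        by (metis (mono_tags, lifting) mem_Collect_eq openin_subtopology_Int2 topology_generated_by_Basis)
    qed
  qed
  then show ?thesis
    by (simp add: directed_coset_groupoid_def restrict_groupoid_def coset_groupoid_def)
qed

lemma openin_GD_basic: "openin (gtop GD) {D \<in> dcosets. a \<in> D}"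
  by (auto simp: openin_GD)

lemma groupoid_GD: "groupoid GD"
  unfolding groupoid_def GD_simps
proof (intro conjI allI ballI impI)
  fix B C D assume *: "(B \<in> dcosets \<and> C \<in> dcosets \<and> src B = rng C) \<and>
    C \<in> dcosets \<and> D \<in> dcosets \<and> src C = rng D"
  then show "src ((B * C)\<up>) = rng D" "src B = rng ((C * D)\<up>)"
    using mult_cancel(3,4) dcosetD(1) by metis+
  show "((B * C)\<up> * D)\<up> = (B * (C * D)\<up>)\<up>"
    using * by (simp add: up_mult round_mult rounds dcosetD(1) mult.assoc)
qed (use dcoset_mult dcoset_star dcosetD(1) star_star mult_cancel rng_star in auto)

lemma topological_groupoid_GD: "topological_groupoid GD"
  unfolding topological_groupoid_def
proof (intro conjI groupoid_GD)
  show "continuous_map (gtop GD) (gtop GD) (ginv GD)"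
  proof (rule continuous_map_atI)
    fix D V assume D: "D \<in> topspace (gtop GD)" "openin (gtop GD) V" "ginv GD D \<in> V"
    then obtain s where s: "s \<in> D\<star>" "\<forall>E\<in>dcosets. s \<in> E \<longrightarrow> E \<in> V"
      by (auto simp: openin_GD GD_simps)
    then obtain a c where a: "a \<in> D" "a \<lhd>\<^bsub>s\<^esub> c"
      by (auto simp: star_def)
    show "\<exists>U. openin (gtop GD) U \<and> D \<in> U \<and> (\<forall>E\<in>U. ginv GD E \<in> V)"
      by (rule exI[of _ "{E \<in> dcosets. a \<in> E}"])
        (use D a s dcoset_star starI openin_GD_basic in \<open>auto simp: GD_simps\<close>)
  qed (simp add: GD_simps dcoset_star)
  show "continuous_map (subtopology (prod_topology (gtop GD) (gtop GD)) {(B, C). gcomp GD B C})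
     (gtop GD) (\<lambda>(B, C). gmult GD B C)"
  proof (rule continuous_map_pairs_atI)
    fix B C V
    assume *: "(B, C) \<in> {(B, C). gcomp GD B C}" "openin (gtop GD) V" "(case (B, C) of (B, C) \<Rightarrow> gmult GD B C) \<in> V"
    then obtain d where d: "d \<in> (B * C)\<up>" "\<forall>E\<in>dcosets. d \<in> E \<longrightarrow> E \<in> V"
      by (auto simp: openin_GD GD_simps)
    then obtain b c where b: "b \<in> B" "c \<in> C" "b * c \<lhd> d"
      by (auto elim!: upE set_times_elim)
    have "(B' * C')\<up> \<in> V"
      if "B' \<in> dcosets" "C' \<in> dcosets" "src B' = rng C'" "b \<in> B'" "c \<in> C'" for B' C'
      using that b(3) d(2) dcoset_mult by (meson set_times_intro upI)
    then show "\<exists>U U'. openin (gtop GD) U \<and> openin (gtop GD) U' \<and> B \<in> U \<and> C \<in> U' \<and>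
        (\<forall>x'\<in>U. \<forall>y'\<in>U'. (x', y') \<in> {(B, C). gcomp GD B C} \<longrightarrow>
          (case (x', y') of (B, C) \<Rightarrow> gmult GD B C) \<in> V)"
      using * b by (intro exI[of _ "{E \<in> dcosets. b \<in> E}"] exI[of _ "{E \<in> dcosets. c \<in> E}"])
        (auto simp: GD_simps openin_GD_basic)
  qed (auto simp: GD_simps dcoset_mult)
qed

text \<open>
  For \<open>a\<close> in \<open>D\<close> and \<open>a'\<close> below it via \<open>s\<close>, the source of \<open>D\<close> contains \<open>s * a'\<close>. Conversely, any
  directed coset containing \<open>s * a'\<close>, an element of \<open>N\<close>, is a unit that can be moved along \<open>a\<close>,
  and hence the source of a directed coset containing \<open>a\<close>.
\<close>

lemma etale_groupoid_GD: "etale_groupoid GD"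
  unfolding etale_groupoid_def open_map_def
proof (intro conjI allI impI topological_groupoid_GD)
  fix W assume W: "openin (gtop GD) W"
  show "openin (gtop GD) (gsrc GD ` W)"
    unfolding openin_GD
  proof (intro conjI ballI)
    show "gsrc GD ` W \<subseteq> dcosets"
      using W by (auto simp: openin_GD GD_simps intro: dcoset_src)
    fix U assume "U \<in> gsrc GD ` W"
    then obtain D where D: "D \<in> W" "U = src D" "D \<in> dcosets"
      using W by (auto simp: openin_GD GD_simps)
    then obtain a where a: "a \<in> D" "\<forall>E\<in>dcosets. a \<in> E \<longrightarrow> E \<in> W"
      using W by (auto simp: openin_GD)
    obtain a' s where a': "a' \<in> D" "a' \<lhd>\<^bsub>s\<^esub> a" "s \<in> D\<star>"
      using coset_belowE[OF dcosetD(1)[OF D(3)] a(1)] by blast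
    note eq = via_rewrite[OF a'(2)] viaD[OF a'(2)]
    have "E \<in> gsrc GD ` W" if E: "E \<in> dcosets" "s * a' \<in> E" for E
    proof -
      have U: "unit_coset E"
        using unit_if_meets_N dcosetD(1) E eq by blast
      have sas: "s * a * (s * a') = s * a'"
        using eq by (simp add: mult.assoc)
      let ?C = "({a} * E)\<up>"
      note C = translate_unit[OF U E(2) eq(8,9,10) sas]
      have "?C \<in> W" "src ?C = E"
        using a(2) C dcosetI dcosetD(3)[OF E(1)] by blast+
      then show ?thesis
        unfolding GD_simps by blast
    qed
    moreover have "s * a' \<in> U"
      using mult_in_src dcosetD(1) D a' by blast
    ultimately show "\<exists>d. d \<in> U \<and> (\<forall>E\<in>dcosets. d \<in> E \<longrightarrow> E \<in> gsrc GD ` W)"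
      by blast
  qed
qed

lemma GD_units: "gunits GD = {U \<in> dcosets. unit_coset U}"
  using dcoset_src unit_src dcosetD(1) unit_cosetD(3)
  by (fastforce simp: gunits_def GD_simps image_iff)

lemma etale_representation_GD:
  assumes "symmetric_subsemigroup Z"
  shows "etale_representation N Z GD (\<lambda>a. {D \<in> dcosets. a \<in> D})"
  unfolding etale_representation_def
proof (intro conjI allI ballI etale_groupoid_GD)
  show "{D \<in> dcosets. a \<in> D} \<in> open_slices GD" for a
  proof -
    have "inj_on (gsrc GD) {D \<in> dcosets. a \<in> D}"
      by (rule inj_onI) (metis (mono_tags, lifting) GD_simps(6) coset_eq_src dcosetD(1) mem_Collect_eq)
    moreover have "inj_on (grng GD) {D \<in> dcosets. a \<in> D}"
      by (rule inj_onI) (metis (mono_tags, lifting) GD_rng coset_eq_rng dcosetD(1) mem_Collect_eq)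
    ultimately show ?thesis
      using openin_GD_basic by (simp add: open_slices_def)
  qed
  show "{D \<in> dcosets. a * b \<in> D} = slice_mult GD {D \<in> dcosets. a \<in> D} {D \<in> dcosets. b \<in> D}" for a b
  proof
    show "{D \<in> dcosets. a * b \<in> D} \<subseteq> slice_mult GD {D \<in> dcosets. a \<in> D} {D \<in> dcosets. b \<in> D}"
      unfolding slice_mult_def GD_simps using split_dcoset[OF assms] by blast
    show "slice_mult GD {D \<in> dcosets. a \<in> D} {D \<in> dcosets. b \<in> D} \<subseteq> {D \<in> dcosets. a * b \<in> D}"
      unfolding slice_mult_def GD_simps using dcoset_mult mult_in_mult dcosetD(1) by fast
  qed
  show "(\<Union>a. {D \<in> dcosets. a \<in> D}) = gset GD"
    using dcosetD(2) by (auto simp: GD_simps)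
  show "openin (subtopology (gtop GD) (gunits GD)) {D \<in> dcosets. n \<in> D}" if "n \<in> N" for n
  proof -
    have "{D \<in> dcosets. n \<in> D} \<subseteq> gunits GD"
      using that unit_if_meets_N dcosetD(1) by (auto simp: GD_units)
    then show ?thesis
      using openin_subtopology_Int2[OF openin_GD_basic, of "gunits GD" n] by (simp add: Int_absorb1)
  qed
  show "\<exists>b. b \<lhd> a \<and> D \<in> {D \<in> dcosets. b \<in> D}" if "D \<in> {D \<in> dcosets. a \<in> D}" for a D
  proof -
    have "D \<in> dcosets" "a \<in> D"
      using that by simp_all
    then obtain b where "b \<in> D" "b \<lhd> a"
      using roundE[OF cosetD(3)[OF dcosetD(1)]] by metis
    then show ?thesis
      using that by auto
  qed
qed

end

section \<open>The directed coset bundle\<close>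

context structured
begin

abbreviation equiv_on ("_ \<approx>\<^bsub>_\<^esub> _" [51, 0, 51] 50) where
  "a \<approx>\<^bsub>C\<^esub> b \<equiv> atlas_equiv N Z C a b"

abbreviation cls where "cls \<equiv> atlas_class N Z"

text \<open>
  The element \<open>w\<close> serves as a local unit: it is supported where \<open>s\<close> is an exact inverse of \<open>c\<close>.
\<close>

lemma central_in_src:
  assumes C: "coset N Z C" and a: "a \<in> C" "a \<lhd>\<^bsub>s\<^esub> c"
  obtains w where "w \<in> Z" "w \<in> src C" "w * (s * c) = w"
proof -
  obtain b t where b: "b \<in> C" "b \<lhd>\<^bsub>t\<^esub> a" "t \<in> C\<star>"
    using coset_belowE[OF C a(1)] by blast
  then show thesis
    using that[of "t * a"] mult_in_src[OF C b(3) a(1)] viaD[OF b(2)] via_rewrite[OF a(2)]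
    by (simp add: mult.assoc)
qed

lemma central_in_rng:
  assumes C: "coset N Z C" and a: "a \<in> C" "a \<lhd>\<^bsub>s\<^esub> c"
  obtains z where "z \<in> Z" "z \<in> rng C" "c * s * z = z"
proof -
  obtain b t where b: "b \<in> C" "b \<lhd>\<^bsub>t\<^esub> a" "t \<in> C\<star>"
    using coset_belowE[OF C a(1)] by blast
  then show thesis
    using that[of "a * t"] mult_in_rng[OF C b(3) a(1)] viaD[OF b(2)] via_rewrite[OF a(2)]
    by (simp add: mult.assoc)
qed

lemma central_exists:
  assumes "coset N Z C" "c \<in> C"
  obtains z w where "z \<in> Z" "z \<in> rng C" "w \<in> Z" "w \<in> src C"
  using assms coset_belowE central_in_src central_in_rng by metis

text \<open>
  The multipliers in the definition of the equivalence come from \<open>C\<star>\<close>. Multiplying with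
  the elements that they invert makes them central. Conversely, central elements of the range and the
  source can be absorbed into elements of \<open>C\<star>\<close>.
\<close>

lemma equivI:
  assumes C: "coset N Z C" "c \<in> C"
    and z: "z \<in> Z" "z \<in> rng C" "w \<in> Z" "w \<in> src C" "z * a * w = z * b * w"
  shows "a \<approx>\<^bsub>C\<^esub> b"
proof -
  obtain s where s: "s \<in> C\<star>"
    using coset_belowE C by metis
  have "s * z \<in> C\<star>"
    using mult_src[OF coset_star[OF C(1)] s] src_star[OF C(1)] z by simp
  moreover have "w * s \<in> C\<star>"
    using rng_mult[OF coset_star[OF C(1)] s] rng_star[OF C(1)] z by simp
  moreover have "s * z * a * (w * s) = s * z * b * (w * s)"
    using z(5) by (metis mult.assoc)
  ultimately show ?thesis
    unfolding atlas_equiv_def by blast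
qed

lemma equivE:
  assumes C: "coset N Z C" and "a \<approx>\<^bsub>C\<^esub> b"
  obtains z w where "z \<in> Z" "z \<in> rng C" "w \<in> Z" "w \<in> src C" "z * a * w = z * b * w"
proof -
  obtain s t where st: "s \<in> C\<star>" "t \<in> C\<star>" "s * a * t = s * b * t"
    using assms unfolding atlas_equiv_def by blast
  obtain x c where x: "c \<in> C" "x \<lhd>\<^bsub>s\<^esub> c"
    using starE[OF C st(1)] by metis
  obtain y d where y: "d \<in> C" "y \<lhd>\<^bsub>t\<^esub> d"
    using starE[OF C st(2)] by metis
  have "c * s * a * (t * d) = c * (s * a * t) * d"
    by (simp add: mult.assoc)
  also have "\<dots> = c * s * b * (t * d)"
    unfolding st(3) by (simp add: mult.assoc)
  finally show thesis
    using that viaD(5)[OF x(2)] viaD(6)[OF y(2)] mult_in_rng[OF C st(1) x(1)]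
      mult_in_src[OF C st(2) y(1)] by blast
qed

lemma equiv_refl: "coset N Z C \<Longrightarrow> c \<in> C \<Longrightarrow> a \<approx>\<^bsub>C\<^esub> a"
  by (metis central_exists equivI)

lemma equiv_sym: "a \<approx>\<^bsub>C\<^esub> b \<Longrightarrow> b \<approx>\<^bsub>C\<^esub> a"
  unfolding atlas_equiv_def by metis

lemma equiv_trans:
  assumes C: "coset N Z C" "d \<in> C" and ab: "a \<approx>\<^bsub>C\<^esub> b" "b \<approx>\<^bsub>C\<^esub> c"
  shows "a \<approx>\<^bsub>C\<^esub> c"
proof -
  obtain z w where z: "z \<in> Z" "z \<in> rng C" "w \<in> Z" "w \<in> src C" "z * a * w = z * b * w"
    using equivE[OF C(1) ab(1)] by blast
  obtain x y where x: "x \<in> Z" "x \<in> rng C" "y \<in> Z" "y \<in> src C" "x * b * y = x * c * y"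
    using equivE[OF C(1) ab(2)] by blast
  have comm: "x * z = z * x" "w * y = y * w"
    using Z_central Z_N z x by blast+
  have "x * z * a * (w * y) = x * (z * a * w) * y"
    by (simp add: mult.assoc)
  also have "\<dots> = (x * z) * b * (w * y)"
    unfolding z(5) by (simp add: mult.assoc)
  also have "\<dots> = z * (x * b * y) * w"
    unfolding comm by (simp add: mult.assoc)
  also have "\<dots> = x * z * c * (w * y)"
    unfolding x(5) comm by (simp add: mult.assoc)
  finally have "x * z * a * (w * y) = x * z * c * (w * y)" .
  then show ?thesis
    using equivI[OF C Z_mult[OF x(1) z(1)] _ Z_mult[OF z(3) x(3)]] z(2,4) x(2,4)
      unit_cosetD(5)[OF unit_src[OF C(1)]] unit_cosetD(5)[OF unit_rng[OF C(1)]] by blast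
qed

text \<open>
  The multiplier \<open>w\<close> stands between \<open>b\<close> and \<open>c\<close>. Conjugation by \<open>c\<close> moves it to the right, where
  it becomes the central element \<open>u * w * c\<close> of the source of \<open>C\<close>.
\<close>

lemma equiv_mult_right:
  assumes B: "coset N Z B" and C: "coset N Z C" and BC: "src B = rng C"
    and b: "b \<approx>\<^bsub>B\<^esub> b'" "b \<in> B" and c: "c \<in> C"
  shows "b * c \<approx>\<^bsub>(B * C)\<up>\<^esub> b' * c"
proof -
  note cancel = mult_cancel[OF B C BC]
  obtain z w where z: "z \<in> Z" "z \<in> rng B" "w \<in> Z" "w \<in> src B" "z * b * w = z * b' * w"
    using equivE[OF B b(1)] by blast
  obtain x u where u: "x \<in> C" "x \<lhd>\<^bsub>u\<^esub> c" "u \<in> C\<star>"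
    using coset_belowE[OF C c] by blast
  let ?r = "u * w * c"
  have "u * (w * c) \<in> src C"
    using mult_in_src[OF C u(3)] rng_mult[OF C c] z BC by simp
  then have r: "?r \<in> Z" "?r \<in> src C"
    using Z_conj viaD[OF u(2)] z by (simp_all add: mult.assoc)
  have comm: "c * u * w = w * (c * u)"
    using Z_central[OF z(3) Z_N] viaD(5)[OF u(2)] by simp
  have move: "z * (y * c) * ?r = (z * y * w) * (c * u * c)" for y
  proof -
    have "z * (y * c) * ?r = z * y * (c * u * w) * c"
      by (simp add: mult.assoc)
    then show ?thesis
      unfolding comm by (simp add: mult.assoc)
  qed
  show ?thesis
    by (rule equivI[OF coset_mult[OF B C BC] mult_in_mult[OF B C b(2) c] z(1) _ r(1)])
       (use z r cancel move in simp_all)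
qed

lemma equiv_mult_left:
  assumes B: "coset N Z B" and C: "coset N Z C" and BC: "src B = rng C"
    and b: "b \<in> B" and c: "c \<approx>\<^bsub>C\<^esub> c'" "c \<in> C"
  shows "b * c \<approx>\<^bsub>(B * C)\<up>\<^esub> b * c'"
proof -
  note cancel = mult_cancel[OF B C BC]
  obtain z w where z: "z \<in> Z" "z \<in> rng C" "w \<in> Z" "w \<in> src C" "z * c * w = z * c' * w"
    using equivE[OF C c(1)] by blast
  obtain x u where u: "x \<in> B" "x \<lhd>\<^bsub>u\<^esub> b" "u \<in> B\<star>"
    using coset_belowE[OF B b] by blast
  let ?r = "b * z * u"
  have r: "?r \<in> Z" "?r \<in> rng B"
    using Z_conj viaD[OF u(2)] z mult_in_rng[OF B u(3)] mult_src[OF B b] BC by simp_all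
  have comm: "z * (u * b) = u * b * z"
    using Z_central[OF z(1) Z_N] viaD(6)[OF u(2)] by simp
  have move: "?r * (b * y) * w = (b * u * b) * (z * y * w)" for y
  proof -
    have "?r * (b * y) * w = b * (z * (u * b)) * y * w"
      by (simp add: mult.assoc)
    then show ?thesis
      unfolding comm by (simp add: mult.assoc)
  qed
  show ?thesis
    by (rule equivI[OF coset_mult[OF B C BC] mult_in_mult[OF B C b c(2)] r(1) _ z(3)])
       (use z r cancel move in simp_all)
qed

lemma equiv_mult:
  assumes B: "coset N Z B" and C: "coset N Z C" and BC: "src B = rng C"
    and b: "b \<approx>\<^bsub>B\<^esub> b'" "b \<in> B" "b' \<in> B" and c: "c \<approx>\<^bsub>C\<^esub> c'" "c \<in> C"
  shows "b * c \<approx>\<^bsub>(B * C)\<up>\<^esub> b' * c'"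
  using equiv_trans[OF coset_mult[OF B C BC] mult_in_mult[OF B C b(2) c(2)]]
    equiv_mult_right[OF B C BC b(1,2) c(2)] equiv_mult_left[OF B C BC b(3) c] by blast

lemma equiv_absorb_left:
  assumes C: "coset N Z C" and a: "a \<in> C" "a \<lhd>\<^bsub>s\<^esub> c"
    and D: "coset N Z D" "d \<in> D" "rng D = src C"
  shows "s * c * d \<approx>\<^bsub>D\<^esub> d"
proof -
  obtain w where w: "w \<in> Z" "w \<in> src C" "w * (s * c) = w"
    using central_in_src[OF C a] by blast
  obtain y where y: "y \<in> Z" "y \<in> src D"
    using central_exists[OF D(1,2)] by blast
  have "w * (s * c * d) * y = (w * (s * c)) * d * y"
    by (simp add: mult.assoc)
  then show ?thesis
    using equivI[OF D(1,2) w(1) _ y] w D(3) by metis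
qed

lemma equiv_absorb_right:
  assumes C: "coset N Z C" and a: "a \<in> C" "a \<lhd>\<^bsub>s\<^esub> c"
    and D: "coset N Z D" "d \<in> D" "src D = rng C"
  shows "d * (c * s) \<approx>\<^bsub>D\<^esub> d"
proof -
  obtain z where z: "z \<in> Z" "z \<in> rng C" "c * s * z = z"
    using central_in_rng[OF C a] by blast
  obtain y where y: "y \<in> Z" "y \<in> rng D"
    using central_exists[OF D(1,2)] by blast
  have "y * (d * (c * s)) * z = y * d * (c * s * z)"
    by (simp add: mult.assoc)
  then show ?thesis
    using equivI[OF D(1,2) y z(1)] z D(3) by metis
qed

text \<open>
  The usual argument for uniqueness of inverses: \<open>s\<close> is equivalent to \<open>s * c' * s'\<close>, then to
  \<open>s * c * s'\<close>, then to \<open>s'\<close>.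
\<close>

lemma equiv_inverse:
  assumes C: "coset N Z C" and c: "c \<in> C" "c' \<in> C" "c \<approx>\<^bsub>C\<^esub> c'"
    and a: "a \<in> C" "a \<lhd>\<^bsub>s\<^esub> c" "a' \<in> C" "a' \<lhd>\<^bsub>s'\<^esub> c'"
  shows "s \<approx>\<^bsub>C\<star>\<^esub> s'"
proof -
  note C' = coset_star[OF C] and V = unit_cosetD[OF unit_src[OF C]]
  have s: "s \<in> C\<star>" "s' \<in> C\<star>"
    using a starI by blast+
  have r: "src (C\<star>) = rng C" "rng (C\<star>) = src C"
    using src_star rng_star C by auto
  have "s * (c' * s') \<approx>\<^bsub>C\<star>\<^esub> s"
    by (rule equiv_absorb_right[OF C a(3,4) C' s(1) r(1)])
  then have 1: "s \<approx>\<^bsub>C\<star>\<^esub> s * c' * s'"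
    using equiv_sym by (simp add: mult.assoc)
  have "s * c \<approx>\<^bsub>src C\<^esub> s * c'"
    using equiv_mult_left[OF C' C r(1) s(1) c(3,1)] by (simp add: source_def)
  then have "s * c * s' \<approx>\<^bsub>(src C * C\<star>)\<up>\<^esub> s * c' * s'"
    using equiv_mult_right[OF V(1) C' _ _ _ s(2)] mult_in_src[OF C s(1) c(1)] V(3) r(2) by simp
  moreover have "(src C * C\<star>)\<up> = C\<star>"
    using rng_cancel[OF C' cosetD(3)[OF V(1)]] cosetD(2)[OF V(1)] r(2) by simp
  ultimately have 2: "s * c' * s' \<approx>\<^bsub>C\<star>\<^esub> s * c * s'"
    using equiv_sym by simp
  have 3: "s * c * s' \<approx>\<^bsub>C\<star>\<^esub> s'"
    by (rule equiv_absorb_left[OF C a(1,2) C' s(2) r(2)])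
  show ?thesis
    using equiv_trans[OF C' s(1)] 1 2 3 by blast
qed

lemma cls_eq_iff:
  assumes C: "coset N Z C" "c \<in> C" and D: "coset N Z D" "d \<in> D"
  shows "cls c C = cls d D \<longleftrightarrow> C = D \<and> c \<approx>\<^bsub>C\<^esub> d"
  unfolding atlas_class_def prod.inject cosetD(2)[OF C(1)] cosetD(2)[OF D(1)]
  using equiv_refl[OF C] equiv_refl[OF D, of d] equiv_trans[OF C] equiv_sym assms by blast

lemma cls_up:
  assumes "round A"
  shows "cls a (A\<up>) = cls a A"
  using assms by (simp add: atlas_class_def atlas_equiv_def up_up star_up)

lemma snd_cls: "coset N Z C \<Longrightarrow> snd (cls c C) = C"
  by (simp add: atlas_class_def cosetD(2))

abbreviation FD where "FD \<equiv> directed_coset_bundle N Z"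

definition dclasses where
  "dclasses = {cls c D |c D. c \<in> D \<and> D \<in> dcosets}"

lemma dclassesI: "D \<in> dcosets \<Longrightarrow> c \<in> D \<Longrightarrow> cls c D \<in> dclasses"
  by (auto simp: dclasses_def)

lemma dclassesE:
  assumes "p \<in> dclasses"
  obtains c D where "p = cls c D" "c \<in> D" "D \<in> dcosets"
  using assms by (auto simp: dclasses_def)

lemma snd_dcls: "D \<in> dcosets \<Longrightarrow> snd (cls c D) = D"
  by (simp add: snd_cls dcosetD(1))

lemma cls_eq: "D \<in> dcosets \<Longrightarrow> c \<in> D \<Longrightarrow> d \<in> D \<Longrightarrow> cls c D = cls d D \<longleftrightarrow> c \<approx>\<^bsub>D\<^esub> d"
  using cls_eq_iff dcosetD(1) by blast

lemma dclasses_eq: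
  "{p \<in> coset_bundle_set N Z. coset_proj p \<in> dcosets} = dclasses"
proof -
  have "p \<in> dclasses" if p: "p \<in> coset_bundle_set N Z" "coset_proj p \<in> dcosets" for p
  proof -
    obtain c C where c: "p = cls c C" "c \<in> C" "C \<in> cosets N Z"
      using p(1) by (auto simp: coset_bundle_set_def)
    then have "snd p = C"
      by (simp add: cosets_def snd_cls)
    then show ?thesis
      using p(2) c dclassesI by (simp add: coset_proj_def)
  qed
  moreover have "p \<in> coset_bundle_set N Z" "coset_proj p \<in> dcosets" if p: "p \<in> dclasses" for p
  proof -
    obtain c D where "p = cls c D" "c \<in> D" "D \<in> dcosets"
      using p by (auto simp: dclasses_def)
    then show "p \<in> coset_bundle_set N Z" "coset_proj p \<in> dcosets"
      using dcosetD(4) unfolding coset_bundle_set_def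
      by (blast, simp add: coset_proj_def snd_dcls)
  qed
  ultimately show ?thesis
    by blast
qed

text \<open>
  The sets of points \<open>p\<close> with \<open>in_nbhd p (c, d)\<close> will be seen to form a basis. The first index is a
  representative of the class of \<open>p\<close>, the second one restricts the base point.
\<close>

definition in_nbhd where
  "in_nbhd p i \<longleftrightarrow> (\<exists>D\<in>dcosets. fst i \<in> D \<and> snd i \<in> D \<and> p = cls (fst i) D)"

lemma star_open:
  assumes "D \<in> dcosets" "s \<in> D\<star>"
  obtains d where "d \<in> D" "\<And>E. E \<in> dcosets \<Longrightarrow> d \<in> E \<Longrightarrow> s \<in> E\<star>"
  using assms(2) starI unfolding star_def by blast

lemma dcoset_lower_list:
  assumes D: "D \<in> dcosets" and "set as \<subseteq> D"
  obtains d where "d \<in> D" "\<forall>E\<in>dcosets. d \<in> E \<longrightarrow> set as \<subseteq> E"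
proof -
  have "\<exists>d\<in>D. \<forall>E\<in>dcosets. d \<in> E \<longrightarrow> set as \<subseteq> E"
    using assms(2)
  proof (induction as)
    case Nil
    then show ?case
      using dcosetD(2)[OF D] by auto
  next
    case (Cons a as)
    then obtain d where d: "d \<in> D" "\<forall>E\<in>dcosets. d \<in> E \<longrightarrow> set as \<subseteq> E"
      by auto
    obtain e where "e \<in> D" "e \<lhd> a" "e \<lhd> d"
      using dcoset_lower[OF D _ d(1)] Cons.prems by (metis list.set_intros(1) subsetD)
    then show ?case
      using d(2) coset_below dcosetD(1) by (metis insert_subset list.simps(15))
  qed
  then show thesis
    using that by blast
qed

text \<open>
  An equivalence at \<open>D\<close> persists at all directed cosets close to \<open>D\<close>, because the multipliers
  \<open>s\<close> and \<open>t\<close> stay available there. Therefore every section \<open>[c, _]\<close> of the bundle is continuous.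
\<close>

lemma equiv_open:
  assumes D: "D \<in> dcosets" and c: "c \<in> D" "c' \<in> D" "c \<approx>\<^bsub>D\<^esub> c'"
  obtains d where "d \<in> D" "\<And>E. E \<in> dcosets \<Longrightarrow> d \<in> E \<Longrightarrow> c \<in> E \<and> c' \<in> E \<and> c \<approx>\<^bsub>E\<^esub> c'"
proof -
  obtain s t where st: "s \<in> D\<star>" "t \<in> D\<star>" "s * c * t = s * c' * t"
    using c(3) unfolding atlas_equiv_def by blast
  obtain x where x: "x \<in> D" "\<And>E. E \<in> dcosets \<Longrightarrow> x \<in> E \<Longrightarrow> s \<in> E\<star>"
    using star_open[OF D st(1)] by blast
  obtain y where y: "y \<in> D" "\<And>E. E \<in> dcosets \<Longrightarrow> y \<in> E \<Longrightarrow> t \<in> E\<star>"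
    using star_open[OF D st(2)] by blast
  obtain d where d: "d \<in> D" "\<forall>E\<in>dcosets. d \<in> E \<longrightarrow> set [x, y, c, c'] \<subseteq> E"
    using dcoset_lower_list[OF D, of "[x, y, c, c']"] x y c by auto
  show thesis
  proof (rule that[OF d(1)])
    fix E assume E: "E \<in> dcosets" "d \<in> E"
    then have "s \<in> E\<star>" "t \<in> E\<star>" "c \<in> E" "c' \<in> E"
      using x(2) y(2) d(2) by auto
    then show "c \<in> E \<and> c' \<in> E \<and> c \<approx>\<^bsub>E\<^esub> c'"
      using st(3) unfolding atlas_equiv_def by blast
  qed
qed

lemma openin_FD:
  "openin (gtop FD) W \<longleftrightarrow> W \<subseteq> dclasses \<and>
    (\<forall>D\<in>dcosets. \<forall>c\<in>D. cls c D \<in> W \<longrightarrow>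
      (\<exists>d\<in>D. \<forall>E\<in>dcosets. d \<in> E \<longrightarrow> c \<in> E \<and> cls c E \<in> W))" (is "_ \<longleftrightarrow> ?rhs")
proof -
  let ?\<S> = "{{cls s C | C. s \<in> C \<and> C \<in> cosets N Z} | s. True} \<union>
         {{p \<in> coset_bundle_set N Z. coset_proj p \<in> cosets N Z \<and> s \<in> coset_proj p} | s. True}"
  let ?T = "topology_generated_by ?\<S>"
  have gen: "openin (subtopology ?T dclasses) W \<longleftrightarrow>
    W \<subseteq> dclasses \<and> (\<forall>p\<in>W. \<exists>i. in_nbhd p i \<and> (\<forall>q\<in>dclasses. in_nbhd q i \<longrightarrow> q \<in> W))"
  proof (rule openin_restricted_generated)
    show "\<exists>i. in_nbhd p i \<and> (\<forall>q\<in>dclasses. in_nbhd q i \<longrightarrow> q \<in> S)"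
      if S: "S \<in> ?\<S>" "p \<in> S" "p \<in> dclasses" for S p
    proof -
      obtain c D where p: "p = cls c D" "c \<in> D" "D \<in> dcosets"
        using dclassesE[OF S(3)] by blast
      consider s where "S = {cls s C | C. s \<in> C \<and> C \<in> cosets N Z}"
        | s where "S = {p \<in> coset_bundle_set N Z. coset_proj p \<in> cosets N Z \<and> s \<in> coset_proj p}"
        using S(1) by blast
      then show ?thesis
      proof cases
        case (1 s)
        then obtain C where C: "p = cls s C" "s \<in> C" "C \<in> cosets N Z"
          using S(2) by blast
        have "C = D"
          using p(1) C(1,3) snd_dcls[OF p(3)] snd_cls[of C] by (metis (mono_tags) cosets_def mem_Collect_eq)
        then have "in_nbhd p (s, s)"
          using C p(3) by (auto simp: in_nbhd_def)
        moreover have "q \<in> S" if "in_nbhd q (s, s)" for q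
          using that dcosetD(4) by (auto simp: in_nbhd_def 1)
        ultimately show ?thesis
          by blast
      next
        case (2 s)
        then have "s \<in> D"
          using S(2) p snd_dcls by (simp add: coset_proj_def)
        then have "in_nbhd p (c, s)"
          using p by (auto simp: in_nbhd_def)
        moreover have "q \<in> S" if "in_nbhd q (c, s)" for q
          using that dcosetD(4) snd_dcls
          by (auto simp: in_nbhd_def 2 coset_proj_def coset_bundle_set_def)
        ultimately show ?thesis
          by blast
      qed
    qed
    show "\<exists>k. in_nbhd p k \<and> (\<forall>q\<in>dclasses. in_nbhd q k \<longrightarrow> in_nbhd q i \<and> in_nbhd q j)"
      if ij: "p \<in> dclasses" "in_nbhd p i" "in_nbhd p j" for p i j
    proof -
      obtain D where D: "D \<in> dcosets" "fst i \<in> D" "snd i \<in> D" "p = cls (fst i) D"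
        using ij(2) by (auto simp: in_nbhd_def)
      obtain D' where D': "D' \<in> dcosets" "fst j \<in> D'" "snd j \<in> D'" "p = cls (fst j) D'"
        using ij(3) by (auto simp: in_nbhd_def)
      have "D' = D"
        using D D' snd_dcls by metis
      note D' = D'[unfolded this]
      have "fst i \<approx>\<^bsub>D\<^esub> fst j"
        using D D' cls_eq by metis
      then obtain d where d: "d \<in> D"
        "\<And>E. E \<in> dcosets \<Longrightarrow> d \<in> E \<Longrightarrow> fst i \<in> E \<and> fst j \<in> E \<and> fst i \<approx>\<^bsub>E\<^esub> fst j"
        using equiv_open[OF D(1,2) D'(2)] by blast
      obtain e where e: "e \<in> D" "\<forall>E\<in>dcosets. e \<in> E \<longrightarrow> set [d, snd i, snd j] \<subseteq> E"
        using dcoset_lower_list[OF D(1), of "[d, snd i, snd j]"] d(1) D(3) D'(3) by auto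
      have "in_nbhd p (fst i, e)"
        using D e(1) by (auto simp: in_nbhd_def)
      moreover have "in_nbhd q i \<and> in_nbhd q j" if "in_nbhd q (fst i, e)" for q
      proof -
        obtain E where E: "E \<in> dcosets" "e \<in> E" "q = cls (fst i) E"
          using \<open>in_nbhd q (fst i, e)\<close> by (auto simp: in_nbhd_def)
        then have "d \<in> E" "snd i \<in> E" "snd j \<in> E"
          using e(2) by auto
        moreover have "cls (fst i) E = cls (fst j) E"
          using d(2)[OF E(1) \<open>d \<in> E\<close>] cls_eq[OF E(1)] by simp
        ultimately show ?thesis
          using E d(2)[OF E(1)] unfolding in_nbhd_def by metis
      qed
      ultimately show ?thesis
        by blast
    qed
    show "openin (subtopology ?T dclasses) {q \<in> dclasses. in_nbhd q i}" for i
    proof -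
      let ?A = "{cls (fst i) C | C. fst i \<in> C \<and> C \<in> cosets N Z}"
      let ?B = "{p \<in> coset_bundle_set N Z. coset_proj p \<in> cosets N Z \<and> snd i \<in> coset_proj p}"
      have "{q \<in> dclasses. in_nbhd q i} = dclasses \<inter> (?A \<inter> ?B)"
      proof (intro equalityI subsetI)
        fix q assume "q \<in> dclasses \<inter> (?A \<inter> ?B)"
        then obtain C where C: "q = cls (fst i) C" "fst i \<in> C" "C \<in> cosets N Z" "q \<in> ?B"
          "q \<in> dclasses"
          by blast
        have "snd q = C"
          using C(1,3) snd_cls by (simp add: cosets_def)
        moreover have "snd q \<in> dcosets"
          using C(5) dclasses_eq by (auto simp: coset_proj_def)
        ultimately show "q \<in> {q \<in> dclasses. in_nbhd q i}"
          using C by (auto simp: in_nbhd_def coset_proj_def)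
      next
        fix q assume "q \<in> {q \<in> dclasses. in_nbhd q i}"
        then obtain D where D: "D \<in> dcosets" "fst i \<in> D" "snd i \<in> D" "q = cls (fst i) D"
          "q \<in> dclasses"
          by (auto simp: in_nbhd_def)
        then show "q \<in> dclasses \<inter> (?A \<inter> ?B)"
          using dcosetD(4) snd_dcls by (auto simp: coset_proj_def coset_bundle_set_def)
      qed
      moreover have "openin ?T ?A" "openin ?T ?B"
        by (rule topology_generated_by_Basis; blast)+
      ultimately show ?thesis
        by (simp add: openin_subtopology_Int2 openin_Int)
    qed
  qed
  have top: "gtop FD = subtopology ?T dclasses"
    by (simp add: directed_coset_bundle_def restrict_groupoid_def coset_bundle_def dclasses_eq)
  have local: "(\<forall>p\<in>W. \<exists>i. in_nbhd p i \<and> (\<forall>q\<in>dclasses. in_nbhd q i \<longrightarrow> q \<in> W)) \<longleftrightarrow>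
    (\<forall>D\<in>dcosets. \<forall>c\<in>D. cls c D \<in> W \<longrightarrow>
      (\<exists>d\<in>D. \<forall>E\<in>dcosets. d \<in> E \<longrightarrow> c \<in> E \<and> cls c E \<in> W))" (is "?l \<longleftrightarrow> ?r")
    if W: "W \<subseteq> dclasses"
  proof
    assume l: ?l
    show ?r
    proof (intro ballI impI)
      fix D c assume D: "D \<in> dcosets" "c \<in> D" "cls c D \<in> W"
      obtain i where i: "in_nbhd (cls c D) i" "\<forall>q\<in>dclasses. in_nbhd q i \<longrightarrow> q \<in> W"
        using l D by blast
      then obtain D' where D': "D' \<in> dcosets" "fst i \<in> D'" "snd i \<in> D'" "cls c D = cls (fst i) D'"
        by (auto simp: in_nbhd_def)
      have "D' = D"
        using D D' snd_dcls by metis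
      note D' = D'[unfolded this]
      obtain d where d: "d \<in> D"
        "\<And>E. E \<in> dcosets \<Longrightarrow> d \<in> E \<Longrightarrow> c \<in> E \<and> fst i \<in> E \<and> c \<approx>\<^bsub>E\<^esub> fst i"
        using equiv_open[OF D(1,2) D'(2)] cls_eq[OF D(1,2) D'(2)] D'(4) by blast
      obtain e where e: "e \<in> D" "\<forall>E\<in>dcosets. e \<in> E \<longrightarrow> set [d, snd i] \<subseteq> E"
        using dcoset_lower_list[OF D(1), of "[d, snd i]"] d(1) D'(3) by auto
      have "c \<in> E \<and> cls c E \<in> W" if E: "E \<in> dcosets" "e \<in> E" for E
      proof -
        have E': "d \<in> E" "snd i \<in> E"
          using e(2) E by auto
        then have "c \<in> E" "fst i \<in> E" "cls c E = cls (fst i) E"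
          using d(2)[OF E(1)] cls_eq[OF E(1)] by simp_all
        then show ?thesis
          using i(2) E' E(1) dclassesI unfolding in_nbhd_def by metis
      qed
      then show "\<exists>d\<in>D. \<forall>E\<in>dcosets. d \<in> E \<longrightarrow> c \<in> E \<and> cls c E \<in> W"
        using e(1) by blast
    qed
  next
    assume r: ?r
    show ?l
    proof
      fix p assume p: "p \<in> W"
      then obtain c D where c: "p = cls c D" "c \<in> D" "D \<in> dcosets"
        using W dclassesE by blast
      then obtain d where d: "d \<in> D" "\<forall>E\<in>dcosets. d \<in> E \<longrightarrow> c \<in> E \<and> cls c E \<in> W"
        using r p by blast
      then have "in_nbhd p (c, d)" "\<forall>q\<in>dclasses. in_nbhd q (c, d) \<longrightarrow> q \<in> W"
        using c by (auto simp: in_nbhd_def)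
      then show "\<exists>i. in_nbhd p i \<and> (\<forall>q\<in>dclasses. in_nbhd q i \<longrightarrow> q \<in> W)"
        by blast
    qed
  qed
  show ?thesis
    unfolding top gen by (rule conj_cong[OF refl local])
qed


lemma FD_simps:
  "gset FD = dclasses" "topspace (gtop FD) = dclasses"
  "gcomp FD p q \<longleftrightarrow> p \<in> dclasses \<and> q \<in> dclasses \<and> src (snd p) = rng (snd q)"
proof -
  have "gtop FD = subtopology (gtop (coset_bundle N Z)) dclasses"
    by (simp add: directed_coset_bundle_def restrict_groupoid_def dclasses_eq)
  moreover have "openin (gtop FD) dclasses"
    unfolding openin_FD using dclassesI by blast
  ultimately show *: "topspace (gtop FD) = dclasses"
    by (metis inf.cobounded2 openin_subset subset_antisym topspace_subtopology)
  then show "gset FD = dclasses"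
    by (simp add: gset_def)
  have "x \<in> dclasses \<longleftrightarrow> x \<in> coset_bundle_set N Z \<and> coset_proj x \<in> dcosets" for x
    unfolding dclasses_eq[symmetric] by blast
  then show "gcomp FD p q \<longleftrightarrow> p \<in> dclasses \<and> q \<in> dclasses \<and> src (snd p) = rng (snd q)"
    unfolding directed_coset_bundle_def restrict_groupoid_def coset_bundle_def
    by (simp add: coset_proj_def; blast)
qed

lemma FD_comp: "B \<in> dcosets \<Longrightarrow> C \<in> dcosets \<Longrightarrow> b \<in> B \<Longrightarrow> c \<in> C \<Longrightarrow>
    gcomp FD (cls b B) (cls c C) \<longleftrightarrow> src B = rng C"
  by (simp add: FD_simps snd_dcls dclassesI)

lemma FD_mult:
  assumes B: "B \<in> dcosets" "b \<in> B" and C: "C \<in> dcosets" "c \<in> C" and BC: "src B = rng C"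
  shows "gmult FD (cls b B) (cls c C) = cls (b * c) ((B * C)\<up>)"
proof -
  have r: "round (B * C)"
    using B C round_mult rounds(1) dcosetD(1) by blast
  have "gmult FD (cls b B) (cls c C) = (THE x. \<exists>b' B' c' C'. b' \<in> B' \<and> B' \<in> cosets N Z \<and>
      c' \<in> C' \<and> C' \<in> cosets N Z \<and> cls b B = cls b' B' \<and> cls c C = cls c' C' \<and>
      x = cls (b' * c') (B' * C'))"
    by (simp add: directed_coset_bundle_def restrict_groupoid_def coset_bundle_def)
  also have "\<dots> = cls (b * c) (B * C)"
  proof (rule the_equality)
    show "\<exists>b' B' c' C'. b' \<in> B' \<and> B' \<in> cosets N Z \<and> c' \<in> C' \<and> C' \<in> cosets N Z \<and>
      cls b B = cls b' B' \<and> cls c C = cls c' C' \<and> cls (b * c) (B * C) = cls (b' * c') (B' * C')"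
      using assms dcosetD(4) by blast
    fix x assume "\<exists>b' B' c' C'. b' \<in> B' \<and> B' \<in> cosets N Z \<and> c' \<in> C' \<and> C' \<in> cosets N Z \<and>
      cls b B = cls b' B' \<and> cls c C = cls c' C' \<and> x = cls (b' * c') (B' * C')"
    then obtain b' B' c' C' where *: "b' \<in> B'" "B' \<in> cosets N Z" "c' \<in> C'" "C' \<in> cosets N Z"
      "cls b B = cls b' B'" "cls c C = cls c' C'" "x = cls (b' * c') (B' * C')"
      by blast
    have **: "B' = B" "C' = C" "b \<approx>\<^bsub>B\<^esub> b'" "c \<approx>\<^bsub>C\<^esub> c'"
      using * B C cls_eq_iff dcosetD(1) unfolding cosets_def mem_Collect_eq by metis+
    then have "b * c \<approx>\<^bsub>(B * C)\<up>\<^esub> b' * c'"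
      using equiv_mult[OF dcosetD(1)[OF B(1)] dcosetD(1)[OF C(1)] BC] * B C by blast
    moreover have "b * c \<in> (B * C)\<up>" "b' * c' \<in> (B * C)\<up>"
      using mult_in_mult[OF dcosetD(1)[OF B(1)] dcosetD(1)[OF C(1)]] * ** B C by blast+
    ultimately have "cls (b * c) ((B * C)\<up>) = cls (b' * c') ((B * C)\<up>)"
      using cls_eq[OF dcoset_mult[OF B(1) C(1) BC]] by blast
    then show "x = cls (b * c) (B * C)"
      using * ** cls_up[OF r] by simp
  qed
  finally show ?thesis
    using cls_up[OF r] by simp
qed

lemma FD_inv:
  assumes C: "C \<in> dcosets" and a: "a \<in> C" "a \<lhd>\<^bsub>s\<^esub> c"
  shows "ginv FD (cls c C) = cls s (C\<star>)"
proof -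
  have C': "coset N Z C"
    using C dcosetD(1) by blast
  have c: "c \<in> C" "s \<in> C\<star>"
    using a coset_below C' belowI starI by blast+
  have "ginv FD (cls c C) = (THE x. \<exists>c' C' a s. c' \<in> C' \<and> C' \<in> cosets N Z \<and> a \<in> C' \<and>
      a \<lhd>\<^bsub>s\<^esub> c' \<and> cls c C = cls c' C' \<and> x = cls s (C'\<star>))"
    by (simp add: directed_coset_bundle_def restrict_groupoid_def coset_bundle_def)
  also have "\<dots> = cls s (C\<star>)"
  proof (rule the_equality)
    show "\<exists>c' C' a s'. c' \<in> C' \<and> C' \<in> cosets N Z \<and> a \<in> C' \<and>
      a \<lhd>\<^bsub>s'\<^esub> c' \<and> cls c C = cls c' C' \<and> cls s (C\<star>) = cls s' (C'\<star>)"
      using a c dcosetD(4)[OF C] by blast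
    fix x assume "\<exists>c' C' a s. c' \<in> C' \<and> C' \<in> cosets N Z \<and> a \<in> C' \<and>
      a \<lhd>\<^bsub>s\<^esub> c' \<and> cls c C = cls c' C' \<and> x = cls s (C'\<star>)"
    then obtain c' C' a' s' where *: "c' \<in> C'" "C' \<in> cosets N Z" "a' \<in> C'" "a' \<lhd>\<^bsub>s'\<^esub> c'"
      "cls c C = cls c' C'" "x = cls s' (C'\<star>)"
      by blast
    have **: "C' = C" "c \<approx>\<^bsub>C\<^esub> c'"
      using * c cls_eq_iff[OF C'] unfolding cosets_def mem_Collect_eq by metis+
    then have "s \<approx>\<^bsub>C\<star>\<^esub> s'"
      using equiv_inverse[OF C' c(1)] * a by blast
    moreover have "s' \<in> C\<star>"
      using * ** starI by blast
    ultimately have "cls s (C\<star>) = cls s' (C\<star>)"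
      using cls_eq[OF dcoset_star[OF C] c(2)] by blast
    then show "x = cls s (C\<star>)"
      using * ** by simp
  qed
  finally show ?thesis .
qed

lemma dcoset_belowE:
  assumes "D \<in> dcosets" "c \<in> D"
  obtains a s where "a \<in> D" "a \<lhd>\<^bsub>s\<^esub> c" "s \<in> D\<star>"
  using assms coset_belowE dcosetD(1) by metis

lemma groupoid_FD: "groupoid FD"
  unfolding groupoid_def
proof (intro conjI allI ballI impI)
  fix p q assume "gcomp FD p q"
  then have pq: "p \<in> dclasses" "q \<in> dclasses" "src (snd p) = rng (snd q)"
    by (simp_all add: FD_simps)
  then show "p \<in> gset FD" "q \<in> gset FD"
    by (simp_all add: FD_simps)
  obtain b B where b: "p = cls b B" "b \<in> B" "B \<in> dcosets"
    using dclassesE[OF pq(1)] by blast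
  obtain c C where c: "q = cls c C" "c \<in> C" "C \<in> dcosets"
    using dclassesE[OF pq(2)] by blast
  have BC: "src B = rng C"
    using pq b c snd_dcls by simp
  note B = dcosetD(1)[OF b(3)] and C = dcosetD(1)[OF c(3)] and BCd = dcoset_mult[OF b(3) c(3) BC]
  note cancel = mult_cancel[OF B C BC]
  have m: "gmult FD p q = cls (b * c) ((B * C)\<up>)" "b * c \<in> (B * C)\<up>"
    using FD_mult[OF b(3,2) c(3,2) BC] b c mult_in_mult[OF B C] by simp_all
  then show "gmult FD p q \<in> gset FD"
    using BCd by (simp add: FD_simps dclassesI)
  obtain a s where s: "a \<in> B" "a \<lhd>\<^bsub>s\<^esub> b" "s \<in> B\<star>"
    using dcoset_belowE[OF b(3,2)] by blast
  have inv: "ginv FD p = cls s (B\<star>)"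
    using FD_inv[OF b(3) s(1,2)] b(1) by simp
  have "gmult FD (ginv FD p) (gmult FD p q) = cls (s * (b * c)) ((B\<star> * (B * C)\<up>)\<up>)"
    unfolding inv m(1)
    by (rule FD_mult[OF dcoset_star[OF b(3)] s(3) BCd m(2)]) (simp add: src_star[OF B] cancel)
  also have "\<dots> = q"
    unfolding cancel(1) c(1)
  proof (subst cls_eq[OF c(3) _ c(2)])
    show "s * (b * c) \<in> C"
      using rng_mult[OF C c(2)] mult_in_src[OF B s(3) b(2)] BC by (metis mult.assoc)
    show "s * (b * c) \<approx>\<^bsub>C\<^esub> c"
      using equiv_absorb_left[OF B s(1,2) C c(2)] BC by (metis mult.assoc)
  qed
  finally show "gmult FD (ginv FD p) (gmult FD p q) = q" .
  obtain a' t where t: "a' \<in> C" "a' \<lhd>\<^bsub>t\<^esub> c" "t \<in> C\<star>"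
    using dcoset_belowE[OF c(3,2)] by blast
  have inv': "ginv FD q = cls t (C\<star>)"
    using FD_inv[OF c(3) t(1,2)] c(1) by simp
  have "gmult FD (gmult FD p q) (ginv FD q) = cls (b * c * t) (((B * C)\<up> * C\<star>)\<up>)"
    unfolding inv' m(1)
    by (rule FD_mult[OF BCd m(2) dcoset_star[OF c(3)] t(3)]) (simp add: rng_star[OF C] cancel)
  also have "\<dots> = p"
    unfolding cancel(2) b(1)
  proof (subst cls_eq[OF b(3) _ b(2)])
    show "b * c * t \<in> B"
      using mult_src[OF B b(2)] mult_in_rng[OF C t(3) c(2)] BC by (metis mult.assoc)
    show "b * c * t \<approx>\<^bsub>B\<^esub> b"
      using equiv_absorb_right[OF C t(1,2) B b(2)] BC by (metis mult.assoc)
  qed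
  finally show "gmult FD (gmult FD p q) (ginv FD q) = p" .
next
  fix p assume "p \<in> gset FD"
  then obtain c C where c: "p = cls c C" "c \<in> C" "C \<in> dcosets"
    by (auto simp: FD_simps elim: dclassesE)
  note C = dcosetD(1)[OF c(3)] and Cs = dcoset_star[OF c(3)]
  obtain a s where s: "a \<in> C" "a \<lhd>\<^bsub>s\<^esub> c" "s \<in> C\<star>"
    using dcoset_belowE[OF c(3,2)] by blast
  have p': "ginv FD p = cls s (C\<star>)"
    using FD_inv[OF c(3) s(1,2)] c(1) by simp
  then show "ginv FD p \<in> gset FD"
    using Cs s(3) by (simp add: FD_simps dclassesI)
  show "gcomp FD p (ginv FD p)"
    using FD_comp[OF c(3) Cs c(2) s(3)] rng_star[OF C] unfolding p' unfolding c(1) by simp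
  \<comment> \<open>any witness for the inverse of \<open>[s, C\<^sup>*]\<close> will do, and \<open>c\<close> itself is one\<close>
  have "s * a * s \<in> C\<star>"
    using star_mult3[OF C s(3,1,3)] .
  then show "ginv FD (ginv FD p) = p"
    unfolding p' using FD_inv[OF Cs _ via_switch[OF s(2)]] star_star[OF C] c(1) by simp
next
  fix p q r assume "gcomp FD p q \<and> gcomp FD q r"
  then have pq: "p \<in> dclasses" "q \<in> dclasses" "r \<in> dclasses" "src (snd p) = rng (snd q)"
      "src (snd q) = rng (snd r)"
    by (simp_all add: FD_simps)
  obtain b B where b: "p = cls b B" "b \<in> B" "B \<in> dcosets"
    using dclassesE[OF pq(1)] by blast
  obtain c C where c: "q = cls c C" "c \<in> C" "C \<in> dcosets"
    using dclassesE[OF pq(2)] by blast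
  obtain d D where d: "r = cls d D" "d \<in> D" "D \<in> dcosets"
    using dclassesE[OF pq(3)] by blast
  have BC: "src B = rng C" and CD: "src C = rng D"
    using pq b c d snd_dcls by simp_all
  note B = dcosetD(1)[OF b(3)] and C = dcosetD(1)[OF c(3)] and D = dcosetD(1)[OF d(3)]
  have m: "gmult FD p q = cls (b * c) ((B * C)\<up>)" "gmult FD q r = cls (c * d) ((C * D)\<up>)"
    using FD_mult b c d BC CD by simp_all
  have e: "b * c \<in> (B * C)\<up>" "c * d \<in> (C * D)\<up>"
    using mult_in_mult B C D b c d by simp_all
  have BCd: "(B * C)\<up> \<in> dcosets" "(C * D)\<up> \<in> dcosets"
    using dcoset_mult b c d BC CD by simp_all
  have co: "src ((B * C)\<up>) = rng D" "src B = rng ((C * D)\<up>)"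
    using mult_cancel(3,4) B C D BC CD by metis+
  show "gcomp FD (gmult FD p q) r" "gcomp FD p (gmult FD q r)"
    unfolding m using FD_comp b c d e BCd co by simp_all
  have "((B * C)\<up> * D)\<up> = (B * (C * D)\<up>)\<up>"
    using B C D by (simp add: up_mult round_mult rounds mult.assoc)
  then show "gmult FD (gmult FD p q) r = gmult FD p (gmult FD q r)"
    unfolding m using FD_mult b c d e BCd co by (simp add: mult.assoc)
qed

lemma openin_FD_basic:
  "openin (gtop FD) {cls c D |D. D \<in> dcosets \<and> c \<in> D \<and> d \<in> D}" (is "openin _ ?V")
  unfolding openin_FD
proof (intro conjI ballI impI)
  show "?V \<subseteq> dclasses"
    using dclassesI by blast
  fix D b assume D: "D \<in> dcosets" "b \<in> D" "cls b D \<in> ?V"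
  then obtain D' where "D' \<in> dcosets" "c \<in> D'" "d \<in> D'" "cls b D = cls c D'"
    by blast
  then have cd: "c \<in> D" "d \<in> D" "cls b D = cls c D"
    using D snd_dcls by metis+
  then obtain x where x: "x \<in> D"
    "\<And>E. E \<in> dcosets \<Longrightarrow> x \<in> E \<Longrightarrow> b \<in> E \<and> c \<in> E \<and> b \<approx>\<^bsub>E\<^esub> c"
    using equiv_open[OF D(1,2) cd(1)] cls_eq[OF D(1,2) cd(1)] by blast
  obtain e where e: "e \<in> D" "\<forall>E\<in>dcosets. e \<in> E \<longrightarrow> set [x, d] \<subseteq> E"
    using dcoset_lower_list[OF D(1), of "[x, d]"] x(1) cd by auto
  have "b \<in> E \<and> cls b E \<in> ?V" if E: "E \<in> dcosets" "e \<in> E" for E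
  proof -
    have "x \<in> E" "d \<in> E"
      using e(2) E by auto
    then show ?thesis
      using x(2)[OF E(1)] cls_eq[OF E(1)] E(1) by blast
  qed
  then show "\<exists>e\<in>D. \<forall>E\<in>dcosets. e \<in> E \<longrightarrow> b \<in> E \<and> cls b E \<in> ?V"
    using e(1) by blast
qed

lemma topological_groupoid_FD: "topological_groupoid FD"
  unfolding topological_groupoid_def
proof (intro conjI groupoid_FD)
  have grp: "ginv FD p \<in> gset FD" if "p \<in> gset FD" for p
    using groupoid_FD that unfolding groupoid_def by blast
  show "continuous_map (gtop FD) (gtop FD) (ginv FD)"
  proof (rule continuous_map_atI)
    fix p V assume p: "p \<in> topspace (gtop FD)" "openin (gtop FD) V" "ginv FD p \<in> V"
    then obtain c D where c: "p = cls c D" "c \<in> D" "D \<in> dcosets"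
      by (auto simp: FD_simps elim: dclassesE)
    obtain a s where s: "a \<in> D" "a \<lhd>\<^bsub>s\<^esub> c" "s \<in> D\<star>"
      using dcoset_belowE[OF c(3,2)] by blast
    have "cls s (D\<star>) \<in> V"
      using p(3) c(1) FD_inv[OF c(3) s(1,2)] by simp
    then obtain t where t: "t \<in> D\<star>" "\<forall>E\<in>dcosets. t \<in> E \<longrightarrow> s \<in> E \<and> cls s E \<in> V"
      using p(2) dcoset_star[OF c(3)] s(3) unfolding openin_FD by blast
    obtain d where d: "d \<in> D" "\<And>E. E \<in> dcosets \<Longrightarrow> d \<in> E \<Longrightarrow> t \<in> E\<star>"
      using star_open[OF c(3) t(1)] by blast
    obtain e where e: "e \<in> D" "e \<lhd> a" "e \<lhd> d"
      using dcoset_lower[OF c(3) s(1) d(1)] by blast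
    show "\<exists>U. openin (gtop FD) U \<and> p \<in> U \<and> (\<forall>q\<in>U. ginv FD q \<in> V)"
    proof (intro exI conjI ballI)
      show "openin (gtop FD) {cls c D |D. D \<in> dcosets \<and> c \<in> D \<and> e \<in> D}"
        by (rule openin_FD_basic)
      show "p \<in> {cls c D |D. D \<in> dcosets \<and> c \<in> D \<and> e \<in> D}"
        using c e(1) by blast
      fix q assume "q \<in> {cls c D |D. D \<in> dcosets \<and> c \<in> D \<and> e \<in> D}"
      then obtain E where E: "q = cls c E" "E \<in> dcosets" "c \<in> E" "e \<in> E"
        by blast
      then have "a \<in> E" "d \<in> E"
        using coset_below dcosetD(1) e by blast+
      then show "ginv FD q \<in> V"
        using FD_inv[OF E(2) \<open>a \<in> E\<close> s(2)] t(2) d(2)[OF E(2)] dcoset_star[OF E(2)] E(1) by simp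
    qed
  qed (use grp in \<open>simp add: FD_simps\<close>)
  show "continuous_map (subtopology (prod_topology (gtop FD) (gtop FD)) {(p, q). gcomp FD p q})
     (gtop FD) (\<lambda>(p, q). gmult FD p q)"
  proof (rule continuous_map_pairs_atI)
    show "{(p, q). gcomp FD p q} \<subseteq> topspace (gtop FD) \<times> topspace (gtop FD)"
      by (auto simp: FD_simps)
    have "gmult FD p q \<in> gset FD" if "gcomp FD p q" for p q
      using groupoid_FD that unfolding groupoid_def by blast
    then show "(case (p, q) of (p, q) \<Rightarrow> gmult FD p q) \<in> topspace (gtop FD)"
      if "(p, q) \<in> {(p, q). gcomp FD p q}" for p q
      using that by (simp add: FD_simps(1,2))
    fix p q V assume *: "(p, q) \<in> {(p, q). gcomp FD p q}" "openin (gtop FD) V"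
      "(case (p, q) of (p, q) \<Rightarrow> gmult FD p q) \<in> V"
    obtain b B where b: "p = cls b B" "b \<in> B" "B \<in> dcosets"
      using *(1) by (auto simp: FD_simps elim: dclassesE)
    obtain c C where c: "q = cls c C" "c \<in> C" "C \<in> dcosets"
      using *(1) by (auto simp: FD_simps elim: dclassesE)
    have BC: "src B = rng C"
      using * b c snd_dcls by (simp add: FD_simps)
    then have "cls (b * c) ((B * C)\<up>) \<in> V" "(B * C)\<up> \<in> dcosets" "b * c \<in> (B * C)\<up>"
      using * b c FD_mult dcoset_mult mult_in_mult dcosetD(1) by simp_all
    then obtain d where d: "d \<in> (B * C)\<up>" "\<forall>E\<in>dcosets. d \<in> E \<longrightarrow> b * c \<in> E \<and> cls (b * c) E \<in> V"
      using *(2) unfolding openin_FD by blast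
    then obtain b' c' where b': "b' \<in> B" "c' \<in> C" "b' * c' \<lhd> d"
      by (auto elim!: upE set_times_elim)
    show "\<exists>U U'. openin (gtop FD) U \<and> openin (gtop FD) U' \<and> p \<in> U \<and> q \<in> U' \<and>
        (\<forall>x'\<in>U. \<forall>y'\<in>U'. (x', y') \<in> {(p, q). gcomp FD p q} \<longrightarrow>
          (case (x', y') of (p, q) \<Rightarrow> gmult FD p q) \<in> V)"
    proof (intro exI conjI ballI impI)
      show "openin (gtop FD) {cls b D |D. D \<in> dcosets \<and> b \<in> D \<and> b' \<in> D}"
        "openin (gtop FD) {cls c D |D. D \<in> dcosets \<and> c \<in> D \<and> c' \<in> D}"
        by (rule openin_FD_basic)+
      show "p \<in> {cls b D |D. D \<in> dcosets \<and> b \<in> D \<and> b' \<in> D}"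
        "q \<in> {cls c D |D. D \<in> dcosets \<and> c \<in> D \<and> c' \<in> D}"
        using b c b' by blast+
      fix x y assume xy: "x \<in> {cls b D |D. D \<in> dcosets \<and> b \<in> D \<and> b' \<in> D}"
        "y \<in> {cls c D |D. D \<in> dcosets \<and> c \<in> D \<and> c' \<in> D}" "(x, y) \<in> {(p, q). gcomp FD p q}"
      obtain B' where B': "x = cls b B'" "B' \<in> dcosets" "b \<in> B'" "b' \<in> B'"
        using xy(1) by blast
      obtain C' where C': "y = cls c C'" "C' \<in> dcosets" "c \<in> C'" "c' \<in> C'"
        using xy(2) by blast
      have co: "src B' = rng C'"
        using xy(3) B' C' snd_dcls by (simp add: FD_simps)
      have "d \<in> (B' * C')\<up>"
        using B'(4) C'(4) b'(3) by (meson set_times_intro upI)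
      then show "(case (x, y) of (p, q) \<Rightarrow> gmult FD p q) \<in> V"
        using d(2) dcoset_mult[OF B'(2) C'(2) co] FD_mult[OF B'(2,3) C'(2,3) co] B'(1) C'(1)
        by simp
    qed
  qed
qed

lemma gsrc_FD:
  assumes "D \<in> dcosets" "a \<in> D" "a \<lhd>\<^bsub>s\<^esub> c"
  shows "gsrc FD (cls c D) = cls (s * c) (src D)"
proof -
  have c: "c \<in> D" "s \<in> D\<star>"
    using assms coset_below dcosetD(1) belowI starI by blast+
  show ?thesis
    unfolding gsrc_def FD_inv[OF assms] source_def
    by (rule FD_mult[OF dcoset_star[OF assms(1)] c(2) assms(1) c(1) src_star[OF dcosetD(1)[OF assms(1)]]])
qed

end

lemma etale_representationD:
  assumes "etale_representation N Z G \<theta>"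
  shows "etale_groupoid G" "\<theta> a \<in> open_slices G" "\<theta> (a * b) = slice_mult G (\<theta> a) (\<theta> b)"
    "(\<Union>a. \<theta> a) = gset G" "n \<in> N \<Longrightarrow> openin (subtopology (gtop G) (gunits G)) (\<theta> n)"
    "g \<in> \<theta> a \<Longrightarrow> \<exists>b. below N Z b a \<and> g \<in> \<theta> b"
  using assms by (simp_all add: etale_representation_def)

context structured
begin

lemma coset_proj_cls: "D \<in> dcosets \<Longrightarrow> coset_proj (cls c D) = D"
  by (simp add: coset_proj_def snd_dcls)

lemma coset_proj_in: "p \<in> dclasses \<Longrightarrow> coset_proj p \<in> dcosets"
  by (erule dclassesE) (simp add: coset_proj_cls)

lemma groupoid_bundle_FD: "groupoid_bundle FD GD coset_proj"
  unfolding groupoid_bundle_def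
proof (intro conjI topological_groupoid_FD etale_groupoid_GD)
  show "open_map (gtop FD) (gtop GD) coset_proj"
    unfolding open_map_def
  proof (intro allI impI)
    fix W assume W: "openin (gtop FD) W"
    show "openin (gtop GD) (coset_proj ` W)"
      unfolding openin_GD
    proof (intro conjI ballI)
      show "coset_proj ` W \<subseteq> dcosets"
        using W coset_proj_in unfolding openin_FD by blast
      fix D assume "D \<in> coset_proj ` W"
      then obtain p where p: "p \<in> W" "D = coset_proj p" "p \<in> dclasses"
        using W unfolding openin_FD by blast
      obtain c E where "p = cls c E" "c \<in> E" "E \<in> dcosets"
        using dclassesE[OF p(3)] by blast
      then have c: "cls c D \<in> W" "D \<in> dcosets" "c \<in> D"
        using p snd_dcls by (simp_all add: coset_proj_def)
      then obtain d where d: "d \<in> D" "\<forall>E\<in>dcosets. d \<in> E \<longrightarrow> c \<in> E \<and> cls c E \<in> W"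
        using W unfolding openin_FD by blast
      then have "E \<in> coset_proj ` W" if "E \<in> dcosets" "d \<in> E" for E
        using that snd_dcls unfolding coset_proj_def by (metis imageI)
      then show "\<exists>d. d \<in> D \<and> (\<forall>E\<in>dcosets. d \<in> E \<longrightarrow> E \<in> coset_proj ` W)"
        using d(1) by blast
    qed
  qed
  show "continuous_map (gtop FD) (gtop GD) coset_proj"
  proof (rule continuous_map_atI)
    fix p V assume p: "p \<in> topspace (gtop FD)" "openin (gtop GD) V" "coset_proj p \<in> V"
    then obtain c D where c: "p = cls c D" "c \<in> D" "D \<in> dcosets"
      by (auto simp: FD_simps elim: dclassesE)
    then obtain d where d: "d \<in> D" "\<forall>E\<in>dcosets. d \<in> E \<longrightarrow> E \<in> V"
      using p(2,3) snd_dcls by (auto simp: openin_GD coset_proj_def)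
    let ?U = "{cls c D |D. D \<in> dcosets \<and> c \<in> D \<and> d \<in> D}"
    have "coset_proj q \<in> V" if q: "q \<in> ?U" for q
    proof -
      obtain E where "q = cls c E" "E \<in> dcosets" "d \<in> E"
        using q by blast
      then show ?thesis
        using d(2) coset_proj_cls by simp
    qed
    moreover have "p \<in> ?U"
      using c d(1) by blast
    ultimately show "\<exists>U. openin (gtop FD) U \<and> p \<in> U \<and> (\<forall>q\<in>U. coset_proj q \<in> V)"
      using openin_FD_basic by blast
  qed (simp add: FD_simps GD_simps coset_proj_in)
  show "groupoid_functor FD GD coset_proj"
    unfolding groupoid_functor_def
  proof (intro conjI ballI allI impI)
    show "coset_proj p \<in> gset GD" if "p \<in> gset FD" for p
      using that by (simp add: FD_simps GD_simps coset_proj_in)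
    fix p q assume pq: "gcomp FD p q"
    obtain b B where b: "p = cls b B" "b \<in> B" "B \<in> dcosets"
      using pq by (auto simp: FD_simps elim: dclassesE)
    obtain c C where c: "q = cls c C" "c \<in> C" "C \<in> dcosets"
      using pq by (auto simp: FD_simps elim: dclassesE)
    have BC: "src B = rng C"
      using pq b c snd_dcls by (simp add: FD_simps)
    then show "gcomp GD (coset_proj p) (coset_proj q)"
      using b c snd_dcls by (simp add: GD_simps coset_proj_def)
    show "coset_proj (gmult FD p q) = gmult GD (coset_proj p) (coset_proj q)"
      using FD_mult[OF b(3,2) c(3,2) BC] b c snd_dcls dcoset_mult[OF b(3) c(3) BC]
      by (simp add: GD_simps coset_proj_def)
  qed
  show "inj_on coset_proj (gunits FD)"
  proof (rule inj_onI)
    fix p q assume pq: "p \<in> gunits FD" "q \<in> gunits FD" "coset_proj p = coset_proj q"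
    obtain c C where c: "p = gsrc FD (cls c C)" "c \<in> C" "C \<in> dcosets"
      using pq(1) unfolding gunits_def FD_simps by (blast elim: dclassesE)
    obtain d D where d: "q = gsrc FD (cls d D)" "d \<in> D" "D \<in> dcosets"
      using pq(2) unfolding gunits_def FD_simps by (blast elim: dclassesE)
    obtain a s where s: "a \<in> C" "a \<lhd>\<^bsub>s\<^esub> c" "s \<in> C\<star>"
      using dcoset_belowE[OF c(3,2)] by blast
    obtain b t where t: "b \<in> D" "b \<lhd>\<^bsub>t\<^esub> d" "t \<in> D\<star>"
      using dcoset_belowE[OF d(3,2)] by blast
    have p: "p = cls (s * c) (src C)" and q: "q = cls (t * d) (src D)"
      using gsrc_FD c(1,3) d(1,3) s t by metis+
    have eq: "src D = src C"
      using pq(3) snd_dcls[OF dcoset_src[OF c(3)]] snd_dcls[OF dcoset_src[OF d(3)]]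
      unfolding p q coset_proj_def by simp
    note C = dcosetD(1)[OF c(3)] and D = dcosetD(1)[OF d(3)]
    note U = unit_cosetD[OF unit_src[OF C]]
    have sc: "s * c \<in> src C" and td: "t * d \<in> src C"
      using mult_in_src[OF C s(3) c(2)] mult_in_src[OF D t(3) d(2)] eq by simp_all
    have "s * c * (t * d) \<approx>\<^bsub>src C\<^esub> t * d"
      by (rule equiv_absorb_left[OF C s(1,2) U(1) td U(4)])
    moreover have "t * d * (s * c) \<approx>\<^bsub>src C\<^esub> s * c"
      using equiv_absorb_left[OF D t(1,2) U(1) sc] U(4) eq by simp
    moreover have "s * c * (t * d) = t * d * (s * c)"
      using Z_central Z_N viaD(6) s(2) t(2) by metis
    ultimately have "s * c \<approx>\<^bsub>src C\<^esub> t * d"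
      using equiv_trans[OF U(1) sc] equiv_sym by metis
    then show "p = q"
      using cls_eq[OF dcoset_src[OF c(3)] sc td] unfolding p q eq by simp
  qed
qed

lemma dom_directed_coset_rep: "dom (directed_coset_rep N Z a) = {D \<in> dcosets. a \<in> D}"
  by (auto simp: directed_coset_rep_def split: if_splits)

lemma bundle_representation_FD:
  assumes "symmetric_subsemigroup Z"
  shows "bundle_representation N Z FD GD coset_proj (directed_coset_rep N Z)"
  unfolding bundle_representation_def
proof (intro conjI allI groupoid_bundle_FD)
  let ?\<mu> = "directed_coset_rep N Z"
  have etale: "etale_representation N Z GD (\<lambda>a. {D \<in> dcosets. a \<in> D})"
    by (rule etale_representation_GD[OF assms])
  then show "etale_representation N Z GD (\<lambda>a. dom (?\<mu> a))"
    by (simp only: dom_directed_coset_rep)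
  have slice: "{D \<in> dcosets. a \<in> D} \<in> open_slices GD" for a
    using etale_representationD(2)[OF etale] .
  have hom: "{D \<in> dcosets. a * b \<in> D} = slice_mult GD {D \<in> dcosets. a \<in> D} {D \<in> dcosets. b \<in> D}" for a b
    using etale_representationD(3)[OF etale] .
  have val: "the (?\<mu> a D) = cls a D" if "D \<in> dcosets" "a \<in> D" for a D
    using that by (simp add: directed_coset_rep_def)
  show "?\<mu> a \<in> slice_sections FD GD coset_proj" for a
    unfolding slice_sections_def mem_Collect_eq dom_directed_coset_rep
  proof (intro conjI ballI slice)
    show "coset_proj (the (?\<mu> a D)) = D" if "D \<in> {D \<in> dcosets. a \<in> D}" for D
      using that val snd_dcls by (simp add: coset_proj_def)
    show "continuous_map (subtopology (gtop GD) {D \<in> dcosets. a \<in> D}) (gtop FD) (\<lambda>D. the (?\<mu> a D))"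
    proof (rule continuous_map_atI)
      fix D V assume "D \<in> topspace (subtopology (gtop GD) {D \<in> dcosets. a \<in> D})"
        "openin (gtop FD) V" "the (?\<mu> a D) \<in> V"
      then have *: "D \<in> dcosets" "a \<in> D" "openin (gtop FD) V" "cls a D \<in> V"
        using val by (auto simp: GD_simps)
      then obtain d where d: "d \<in> D" "\<forall>E\<in>dcosets. d \<in> E \<longrightarrow> a \<in> E \<and> cls a E \<in> V"
        unfolding openin_FD by blast
      show "\<exists>U. openin (subtopology (gtop GD) {D \<in> dcosets. a \<in> D}) U \<and> D \<in> U \<and>
          (\<forall>E\<in>U. the (?\<mu> a E) \<in> V)"
      proof (intro exI conjI)
        show "openin (subtopology (gtop GD) {D \<in> dcosets. a \<in> D})
            ({D \<in> dcosets. a \<in> D} \<inter> {D \<in> dcosets. d \<in> D})"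
          by (rule openin_subtopology_Int2[OF openin_GD_basic])
      qed (use * d val in auto)
    qed (use val dclassesI in \<open>auto simp: FD_simps GD_simps\<close>)
  qed
  fix a b
  show "?\<mu> (a * b) = section_mult FD GD (?\<mu> a) (?\<mu> b)"
  proof
    fix D
    show "?\<mu> (a * b) D = section_mult FD GD (?\<mu> a) (?\<mu> b) D"
    proof (cases "D \<in> dcosets \<and> a * b \<in> D")
      case False
      then show ?thesis
        using hom[of a b] unfolding section_mult_def dom_directed_coset_rep
        by (auto simp: directed_coset_rep_def)
    next
      case True
      then have D: "D \<in> slice_mult GD {D \<in> dcosets. a \<in> D} {D \<in> dcosets. b \<in> D}"
        using hom by blast
      have *: "gmult FD (the (?\<mu> a B)) (the (?\<mu> b C)) = cls (a * b) D"
        if "B \<in> dcosets" "a \<in> B" "C \<in> dcosets" "b \<in> C" "gcomp GD B C" "D = gmult GD B C" for B C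
        using that val FD_mult by (simp add: GD_simps)
      have "(THE f. \<exists>B\<in>{D \<in> dcosets. a \<in> D}. \<exists>C\<in>{D \<in> dcosets. b \<in> D}. gcomp GD B C \<and>
          D = gmult GD B C \<and> f = gmult FD (the (?\<mu> a B)) (the (?\<mu> b C))) = cls (a * b) D"
      proof (rule the_equality)
        show "\<exists>B\<in>{D \<in> dcosets. a \<in> D}. \<exists>C\<in>{D \<in> dcosets. b \<in> D}. gcomp GD B C \<and>
          D = gmult GD B C \<and> cls (a * b) D = gmult FD (the (?\<mu> a B)) (the (?\<mu> b C))"
          using D * unfolding slice_mult_def by fastforce
      qed (use * in blast)
      then show ?thesis
        using D True unfolding section_mult_def dom_directed_coset_rep
        by (simp add: directed_coset_rep_def)
    qed
  qed
qed

end

section \<open>Groupoids\<close>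

locale is_groupoid =
  fixes G :: "'g top_groupoid"
  assumes groupoid: "groupoid G"
begin

lemma comp_closed: "gcomp G g h \<Longrightarrow> g \<in> gset G" "gcomp G g h \<Longrightarrow> h \<in> gset G"
    "gcomp G g h \<Longrightarrow> gmult G g h \<in> gset G"
  and inv_closed: "g \<in> gset G \<Longrightarrow> ginv G g \<in> gset G"
  and inv_inv: "g \<in> gset G \<Longrightarrow> ginv G (ginv G g) = g"
  and comp_inv: "g \<in> gset G \<Longrightarrow> gcomp G g (ginv G g)"
  and assoc: "gcomp G g h \<Longrightarrow> gcomp G h k \<Longrightarrow> gcomp G (gmult G g h) k"
    "gcomp G g h \<Longrightarrow> gcomp G h k \<Longrightarrow> gcomp G g (gmult G h k)"
    "gcomp G g h \<Longrightarrow> gcomp G h k \<Longrightarrow> gmult G (gmult G g h) k = gmult G g (gmult G h k)"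
  and cancel: "gcomp G g h \<Longrightarrow> gmult G (ginv G g) (gmult G g h) = h"
    "gcomp G g h \<Longrightarrow> gmult G (gmult G g h) (ginv G h) = g"
  using groupoid unfolding groupoid_def by blast+

lemma comp_inv_left: "g \<in> gset G \<Longrightarrow> gcomp G (ginv G g) g"
  using comp_inv inv_closed inv_inv by metis

lemma comp_iff: "g \<in> gset G \<Longrightarrow> h \<in> gset G \<Longrightarrow> gcomp G g h \<longleftrightarrow> gsrc G g = grng G h"
  by (rule gcomp_iff[OF groupoid])

lemma src_inv: "g \<in> gset G \<Longrightarrow> gsrc G (ginv G g) = grng G g"
  and rng_inv: "g \<in> gset G \<Longrightarrow> grng G (ginv G g) = gsrc G g"
  by (simp_all add: gsrc_def grng_def inv_inv)

lemma src_mult: assumes "gcomp G g h" shows "gsrc G (gmult G g h) = gsrc G h"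
  using assoc(1)[OF assms comp_inv] comp_closed[OF assms] comp_iff inv_closed rng_inv by metis

lemma rng_mult: assumes "gcomp G g h" shows "grng G (gmult G g h) = grng G g"
  using assoc(2)[OF comp_inv_left assms] comp_closed[OF assms] comp_iff inv_closed src_inv by metis

lemma src_unit: "g \<in> gset G \<Longrightarrow> gsrc G g \<in> gunits G"
  and rng_unit: "g \<in> gset G \<Longrightarrow> grng G g \<in> gunits G"
  using src_inv inv_closed by (auto simp: gunits_def image_iff) metis

lemma unit_closed: "u \<in> gunits G \<Longrightarrow> u \<in> gset G"
  using comp_closed comp_inv_left by (auto simp: gunits_def gsrc_def)

lemma mult_src: "g \<in> gset G \<Longrightarrow> gmult G g (gsrc G g) = g"
  using cancel(1)[OF comp_inv_left] by (simp add: gsrc_def inv_inv)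

lemma unit_eq:
  assumes "u \<in> gunits G"
  shows "gsrc G u = u" "grng G u = u" "ginv G u = u"
proof -
  obtain g where g: "g \<in> gset G" "u = gsrc G g"
    using assms by (auto simp: gunits_def)
  show 1: "gsrc G u = u"
    using src_mult[OF comp_inv_left[OF g(1)]] g by (simp add: gsrc_def)
  show 2: "grng G u = u"
    using rng_mult[OF comp_inv_left[OF g(1)]] g rng_inv by (simp add: gsrc_def)
  have "gmult G (ginv G u) u = ginv G u"
    using mult_src[OF inv_closed[OF unit_closed[OF assms]]] src_inv[OF unit_closed[OF assms]] 2
    by simp
  then show "ginv G u = u"
    using 1 by (simp add: gsrc_def)
qed

lemma rng_mult_self: "g \<in> gset G \<Longrightarrow> gmult G (grng G g) g = g"
  using cancel(2)[OF comp_inv] by (simp add: grng_def inv_inv)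

lemma comp_src: "g \<in> gset G \<Longrightarrow> gcomp G g (gsrc G g)"
  and comp_rng: "g \<in> gset G \<Longrightarrow> gcomp G (grng G g) g"
  using comp_iff unit_eq src_unit rng_unit unit_closed by metis+

lemma unit_mult: "gcomp G u g \<Longrightarrow> u \<in> gunits G \<Longrightarrow> gmult G u g = g"
  using comp_iff comp_closed unit_eq rng_mult_self by metis

lemma left_cancel: "gcomp G g h \<Longrightarrow> gcomp G g k \<Longrightarrow> gmult G g h = gmult G g k \<Longrightarrow> h = k"
  and right_cancel: "gcomp G h g \<Longrightarrow> gcomp G k g \<Longrightarrow> gmult G h g = gmult G k g \<Longrightarrow> h = k"
  using cancel by metis+

end

section \<open>Universality\<close>

locale structured_representation = structured N Z for N Z :: "'a::semigroup_mult set" +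
  fixes F' :: "'e top_groupoid" and G' :: "'h top_groupoid" and \<pi>' :: "'e \<Rightarrow> 'h"
    and \<theta> :: "'a \<Rightarrow> 'h \<rightharpoonup> 'e"
  assumes rep: "bundle_representation N Z F' G' \<pi>' \<theta>"
begin

lemma bundle_FG: "groupoid_bundle F' G' \<pi>'"
  and sections: "\<theta> a \<in> slice_sections F' G' \<pi>'"
  and section_hom: "\<theta> (a * b) = section_mult F' G' (\<theta> a) (\<theta> b)"
  and etale: "etale_representation N Z G' (\<lambda>a. dom (\<theta> a))"
  using rep by (simp_all add: bundle_representation_def)

lemma etale_G': "etale_groupoid G'"
  by (rule etale_representationD(1)[OF etale])

sublocale G': is_groupoid G'
  using etale_G' by unfold_locales (simp add: etale_groupoid_def topological_groupoid_def)

sublocale F': is_groupoid F'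
  using bundle_FG by unfold_locales (simp add: groupoid_bundle_def topological_groupoid_def)

abbreviation T where "T a \<equiv> dom (\<theta> a)"

definition sec where "sec a h = the (\<theta> a h)"

lemma T_open: "openin (gtop G') (T a)"
  and T_inj_src: "inj_on (gsrc G') (T a)"
  and T_inj_rng: "inj_on (grng G') (T a)"
  using etale_representationD(2)[OF etale, of a] by (simp_all add: open_slices_def)

lemma T_closed: "h \<in> T a \<Longrightarrow> h \<in> gset G'"
  using openin_subset[OF T_open] by (auto simp: gset_def)

lemma T_eq_rng: "h \<in> T a \<Longrightarrow> k \<in> T a \<Longrightarrow> grng G' h = grng G' k \<Longrightarrow> h = k"
  using T_inj_rng by (meson inj_onD)

lemma T_eq_src: "h \<in> T a \<Longrightarrow> k \<in> T a \<Longrightarrow> gsrc G' h = gsrc G' k \<Longrightarrow> h = k"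
  using T_inj_src by (meson inj_onD)

lemma T_multI: "h \<in> T a \<Longrightarrow> k \<in> T b \<Longrightarrow> gcomp G' h k \<Longrightarrow> gmult G' h k \<in> T (a * b)"
  unfolding etale_representationD(3)[OF etale] slice_mult_def by blast

lemma T_multE:
  assumes "h \<in> T (a * b)"
  obtains g k where "g \<in> T a" "k \<in> T b" "gcomp G' g k" "h = gmult G' g k"
  using assms unfolding etale_representationD(3)[OF etale] slice_mult_def by blast

lemma T_N: "n \<in> N \<Longrightarrow> u \<in> T n \<Longrightarrow> u \<in> gunits G'"
  using openin_subset[OF etale_representationD(5)[OF etale]] by fastforce

lemma T_below: assumes "h \<in> T a" obtains b where "b \<lhd> a" "h \<in> T b"
  using etale_representationD(6)[OF etale assms] by blast

text \<open>
  As \<open>a = a * s * b\<close> with \<open>a * s\<close> in \<open>N\<close>, the point \<open>h\<close> is a product of a unit and a point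
  of \<open>T b\<close>. The unit in turn factors through \<open>T a\<close> and \<open>T s\<close>, and the slice property identifies
  these factors as \<open>h\<close> and its inverse.
\<close>

lemma T_via:
  assumes "h \<in> T a" "a \<lhd>\<^bsub>s\<^esub> b"
  shows "h \<in> T b" "ginv G' h \<in> T s"
proof -
  note a = viaD[OF assms(2)]
  obtain k l where k: "k \<in> T (a * s)" "l \<in> T b" "gcomp G' k l" "h = gmult G' k l"
    using assms(1) a(1) T_multE by metis
  have u: "k \<in> gunits G'"
    by (rule T_N[OF a(3) k(1)])
  then show "h \<in> T b"
    using G'.unit_mult k by simp
  obtain g i where g: "g \<in> T a" "i \<in> T s" "gcomp G' g i" "k = gmult G' g i"
    using k(1) T_multE by metis
  have h: "h \<in> gset G'"
    by (rule T_closed[OF assms(1)])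
  have kh: "k = grng G' h"
    using G'.rng_mult[OF k(3)] G'.unit_eq(2)[OF u] k(4) by simp
  then have "grng G' g = grng G' h"
    using G'.rng_mult[OF g(3)] g(4) G'.unit_eq(2)[OF u] by simp
  then have "g = h"
    using T_eq_rng g(1) assms(1) by blast
  then have "i = ginv G' h"
    using g(3,4) kh G'.left_cancel G'.comp_inv[OF h] by (metis grng_def)
  then show "ginv G' h \<in> T s"
    using g(2) by simp
qed

lemma T_up: "h \<in> T a \<Longrightarrow> a \<lhd> b \<Longrightarrow> h \<in> T b"
  using T_via belowE by metis

lemma T_quotient_rng:
  assumes "h \<in> T a" "ginv G' h \<in> T s"
  shows "grng G' h \<in> T (a * s)"
  using T_multI[OF assms G'.comp_inv] T_closed assms(1) by (simp add: grng_def)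

lemma T_triple:
  assumes "h \<in> T a" "ginv G' h \<in> T s" "h \<in> T b"
  shows "h \<in> T (a * s * b)"
  using T_multI[OF T_quotient_rng[OF assms(1,2)] assms(3)] T_closed[OF assms(1)]
    G'.comp_rng G'.rng_mult_self by metis

lemma N_cross:
  assumes "e \<lhd>\<^bsub>s\<^esub> a" "d \<lhd>\<^bsub>t\<^esub> a"
  shows "e * t \<in> N" "t * e \<in> N"
proof -
  note e = viaD[OF assms(1)] via_rewrite[OF assms(1)] and d = viaD[OF assms(2)]
  have "e * t = (e * s) * (a * t)" "t * e = (t * a) * (s * e)"
    using e by (simp_all add: mult.assoc)
  then show "e * t \<in> N" "t * e \<in> N"
    using N_mult[OF e(3) Z_N[OF d(5)]] N_mult[OF Z_N[OF d(6)] e(4)] by simp_all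
qed

text \<open>
  If \<open>t\<close> is a witness for \<open>d'\<close> below \<open>a\<close>, then \<open>e * t * e'\<close> can be bracketed as \<open>e\<close> times an
  element of \<open>N\<close> and as an element of \<open>N\<close> times \<open>e'\<close>. The upper bound \<open>a\<close> is essential for
  this: two elements defined at \<open>h\<close> may have no common lower bound there.
\<close>

lemma T_common_lower:
  assumes d: "h \<in> T d" "d \<lhd> a" and d': "h \<in> T d'" "d' \<lhd> a"
  obtains e where "h \<in> T e" "e \<lhd> d" "e \<lhd> d'"
proof -
  obtain s t where s: "d \<lhd>\<^bsub>s\<^esub> a" and t: "d' \<lhd>\<^bsub>t\<^esub> a"
    using d d' belowE by metis
  obtain e where e: "e \<lhd> d" "h \<in> T e"
    using T_below[OF d(1)] .
  obtain e' where e': "e' \<lhd> d'" "h \<in> T e'"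
    using T_below[OF d'(1)] .
  have "e * (t * e') \<lhd> d"
    by (rule below_N(1)[OF e(1) viaD(4)[OF below_via_trans[OF e'(1) t]]])
  moreover have "(e * t) * e' \<lhd> d'"
    by (rule below_N(2)[OF e'(1) N_cross(1)[OF below_via_trans[OF e(1) s] t]])
  moreover have "h \<in> T (e * t * e')"
    by (rule T_triple[OF e(2) T_via(2)[OF d'(1) t] e'(2)])
  ultimately show thesis
    using that by (simp add: mult.assoc)
qed

text \<open>
  The elements defined at \<open>h\<close> split into classes of those with a common lower bound
  defined at \<open>h\<close>, and \<open>germ a h\<close> is the class of \<open>a\<close>.
\<close>

definition germ where "germ a h = {b. \<exists>d. h \<in> T d \<and> d \<lhd> a \<and> d \<lhd> b}"

lemma germI: "h \<in> T d \<Longrightarrow> d \<lhd> a \<Longrightarrow> d \<lhd> b \<Longrightarrow> b \<in> germ a h"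
  by (auto simp: germ_def)

lemma germE: assumes "b \<in> germ a h" obtains d where "h \<in> T d" "d \<lhd> a" "d \<lhd> b"
  using assms by (auto simp: germ_def)

lemma germ_self: "h \<in> T a \<Longrightarrow> a \<in> germ a h"
  using T_below germI by metis

lemma germ_below: "h \<in> T d \<Longrightarrow> d \<lhd> a \<Longrightarrow> d \<in> germ a h"
  using T_below germI below_trans by metis

lemma germ_T: "b \<in> germ a h \<Longrightarrow> h \<in> T b"
  using germE T_up by metis

lemma germ_sym: "b \<in> germ a h \<Longrightarrow> a \<in> germ b h"
  by (auto simp: germ_def)

lemma germ_trans: assumes "b \<in> germ a h" "x \<in> germ b h" shows "x \<in> germ a h"
proof -
  obtain d where d: "h \<in> T d" "d \<lhd> a" "d \<lhd> b"
    using germE[OF assms(1)] .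
  obtain e where e: "h \<in> T e" "e \<lhd> b" "e \<lhd> x"
    using germE[OF assms(2)] .
  obtain f where "h \<in> T f" "f \<lhd> d" "f \<lhd> e"
    using T_common_lower[OF d(1,3) e(1,2)] .
  then show ?thesis
    using d e below_trans germI by blast
qed

lemma germ_eq: "b \<in> germ a h \<Longrightarrow> germ b h = germ a h"
  using germ_trans germ_sym by blast

lemma germ_lower:
  assumes "b \<in> germ a h" "b' \<in> germ a h"
  obtains e where "e \<in> germ a h" "h \<in> T e" "e \<lhd> a" "e \<lhd> b" "e \<lhd> b'"
proof -
  obtain d where d: "h \<in> T d" "d \<lhd> a" "d \<lhd> b"
    using germE[OF assms(1)] .
  obtain d' where d': "h \<in> T d'" "d' \<lhd> a" "d' \<lhd> b'"
    using germE[OF assms(2)] .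
  obtain e where e: "h \<in> T e" "e \<lhd> d" "e \<lhd> d'"
    using T_common_lower[OF d(1,2) d'(1,2)] .
  then have "e \<lhd> a" "e \<lhd> b" "e \<lhd> b'"
    using d d' below_trans by blast+
  then show thesis
    using that germ_below e(1) by blast
qed

lemma germ_dcoset:
  assumes a: "h \<in> T a"
  shows "germ a h \<in> dcosets"
proof (rule dcosetI[OF _ germ_self[OF a]])
  let ?D = "germ a h"
  show "directed N Z ?D"
    unfolding directed_def using germ_lower by metis
  show "coset N Z ?D"
    unfolding coset_def
  proof
    show "?D = ?D\<up>"
    proof
      show "?D \<subseteq> ?D\<up>"
        using germ_lower upI by (metis subsetI)
      show "?D\<up> \<subseteq> ?D"
        by (auto simp: germ_def elim!: upE intro: below_trans)
    qed
    show "?D * ?D\<star> * ?D \<subseteq> ?D"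
    proof (safe elim!: set_times_elim)
      fix b s c assume *: "b \<in> ?D" "s \<in> ?D\<star>" "c \<in> ?D"
      obtain x y where x: "x \<in> ?D" "x \<lhd>\<^bsub>s\<^esub> y"
        using *(2) by (auto simp: star_def)
      obtain e where e: "e \<in> ?D" "h \<in> T e" "e \<lhd> b" "e \<lhd> c"
        using germ_lower[OF *(1,3)] by metis
      obtain d where d: "h \<in> T d" "d \<lhd> a" "d \<lhd> e" "d \<lhd> x"
        using germ_lower[OF e(1) x(1)] by metis
      have ds: "d \<lhd>\<^bsub>s\<^esub> y"
        by (rule below_via_trans[OF d(4) x(2)])
      have s: "ginv G' h \<in> T s"
        by (rule T_via(2)[OF d(1) ds])
      have "h \<in> T (d * s * d * s * d)"
        using T_triple[OF T_triple[OF d(1) s d(1)] s d(1)] .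
      moreover have "(d * s * (d * s)) * d \<lhd> a"
        by (rule below_N(2)[OF d(2) N_mult]) (rule viaD(3)[OF ds])+
      moreover have "d * (s * d * s) * d \<lhd> b * s * c"
        by (intro below_mult) (use d e ds below_trans via_switch belowI in blast)+
      ultimately show "b * s * c \<in> ?D"
        by (intro germI[of _ "d * s * d * s * d"]) (simp_all add: mult.assoc)
    qed
  qed
qed

definition \<phi> where "\<phi> = {(germ a h, h) |a h. h \<in> T a}"

lemma phiI: "h \<in> T a \<Longrightarrow> (germ a h, h) \<in> \<phi>"
  by (auto simp: \<phi>_def)

lemma phiD:
  assumes "(D, h) \<in> \<phi>"
  shows "D \<in> dcosets" "h \<in> gset G'" "b \<in> D \<Longrightarrow> D = germ b h" "b \<in> D \<Longrightarrow> h \<in> T b"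
proof -
  obtain a where "D = germ a h" "h \<in> T a"
    using assms unfolding \<phi>_def by blast
  then show "D \<in> dcosets" "h \<in> gset G'" "b \<in> D \<Longrightarrow> D = germ b h" "b \<in> D \<Longrightarrow> h \<in> T b"
    using germ_dcoset T_closed germ_eq germ_T by blast+
qed

text \<open>
  A directed coset of elements defined at \<open>h\<close> is always contained in one of the classes. To be the
  whole class it only has to contain the elements defined at \<open>h\<close> that are below one of its members.
\<close>

lemma phi_if_maximal:
  assumes X: "X \<in> dcosets" "\<And>x. x \<in> X \<Longrightarrow> h \<in> T x"
    and e: "e \<in> X" "\<And>t. h \<in> T t \<Longrightarrow> t \<lhd> e \<Longrightarrow> t \<in> X"
  shows "(X, h) \<in> \<phi>"
proof -
  have "X = germ e h"
  proof
    show "X \<subseteq> germ e h"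
      using dcoset_lower[OF X(1) e(1)] X(2) germI by (metis subsetI)
    show "germ e h \<subseteq> X"
      using e(2) coset_below[OF dcosetD(1)[OF X(1)]] by (auto elim!: germE)
  qed
  then show ?thesis
    using phiI[OF X(2)[OF e(1)]] by simp
qed

text \<open>
  Over a unit there may be many classes, but only one of them meets \<open>N\<close>. This rigidity makes
  related cosets composable whenever their points are.
\<close>

lemma phi_unit_unique:
  assumes D: "(D, u) \<in> \<phi>" "n \<in> D" "n \<in> N" and E: "(E, u) \<in> \<phi>" "m \<in> E" "m \<in> N"
  shows "D = E"
proof -
  have u: "u \<in> T n" "u \<in> T m"
    using phiD D E by blast+
  obtain n' where n': "n' \<lhd> n" "u \<in> T n'"
    using T_below[OF u(1)] .
  obtain m' where m': "m' \<lhd> m" "u \<in> T m'"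
    using T_below[OF u(2)] .
  have U: "u \<in> gunits G'"
    by (rule T_N[OF D(3) u(1)])
  then have "gcomp G' u u" "gmult G' u u = u"
    using G'.comp_src G'.mult_src G'.unit_eq(1) G'.unit_closed by metis+
  then have "u \<in> T (n' * m')"
    using T_multI[OF n'(2) m'(2)] by simp
  then have "m \<in> germ n u"
    using germI below_N n' m' below_in_N D(3) E(3) by meson
  then show ?thesis
    using germ_eq phiD(3) D E by metis
qed

text \<open>
  Given \<open>t\<close> below \<open>b * c\<close> via \<open>u\<close>, it must be shown that \<open>t\<close> belongs to the product. The element
  \<open>t' * u\<close> of \<open>N\<close> carries \<open>t\<close> relative to \<open>b * c\<close>; absorbing it into the first factor yields
  \<open>t' * u * b'\<close> in \<open>D\<close>, and its product with \<open>c'\<close> is below \<open>t\<close>.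
\<close>

lemma phi_mult:
  assumes D: "(D, h) \<in> \<phi>" and E: "(E, k) \<in> \<phi>" and hk: "gcomp G' h k" and DE: "src D = rng E"
  shows "((D * E)\<up>, gmult G' h k) \<in> \<phi>"
proof -
  note D' = phiD(1)[OF D] dcosetD[OF phiD(1)[OF D]]
    and E' = phiD(1)[OF E] dcosetD[OF phiD(1)[OF E]]
  obtain b c where b: "b \<in> D" "c \<in> E"
    using D'(3) E'(3) by blast
  obtain b' p where b': "b' \<in> D" "b' \<lhd>\<^bsub>p\<^esub> b"
    using dcoset_belowE[OF D'(1) b(1)] by metis
  obtain c' q where c': "c' \<in> E" "c' \<lhd>\<^bsub>q\<^esub> c"
    using dcoset_belowE[OF E'(1) b(2)] by metis
  have prod: "gmult G' h k \<in> T (x * y)" if "x \<in> D" "y \<in> E" for x y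
    by (rule T_multI[OF phiD(4)[OF D that(1)] phiD(4)[OF E that(2)] hk])
  show ?thesis
  proof (rule phi_if_maximal)
    show "(D * E)\<up> \<in> dcosets"
      by (rule dcoset_mult[OF D'(1) E'(1) DE])
    show "gmult G' h k \<in> T x" if x: "x \<in> (D * E)\<up>" for x
    proof -
      obtain y z where "y \<in> D" "z \<in> E" "y * z \<lhd> x"
        using x by (rule up_multE)
      then show ?thesis
        using prod T_up by metis
    qed
    show "b * c \<in> (D * E)\<up>"
      by (rule mult_in_mult[OF D'(2) E'(2) b])
    fix t assume t: "gmult G' h k \<in> T t" "t \<lhd> b * c"
    obtain u where u: "t \<lhd>\<^bsub>u\<^esub> b * c"
      using t(2) belowE by blast
    obtain t' where t': "t' \<lhd> t" "gmult G' h k \<in> T t'"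
      using T_below[OF t(1)] .
    let ?y = "t' * u * b'"
    have "?y \<lhd> b"
      by (rule below_N(2)[OF belowI[OF b'(2)] viaD(3)[OF below_via_trans[OF t'(1) u]]])
    moreover have "h \<in> T ?y"
    proof -
      have "grng G' h \<in> T (t' * u)"
        using T_quotient_rng[OF t'(2) T_via(2)[OF t(1) u]] G'.rng_mult[OF hk] by simp
      then show ?thesis
        using T_multI[OF _ phiD(4)[OF D b'(1)]] phiD(2)[OF D] G'.comp_rng G'.rng_mult_self by metis
    qed
    ultimately have "?y \<in> D"
      using germ_below phiD(3)[OF D b(1)] by blast
    then have "?y * c' \<in> (D * E)\<up>"
      using mult_in_mult[OF D'(2) E'(2) _ c'(1)] by blast
    moreover have "t' * (u * (b' * c')) \<lhd> t"
      by (rule below_N(1)[OF t'(1) N_cross(2)[OF via_mult[OF b'(2) c'(2)] u]])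
    ultimately show "t \<in> (D * E)\<up>"
      using coset_below[OF coset_mult[OF D'(2) E'(2) DE]] by (metis mult.assoc)
  qed
qed

text \<open>
  An element \<open>t\<close> below \<open>s\<close> is replaced by a smaller \<open>r\<close> for which \<open>c\<close> serves as a witness. Then
  \<open>c * r * c\<close> is below \<open>c\<close> and so lies in \<open>D\<close>, whence \<open>r = s * (c * r * c) * s\<close> lies in \<open>D\<star>\<close>.
\<close>

lemma phi_inv:
  assumes D: "(D, h) \<in> \<phi>"
  shows "(D\<star>, ginv G' h) \<in> \<phi>"
proof -
  note D' = phiD(1)[OF D] dcosetD[OF phiD(1)[OF D]]
  have h: "ginv G' (ginv G' h) = h"
    using G'.inv_inv phiD(2)[OF D] by blast
  obtain c where c: "c \<in> D"
    using D'(3) by blast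
  obtain a s where a: "a \<in> D" "a \<lhd>\<^bsub>s\<^esub> c" "s \<in> D\<star>"
    using dcoset_belowE[OF D'(1) c] by metis
  note hT = phiD(4)[OF D]
  show ?thesis
  proof (rule phi_if_maximal)
    show "D\<star> \<in> dcosets"
      by (rule dcoset_star[OF D'(1)])
    show "ginv G' h \<in> T x" if "x \<in> D\<star>" for x
      using starE[OF D'(2) that] hT T_via(2) by metis
    then have s: "ginv G' h \<in> T s"
      using a(3) by blast
    show "s \<in> D\<star>"
      by (rule a(3))
    fix t assume t: "ginv G' h \<in> T t" "t \<lhd> s"
    obtain b where b: "t \<lhd>\<^bsub>b\<^esub> s"
      using t(2) belowE by blast
    obtain t' where t': "t' \<lhd> t" "ginv G' h \<in> T t'"
      using T_below[OF t(1)] .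
    have hb: "h \<in> T b"
      using T_via(2)[OF t(1) b] h by simp
    \<comment> \<open>an element below \<open>t\<close> that, unlike \<open>t\<close> itself, is below \<open>s\<close> via \<open>c\<close>\<close>
    let ?r = "t' * b * (s * a * s)"
    have r: "ginv G' h \<in> T ?r"
      using T_triple[OF t'(2) _ T_triple[OF s _ s]] hb hT[OF a(1)] h by simp
    have rc: "?r \<lhd>\<^bsub>c\<^esub> s"
      by (rule via_N_left[OF via_switch[OF a(2)] viaD(3)[OF below_via_trans[OF t'(1) b]]])
    have "t' * (b * s * (a * s)) \<lhd> t"
      by (rule below_N(1)[OF t'(1) N_mult[OF Z_N[OF viaD(6)[OF b]] viaD(3)[OF a(2)]]])
    then have rt: "?r \<lhd> t"
      by (simp add: mult.assoc)
    have "h \<in> T (c * ?r * c)"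
      by (rule T_triple[OF hT[OF c] r hT[OF c]])
    then have "c * ?r * c \<in> germ c h"
      by (rule germ_below[OF _ belowI[OF via_switch[OF rc]]])
    then have "c * ?r * c \<in> D"
      using phiD(3)[OF D c] by simp
    then have "s * (c * ?r * c) * s \<in> D\<star>"
      using star_mult3[OF D'(2) a(3) _ a(3)] by blast
    moreover have "s * (c * ?r * c) * s = s * c * ?r * c * s"
      by (simp add: mult.assoc)
    moreover have "\<dots> = ?r"
      using viaD(1,2)[OF rc] by (simp only:)
    ultimately show "t \<in> D\<star>"
      using coset_below[OF coset_star[OF D'(2)] _ rt] by simp
  qed
qed

lemma phi_src:
  assumes D: "(D, h) \<in> \<phi>"
  shows "(src D, gsrc G' h) \<in> \<phi>" "(rng D, grng G' h) \<in> \<phi>"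
proof -
  note h = phiD(2)[OF D] and D' = dcosetD(1)[OF phiD(1)[OF D]]
  show "(src D, gsrc G' h) \<in> \<phi>"
    using phi_mult[OF phi_inv[OF D] D G'.comp_inv_left[OF h] src_star[OF D']]
    by (simp add: source_def gsrc_def)
  show "(rng D, grng G' h) \<in> \<phi>"
    using phi_mult[OF D phi_inv[OF D] G'.comp_inv[OF h]] rng_star[OF D']
    by (simp add: range_coset_def grng_def)
qed

lemma phi_comp:
  assumes D: "(D, h) \<in> \<phi>" and E: "(E, k) \<in> \<phi>" and hk: "gsrc G' h = grng G' k"
  shows "src D = rng E"
proof -
  note D' = phiD(1)[OF D] dcosetD[OF phiD(1)[OF D]]
    and E' = phiD(1)[OF E] dcosetD[OF phiD(1)[OF E]]
  obtain n m where "n \<in> src D" "n \<in> N" "m \<in> rng E" "m \<in> N"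
    using central_exists D' E' Z_N by (metis ex_in_conv)
  then show ?thesis
    using phi_unit_unique phi_src(1)[OF D] phi_src(2)[OF E] hk by metis
qed

lemma phi_subset: "\<phi> \<subseteq> gset GD \<times> gset G'"
  using phiD by (auto simp: GD_simps)

text \<open>
  For star-bijectivity, a unit \<open>u\<close> related to the range of \<open>D\<close> is in the domain of
  \<open>a' * s\<close>, so it is the range of a point \<open>i\<close> in the domain of \<open>a'\<close>; the class of \<open>a'\<close> at \<open>i\<close> shares
  with \<open>D\<close> its range and the element \<open>a'\<close>, and so equals \<open>D\<close>. The preimage of an open set is
  open since with \<open>D\<close> all cosets containing some \<open>d\<close> belong to that set, so that every point in
  the domain of \<open>d\<close> is in the preimage.
\<close>

lemma zakrzewski_phi: "zakrzewski_morphism GD G' \<phi>"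
  unfolding zakrzewski_morphism_def
proof (intro conjI etale_groupoid_GD etale_G' allI impI)
  show "functorial_relation GD G' \<phi>"
    unfolding functorial_relation_def
  proof (intro conjI ballI phi_subset)
    show "case p of (D, h) \<Rightarrow> (ginv GD D, ginv G' h) \<in> \<phi>" if "p \<in> \<phi>" for p
      using that phi_inv by (auto simp: GD_simps split: prod.split)
    have "src D = rng E \<and> ((D * E)\<up>, gmult G' h k) \<in> \<phi>"
      if "(D, h) \<in> \<phi>" "(E, k) \<in> \<phi>" "gsrc G' h = grng G' k" for D h E k
      using that phi_comp phi_mult G'.comp_iff phiD(2) by metis
    then show "case p of (D, h) \<Rightarrow> \<forall>(E, k)\<in>\<phi>. gsrc G' h = grng G' k \<longrightarrow>
        gsrc GD D = grng GD E \<and> (gmult GD D E, gmult G' h k) \<in> \<phi>" if "p \<in> \<phi>" for p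
      using that unfolding GD_simps GD_rng by fast
  qed
  show "star_bijective GD G' \<phi>"
    unfolding star_bijective_def GD_simps GD_rng
  proof (intro ballI impI)
    fix D u assume D: "D \<in> dcosets" "u \<in> gunits G'" "(rng D, u) \<in> \<phi>"
    note D' = dcosetD[OF D(1)]
    obtain a where a: "a \<in> D"
      using D'(2) by blast
    obtain a' s where a': "a' \<in> D" "a' \<lhd>\<^bsub>s\<^esub> a" "s \<in> D\<star>"
      using dcoset_belowE[OF D(1) a] by metis
    have n: "a' * s \<in> rng D" "a' * s \<in> N"
      using mult_in_rng[OF D'(1) a'(3,1)] viaD(3)[OF a'(2)] by blast+
    then have "u \<in> T (a' * s)"
      using phiD(4)[OF D(3)] by blast
    then obtain i j where ij: "i \<in> T a'" "j \<in> T s" "gcomp G' i j" "u = gmult G' i j"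
      using T_multE by metis
    have i: "grng G' i = u"
      using G'.rng_mult[OF ij(3)] ij(4) G'.unit_eq(2)[OF D(2)] by simp
    let ?E = "germ a' i"
    have E: "(?E, i) \<in> \<phi>" "a' \<in> ?E"
      using phiI germ_self ij(1) by blast+
    note E' = dcosetD(1)[OF phiD(1)[OF E(1)]]
    have "(rng ?E, u) \<in> \<phi>"
      using phi_src(2)[OF E(1)] i by simp
    moreover obtain m where "m \<in> rng ?E" "m \<in> N"
      using central_exists[OF E' E(2)] Z_N by metis
    ultimately have "rng D = rng ?E"
      using phi_unit_unique[OF D(3) n] by blast
    then have "D = ?E"
      using coset_eq_rng[OF D'(1) E' a'(1) E(2)] by blast
    then have "i \<in> gset G' \<and> grng G' i = u \<and> (D, i) \<in> \<phi>"
      using i E(1) phiD(2) by metis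
    moreover have "j = i" if "j \<in> gset G' \<and> grng G' j = u \<and> (D, j) \<in> \<phi>" for j
    proof -
      have "j \<in> T a'"
        using phiD(4)[OF _ a'(1)] that by blast
      then show ?thesis
        using T_eq_rng[OF _ ij(1)] that i by simp
    qed
    ultimately show "\<exists>!i. i \<in> gset G' \<and> grng G' i = u \<and> (D, i) \<in> \<phi>"
      by blast
  qed
  fix U assume U: "openin (gtop GD) U"
  show "openin (gtop G') (\<phi> `` U)"
  proof (subst openin_subopen, rule ballI)
    fix h assume "h \<in> \<phi> `` U"
    then obtain D where D: "D \<in> U" "(D, h) \<in> \<phi>"
      by blast
    then obtain d where d: "d \<in> D" "\<forall>E\<in>dcosets. d \<in> E \<longrightarrow> E \<in> U"
      using U unfolding openin_GD by blast
    have "T d \<subseteq> \<phi> `` U"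
      using d(2) germ_dcoset germ_self phiI by (metis ImageI subsetI)
    then show "\<exists>V. openin (gtop G') V \<and> h \<in> V \<and> V \<subseteq> \<phi> `` U"
      using T_open phiD(4)[OF D(2) d(1)] by blast
  qed
qed

lemma proj_sec: "h \<in> T a \<Longrightarrow> \<pi>' (sec a h) = h"
  and sec_continuous: "continuous_map (subtopology (gtop G') (T a)) (gtop F') (sec a)"
  using sections[of a] by (simp_all add: slice_sections_def sec_def[abs_def])

lemma sec_closed: "h \<in> T a \<Longrightarrow> sec a h \<in> gset F'"
  using continuous_map_image_subset_topspace[OF sec_continuous, of a] T_closed[of h a]
  unfolding gset_def topspace_subtopology by blast

lemma proj_functor: "groupoid_functor F' G' \<pi>'"
  and proj_inj: "inj_on \<pi>' (gunits F')"
  using bundle_FG by (simp_all add: groupoid_bundle_def)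

lemma proj_comp: "gcomp F' e f \<Longrightarrow> gcomp G' (\<pi>' e) (\<pi>' f)"
  and proj_mult: "gcomp F' e f \<Longrightarrow> \<pi>' (gmult F' e f) = gmult G' (\<pi>' e) (\<pi>' f)"
  using proj_functor by (simp_all add: groupoid_functor_def)

lemma proj_src: assumes "e \<in> gset F'" shows "\<pi>' (gsrc F' e) = gsrc G' (\<pi>' e)"
  using proj_comp[OF F'.comp_src[OF assms]] proj_mult[OF F'.comp_src[OF assms]]
    F'.mult_src[OF assms] G'.cancel(1) by (metis gsrc_def)

lemma proj_rng: assumes "e \<in> gset F'" shows "\<pi>' (grng F' e) = grng G' (\<pi>' e)"
  using proj_comp[OF F'.comp_rng[OF assms]] proj_mult[OF F'.comp_rng[OF assms]]
    F'.rng_mult_self[OF assms] G'.cancel(2) by (metis grng_def)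

text \<open>
  Injectivity on units lets the projection detect composability.
\<close>

lemma comp_lift:
  assumes "e \<in> gset F'" "f \<in> gset F'" "gcomp G' (\<pi>' e) (\<pi>' f)"
  shows "gcomp F' e f"
proof -
  have "\<pi>' (gsrc F' e) = \<pi>' (grng F' f)"
    using assms proj_src proj_rng G'.comp_iff G'.comp_closed by metis
  then have "gsrc F' e = grng F' f"
    using proj_inj F'.src_unit F'.rng_unit assms by (meson inj_onD)
  then show ?thesis
    using F'.comp_iff assms by blast
qed

lemma sec_comp: "h \<in> T a \<Longrightarrow> k \<in> T b \<Longrightarrow> gcomp G' h k \<Longrightarrow> gcomp F' (sec a h) (sec b k)"
  by (simp add: comp_lift sec_closed proj_sec)

lemma sec_mult:
  assumes h: "h \<in> T a" and k: "k \<in> T b" and hk: "gcomp G' h k"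
  shows "sec (a * b) (gmult G' h k) = gmult F' (sec a h) (sec b k)"
proof -
  have "gmult G' h k \<in> slice_mult G' (T a) (T b)"
    using assms unfolding slice_mult_def by blast
  then have "sec (a * b) (gmult G' h k) = (THE f. \<exists>g\<in>T a. \<exists>l\<in>T b. gcomp G' g l \<and>
      gmult G' h k = gmult G' g l \<and> f = gmult F' (the (\<theta> a g)) (the (\<theta> b l)))"
    by (simp add: sec_def section_hom section_mult_def)
  also have "\<dots> = gmult F' (sec a h) (sec b k)"
  proof (rule the_equality)
    show "\<exists>g\<in>T a. \<exists>l\<in>T b. gcomp G' g l \<and> gmult G' h k = gmult G' g l \<and>
        gmult F' (sec a h) (sec b k) = gmult F' (the (\<theta> a g)) (the (\<theta> b l))"
      using assms unfolding sec_def by blast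
    fix f assume "\<exists>g\<in>T a. \<exists>l\<in>T b. gcomp G' g l \<and> gmult G' h k = gmult G' g l \<and>
        f = gmult F' (the (\<theta> a g)) (the (\<theta> b l))"
    then obtain g l where g: "g \<in> T a" "l \<in> T b" "gcomp G' g l" "gmult G' h k = gmult G' g l"
        "f = gmult F' (sec a g) (sec b l)"
      unfolding sec_def by blast
    have "grng G' g = grng G' h" "gsrc G' l = gsrc G' k"
      using G'.rng_mult[OF hk] G'.rng_mult[OF g(3)] G'.src_mult[OF hk] G'.src_mult[OF g(3)] g(4)
      by metis+
    then have "g = h" "l = k"
      using T_eq_rng[OF g(1) h] T_eq_src[OF g(2) k] by blast+
    then show "f = gmult F' (sec a h) (sec b k)"
      using g(5) by simp
  qed
  finally show ?thesis .
qed

lemma sec_equiv: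
  assumes D: "(D, h) \<in> \<phi>" and ab: "a \<in> D" "b \<in> D" "a \<approx>\<^bsub>D\<^esub> b"
  shows "sec a h = sec b h"
proof -
  obtain s t where st: "s \<in> D\<star>" "t \<in> D\<star>" "s * a * t = s * b * t"
    using ab(3) unfolding atlas_equiv_def by blast
  let ?k = "ginv G' h"
  have k: "?k \<in> T s" "?k \<in> T t"
    using phiD(4)[OF phi_inv[OF D]] st by blast+
  have h: "h \<in> gset G'" "gcomp G' ?k h"
    using phiD(2)[OF D] G'.comp_inv_left by blast+
  have u: "gcomp G' (gmult G' ?k h) ?k"
    using G'.assoc(1)[OF h(2) G'.comp_inv[OF h(1)]] .
  have main: "sec (s * c * t) (gmult G' (gmult G' ?k h) ?k)
      = gmult F' (gmult F' (sec s ?k) (sec c h)) (sec t ?k)"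
    "gcomp F' (sec s ?k) (sec c h)"
    "gcomp F' (gmult F' (sec s ?k) (sec c h)) (sec t ?k)" if "c \<in> D" for c
  proof -
    note c = phiD(4)[OF D that]
    have m: "gmult G' ?k h \<in> T (s * c)" "sec (s * c) (gmult G' ?k h) = gmult F' (sec s ?k) (sec c h)"
      using T_multI[OF k(1) c h(2)] sec_mult[OF k(1) c h(2)] .
    show "sec (s * c * t) (gmult G' (gmult G' ?k h) ?k)
        = gmult F' (gmult F' (sec s ?k) (sec c h)) (sec t ?k)"
      using sec_mult[OF m(1) k(2) u] m(2) by simp
    show "gcomp F' (gmult F' (sec s ?k) (sec c h)) (sec t ?k)"
      using sec_comp[OF m(1) k(2) u] m(2) by simp
    show "gcomp F' (sec s ?k) (sec c h)"
      by (rule sec_comp[OF k(1) c h(2)])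
  qed
  have "gmult F' (sec s ?k) (sec a h) = gmult F' (sec s ?k) (sec b h)"
    using F'.right_cancel main ab st(3) by metis
  then show ?thesis
    using F'.left_cancel main ab by metis
qed

definition P where "P = {(f, h). f \<in> gset FD \<and> h \<in> gset G' \<and> (coset_proj f, h) \<in> \<phi>}"

lemma P_iff: "(f, h) \<in> P \<longleftrightarrow> f \<in> dclasses \<and> (coset_proj f, h) \<in> \<phi>"
  using phiD(2) by (auto simp: P_def FD_simps)

text \<open>
  The choice of a representative does not matter by \<open>sec_equiv\<close>, see \<open>tau_cls\<close>.
\<close>

definition \<tau> where
  "\<tau> = restrict (\<lambda>(p, h). sec (SOME a. a \<in> snd p \<and> p = cls a (snd p)) h) P"

lemma in_P:
  assumes "a \<in> D" "(D, h) \<in> \<phi>"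
  shows "(cls a D, h) \<in> P"
  using assms phiD(1)[OF assms(2)] by (simp add: P_iff dclassesI coset_proj_cls)

lemma P_E:
  assumes "(p, h) \<in> P"
  obtains a D where "p = cls a D" "a \<in> D" "(D, h) \<in> \<phi>" "D \<in> dcosets"
proof -
  have p: "p \<in> dclasses" "(coset_proj p, h) \<in> \<phi>"
    using assms by (simp_all add: P_iff)
  obtain a D where "p = cls a D" "a \<in> D" "D \<in> dcosets"
    using dclassesE[OF p(1)] .
  then show thesis
    using that p(2) coset_proj_cls by simp
qed

lemma tau_cls:
  assumes a: "a \<in> D" and D: "(D, h) \<in> \<phi>"
  shows "\<tau> (cls a D, h) = sec a h"
proof -
  note D' = phiD(1)[OF D]
  let ?b = "SOME b. b \<in> D \<and> cls a D = cls b D"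
  have b: "?b \<in> D \<and> cls a D = cls ?b D"
    by (rule someI[of _ a]) (use a in simp)
  then have "sec ?b h = sec a h"
    using sec_equiv[OF D _ a] cls_eq[OF D'] a equiv_sym by metis
  then show ?thesis
    using in_P[OF assms] snd_dcls[OF D'] by (simp add: \<tau>_def)
qed

abbreviation PG where "PG \<equiv> pullback_groupoid FD coset_proj \<phi> G'"

lemma PG_simps:
  "gtop PG = subtopology (prod_topology (gtop FD) (gtop G')) P"
  "gset PG = P"
  "gcomp PG p q \<longleftrightarrow> p \<in> P \<and> q \<in> P \<and> gcomp G' (snd p) (snd q)"
  "gmult PG p q = (gmult FD (fst p) (fst q), gmult G' (snd p) (snd q))"
  by (auto simp: pullback_groupoid_def gset_def Let_def P_def)

lemma morphism: "zakrzewski_pierce_morphism FD GD coset_proj F' G' \<pi>' (\<phi>, \<tau>)"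
  unfolding zakrzewski_pierce_morphism_def prod.case Let_def
proof (intro conjI zakrzewski_phi)
  show "\<tau> \<in> extensional (gset PG)"
    by (simp add: PG_simps \<tau>_def)
  have val: "\<tau> p \<in> gset F'" "\<pi>' (\<tau> p) = snd p" if p: "p \<in> P" for p
  proof -
    obtain f h where fh: "p = (f, h)"
      by fastforce
    obtain a D where "f = cls a D" "a \<in> D" "(D, h) \<in> \<phi>"
      using P_E p[unfolded fh] by metis
    then show "\<tau> p \<in> gset F'" "\<pi>' (\<tau> p) = snd p"
      using fh tau_cls phiD(4) sec_closed proj_sec by simp_all
  qed
  then show "\<forall>(f, h)\<in>gset PG. \<pi>' (\<tau> (f, h)) = h"
    unfolding PG_simps by fastforce
  show "continuous_map (gtop PG) (gtop F') \<tau>"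
    unfolding PG_simps
  proof (rule continuous_map_pairs_atI)
    show "P \<subseteq> topspace (gtop FD) \<times> topspace (gtop G')"
      by (auto simp: P_def gset_def)
    show "\<tau> (p, h) \<in> topspace (gtop F')" if "(p, h) \<in> P" for p h
      using val(1)[OF that] by (simp add: gset_def)
    fix p h V assume p: "(p, h) \<in> P" and V: "openin (gtop F') V" "\<tau> (p, h) \<in> V"
    obtain a D where a: "p = cls a D" "a \<in> D" "(D, h) \<in> \<phi>" "D \<in> dcosets"
      using P_E[OF p] .
    \<comment> \<open>near \<open>[a, D]\<close> all classes are represented by \<open>a\<close>, so \<open>\<tau>\<close> is there a value of the single
      continuous section \<open>\<theta> a\<close>\<close>
    let ?U = "{cls a E |E. E \<in> dcosets \<and> a \<in> E \<and> a \<in> E}"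
    let ?W = "{k \<in> T a. sec a k \<in> V}"
    have "topspace (subtopology (gtop G') (T a)) = T a"
      using openin_subset[OF T_open] by auto
    then have "openin (subtopology (gtop G') (T a)) ?W"
      using openin_continuous_map_preimage[OF sec_continuous V(1), of a] by simp
    then have W: "openin (gtop G') ?W"
      using openin_trans_full T_open by blast
    have hW: "h \<in> ?W"
      using V(2) a tau_cls phiD(4) by simp
    have pU: "p \<in> ?U"
      using a by blast
    have V': "\<tau> (q, k) \<in> V" if q: "q \<in> ?U" "k \<in> ?W" "(q, k) \<in> P" for q k
    proof -
      obtain E where E: "q = cls a E" "a \<in> E" "E \<in> dcosets"
        using q(1) by blast
      then have "(E, k) \<in> \<phi>"
        using q(3) coset_proj_cls by (simp add: P_iff)
      then show ?thesis
        using q(2) tau_cls E by simp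
    qed
    show "\<exists>U W. openin (gtop FD) U \<and> openin (gtop G') W \<and> p \<in> U \<and> h \<in> W \<and>
        (\<forall>q\<in>U. \<forall>k\<in>W. (q, k) \<in> P \<longrightarrow> \<tau> (q, k) \<in> V)"
    proof (intro exI conjI ballI impI)
      show "\<tau> (q, k) \<in> V" if "q \<in> ?U" "k \<in> ?W" "(q, k) \<in> P" for q k
        by (rule V'[OF that])
    qed (rule openin_FD_basic W pU hW)+
  qed
  show "groupoid_functor PG F' \<tau>"
    unfolding groupoid_functor_def
  proof (intro conjI ballI allI impI)
    show "\<tau> p \<in> gset F'" if "p \<in> gset PG" for p
      using that val(1) PG_simps(2) by simp
    fix x y assume xy: "gcomp PG x y"
    obtain p h where p: "x = (p, h)" "(p, h) \<in> P"
      using xy unfolding PG_simps by (metis surj_pair)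
    obtain q k where q: "y = (q, k)" "(q, k) \<in> P"
      using xy unfolding PG_simps by (metis surj_pair)
    have hk: "gcomp G' h k"
      using xy p q unfolding PG_simps by simp
    obtain b B where b: "p = cls b B" "b \<in> B" "(B, h) \<in> \<phi>" "B \<in> dcosets"
      using P_E[OF p(2)] .
    obtain c C where c: "q = cls c C" "c \<in> C" "(C, k) \<in> \<phi>" "C \<in> dcosets"
      using P_E[OF q(2)] .
    have BC: "src B = rng C"
      using phi_comp b c hk G'.comp_iff G'.comp_closed by metis
    have T: "h \<in> T b" "k \<in> T c"
      using phiD(4) b c by blast+
    have vals: "\<tau> x = sec b h" "\<tau> y = sec c k"
      using tau_cls p q b c by simp_all
    show "gcomp F' (\<tau> x) (\<tau> y)"
      unfolding vals by (rule sec_comp[OF T hk])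
    have "gmult PG x y = (cls (b * c) ((B * C)\<up>), gmult G' h k)"
      using FD_mult[OF b(4,2) c(4,2) BC] p(1) q(1) b(1) c(1) by (simp add: PG_simps)
    then have "\<tau> (gmult PG x y) = sec (b * c) (gmult G' h k)"
      using tau_cls[OF mult_in_mult phi_mult[OF b(3) c(3) hk BC]] dcosetD(1) b c by simp
    then show "\<tau> (gmult PG x y) = gmult F' (\<tau> x) (\<tau> y)"
      unfolding vals using sec_mult[OF T hk] by simp
  qed
qed

lemma phi_the:
  assumes "a \<in> D" "(D, h) \<in> \<phi>"
  shows "(THE E. E \<in> dom (directed_coset_rep N Z a) \<and> (E, h) \<in> \<phi>) = D"
proof (rule the_equality)
  show "D \<in> dom (directed_coset_rep N Z a) \<and> (D, h) \<in> \<phi>"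
    unfolding dom_directed_coset_rep using assms phiD(1) by blast
  show "E = D" if "E \<in> dom (directed_coset_rep N Z a) \<and> (E, h) \<in> \<phi>" for E
  proof -
    have "a \<in> E" "(E, h) \<in> \<phi>"
      using that unfolding dom_directed_coset_rep by simp_all
    then show ?thesis
      using phiD(3) assms by metis
  qed
qed

lemma induced: "\<theta> = induced_hom (\<phi>, \<tau>) \<circ> directed_coset_rep N Z"
proof (rule ext, rule ext)
  fix a h
  let ?\<mu> = "directed_coset_rep N Z a"
  show "\<theta> a h = (induced_hom (\<phi>, \<tau>) \<circ> directed_coset_rep N Z) a h"
  proof (cases "h \<in> T a")
    case True
    let ?D = "germ a h"
    have D: "?D \<in> dom ?\<mu>" "(?D, h) \<in> \<phi>" "a \<in> ?D"
      using germ_dcoset germ_self phiI True unfolding dom_directed_coset_rep by blast+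
    have "(THE D. D \<in> dom ?\<mu> \<and> (D, h) \<in> \<phi>) = ?D"
      by (rule phi_the[OF D(3,2)])
    then have "induced_hom (\<phi>, \<tau>) ?\<mu> h = Some (\<tau> (the (?\<mu> ?D), h))"
      using D(1,2) unfolding induced_hom_def by auto
    also have "the (?\<mu> ?D) = cls a ?D"
      using D(1,3) dom_directed_coset_rep by (auto simp: directed_coset_rep_def)
    finally show ?thesis
      using tau_cls[OF D(3,2)] True by (auto simp: sec_def)
  next
    case False
    then have "h \<notin> \<phi> `` dom ?\<mu>"
      using phiD(4) unfolding dom_directed_coset_rep by blast
    then show ?thesis
      using False by (simp add: induced_hom_def domIff)
  qed
qed

text \<open>
  The two cosets through \<open>a\<close> that could be related to the same \<open>h\<close> have the same range, by
  functoriality applied to \<open>D\<star>\<close> and \<open>E\<close>, and so coincide. Together with the comparison of domains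
  this identifies the coset through \<open>a\<close> as the class of \<open>a\<close> at \<open>h\<close>.
\<close>

lemma unique:
  assumes m: "zakrzewski_pierce_morphism FD GD coset_proj F' G' \<pi>' (\<psi>, \<sigma>)"
    and ind: "\<theta> = induced_hom (\<psi>, \<sigma>) \<circ> directed_coset_rep N Z"
  shows "\<psi> = \<phi>" "\<sigma> = \<tau>"
proof -
  let ?\<mu> = "directed_coset_rep N Z"
  have psi: "functorial_relation GD G' \<psi>" "\<psi> \<subseteq> gset GD \<times> gset G'"
    using m by (simp_all add: zakrzewski_pierce_morphism_def zakrzewski_morphism_def functorial_relation_def)
  have psi_inv: "(D\<star>, ginv G' h) \<in> \<psi>" if "(D, h) \<in> \<psi>" for D h
    using psi(1) that unfolding functorial_relation_def GD_simps by fast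
  have psi_comp: "src D = rng E" if "(D, h) \<in> \<psi>" "(E, k) \<in> \<psi>" "gsrc G' h = grng G' k" for D h E k
    using psi(1) that unfolding functorial_relation_def GD_simps GD_rng by fast
  have psi_D: "D \<in> dcosets" "h \<in> gset G'" if "(D, h) \<in> \<psi>" for D h
    using psi(2) that by (auto simp: GD_simps)
  have T: "h \<in> T a \<longleftrightarrow> (\<exists>D\<in>dcosets. a \<in> D \<and> (D, h) \<in> \<psi>)" for a h
  proof -
    have "h \<in> T a \<longleftrightarrow> h \<in> \<psi> `` dom (?\<mu> a)"
      by (subst ind) (simp add: induced_hom_def domIff)
    then show ?thesis
      unfolding dom_directed_coset_rep by blast
  qed
  have eq: "D = E" if "(D, h) \<in> \<psi>" "(E, h) \<in> \<psi>" "a \<in> D" "a \<in> E" for D E h a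
  proof -
    have "src (D\<star>) = rng E"
      using psi_comp[OF psi_inv[OF that(1)] that(2)] G'.src_inv psi_D(2)[OF that(1)] by simp
    then show ?thesis
      using coset_eq_rng[OF _ _ that(3,4)] src_star psi_D(1) that dcosetD(1) by metis
  qed
  have germ: "D = germ a h" if D: "(D, h) \<in> \<psi>" "a \<in> D" for D h a
  proof
    show "D \<subseteq> germ a h"
    proof
      fix b assume "b \<in> D"
      then obtain d where "d \<in> D" "d \<lhd> a" "d \<lhd> b"
        using dcoset_lower[OF psi_D(1)[OF D(1)] D(2)] by blast
      then show "b \<in> germ a h"
        using germI T D(1) psi_D(1) by blast
    qed
    show "germ a h \<subseteq> D"
    proof
      fix b assume "b \<in> germ a h"
      then obtain d where d: "h \<in> T d" "d \<lhd> a" "d \<lhd> b"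
        using germE by metis
      then obtain E where E: "E \<in> dcosets" "d \<in> E" "(E, h) \<in> \<psi>"
        using T by blast
      then have "a \<in> E" "b \<in> E"
        using d coset_below dcosetD(1) by blast+
      then show "b \<in> D"
        using eq[OF E(3) D(1) _ D(2)] by blast
    qed
  qed
  show *: "\<psi> = \<phi>"
  proof (rule set_eqI, clarify)
    fix D h
    show "(D, h) \<in> \<psi> \<longleftrightarrow> (D, h) \<in> \<phi>"
    proof
      assume D: "(D, h) \<in> \<psi>"
      then obtain a where "a \<in> D"
        using dcosetD(2) psi_D(1) by blast
      then show "(D, h) \<in> \<phi>"
        using germ[OF D] phiI T D psi_D(1) by metis
    next
      assume D: "(D, h) \<in> \<phi>"
      then obtain a where a: "D = germ a h" "h \<in> T a"
        unfolding \<phi>_def by blast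
      then show "(D, h) \<in> \<psi>"
        using germ T by metis
    qed
  qed
  have "\<sigma> \<in> extensional P"
    using m unfolding zakrzewski_pierce_morphism_def Let_def * by (simp add: PG_simps)
  moreover have "\<tau> \<in> extensional P"
    by (simp add: \<tau>_def)
  moreover have "\<sigma> x = \<tau> x" if x: "x \<in> P" for x
  proof -
    obtain p h where p: "x = (p, h)" "(p, h) \<in> P"
      using x by (metis surj_pair)
    obtain a D where a: "p = cls a D" "a \<in> D" "(D, h) \<in> \<phi>" "D \<in> dcosets"
      using P_E[OF p(2)] .
    have "D \<in> dom (?\<mu> a)"
      using a unfolding dom_directed_coset_rep by blast
    moreover have "(THE D. D \<in> dom (?\<mu> a) \<and> (D, h) \<in> \<phi>) = D"
      by (rule phi_the[OF a(2,3)])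
    ultimately have "\<theta> a h = Some (\<sigma> (the (?\<mu> a D), h))"
      using a(3) by (subst ind) (auto simp: induced_hom_def *)
    moreover have "the (?\<mu> a D) = cls a D"
      using a by (simp add: directed_coset_rep_def)
    ultimately show ?thesis
      using tau_cls[OF a(2,3)] p(1) a(1) by (simp add: sec_def)
  qed
  ultimately show "\<sigma> = \<tau>"
    by (rule extensionalityI)
qed

end

theorem theorem11p18:
  fixes N Z :: "'a::semigroup_mult set"
  assumes "structured_semigroup N Z"
    and "symmetric_subsemigroup Z"
  shows "zakrzewski_universal TYPE('e) TYPE('h) N Z
           (directed_coset_bundle N Z) (directed_coset_groupoid N Z) coset_proj
           (directed_coset_rep N Z)"
  unfolding zakrzewski_universal_def
proof (intro conjI allI impI)
  interpret structured N Z
    using assms(1) by unfold_locales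
  show "bundle_representation N Z FD GD coset_proj (directed_coset_rep N Z)"
    by (rule bundle_representation_FD[OF assms(2)])
  fix F' :: "'e top_groupoid" and G' :: "'h top_groupoid" and \<pi>' \<theta>
  assume "bundle_representation N Z F' G' \<pi>' \<theta>"
  then interpret structured_representation N Z F' G' \<pi>' \<theta>
    by unfold_locales
  show "\<exists>!m. zakrzewski_pierce_morphism FD GD coset_proj F' G' \<pi>' m \<and>
      \<theta> = induced_hom m \<circ> directed_coset_rep N Z"
  proof (rule ex1I)
    show "zakrzewski_pierce_morphism FD GD coset_proj F' G' \<pi>' (\<phi>, \<tau>) \<and>
        \<theta> = induced_hom (\<phi>, \<tau>) \<circ> directed_coset_rep N Z"
      using morphism induced by blast
    show "m = (\<phi>, \<tau>)" if "zakrzewski_pierce_morphism FD GD coset_proj F' G' \<pi>' m \<and>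
        \<theta> = induced_hom m \<circ> directed_coset_rep N Z" for m
      using that unique by (metis surj_pair)
  qed
qed

end
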